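(* Let $k\ge1$ and let $\varphi^{k-1}\in\mathcal V^1(\mathcal T^{k-1})$, $\varphi^k\in\mathcal V^1(\mathcal T^k)$, $\mu^k\in\mathcal V^1(\mathcal T^k)$, $v^k\in H(\mathrm{div},\mathcal T^k)$ be given. Then there exist $v_h^{k+1}\in H(\mathrm{div},\mathcal T^{k+1})$, $\varphi_h^{k+1}\in\mathcal V^1(\mathcal T^{k+1})$ and $\mu_h^{k+1}\in\mathcal V^1(\mathcal T^{k+1})$ such that for all $w\in H(\mathrm{div},\mathcal T^{k+1})$, $\Phi\in\mathcal V^1(\mathcal T^{k+1})$, $\Psi\in\mathcal V^1(\mathcal T^{k+1})$: $$\tfrac1{2\tau}\big(\rho^kv_h^{k+1}-\rho^{k-1}v^k+\rho^{k-1}(v_h^{k+1}-v^k),w\big)+a(\rho^kv^k+J^k,v_h^{k+1},w)+(2\eta^kDv_h^{k+1},Dw)-(\mu_h^{k+1}\nabla\varphi^k+\rho^kg,w)=0,$$ $$\tfrac1\tau(\varphi_h^{k+1}-\mathcal P^{k+1}\varphi^k,\Phi)+(m(\varphi^k)\nabla\mu_h^{k+1},\nabla\Phi)+(v_h^{k+1}\cdot\nabla\varphi^k,\Phi)=0,$$ $$\sigma\epsilon(\nabla\varphi_h^{k+1},\nabla\Psi)+(F_+'(\varphi_h^{k+1})+F_-'(\mathcal P^{k+1}\varphi^k),\Psi)-(\mu_h^{k+1},\Psi)=0.$$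
   Context: $\Omega\subset\mathbb R^n$, $n\in\{2,3\}$, is a bounded domain; $(\cdot,\cdot)$ is the $L^2(\Omega)$ inner product (for scalar-, vector- or matrix-valued functions). $\sigma,\epsilon>0$ and the time step $\tau>0$ are constants, $g\in L^2(\Omega)^n$ is the given gravitational force, $Dv=\frac12(\nabla v+(\nabla v)^t)$. Meshes and spaces: for each time index $k$, $\mathcal T^k$ is a conforming triangulation of $\overline\Omega$ into closed simplices (meshes for different $k$ may differ). $\mathcal V^j(\mathcal T^k)$, $j=1,2$, is the space of continuous functions on $\overline\Omega$ that are polynomials of degree at most $j$ on each $T\in\mathcal T^k$. $L^2_{(0)}(\Omega)$ is the space of $L^2$ functions with zero mean. $H(\mathrm{div},\mathcal T^k)=\{v\in\mathcal V^2(\mathcal T^k)^n:\ (\mathrm{div}\,v,q)=0\ \forall q\in\mathcal V^1(\mathcal T^k)\cap L^2_{(0)}(\Omega),\ v|_{\partial\Omega}=0\}$. Projection: $\mathcal P^k:H^1(\Omega)\to\mathcal V^1(\mathcal T^k)$ is a fixed projection operator with $\|\mathcal P^kv\|_{L^p(\Omega)}\le\|v\|_{L^p(\Omega)}$ and $\|\nabla\mathcal P^kv\|_{L^r(\Omega)}\le\|\nabla v\|_{L^r(\Omega)}$ for $v\in H^1(\Omega)$, $r\in[1,2]$, and $p\in[1,6)$ if $n=3$, $p\in[1,\infty)$ if $n=2$. Trilinear form: $a(u,v,w)=\frac12\int_\Omega((u\cdot\nabla)v)\cdot w\,dx-\frac12\int_\Omega((u\cdot\nabla)w)\cdot v\,dx$.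 Notation: $\rho^k=\rho(\varphi^k)$, $\eta^k=\eta(\varphi^k)$, $m^k=m(\varphi^k)$, $J^k=-\rho'(\varphi^k)m^k\nabla\mu^k$. Standing assumptions on the data: $\rho,\eta,m:\mathbb R\to\mathbb R$ are continuous with $\overline\rho\ge\rho\ge\underline\rho>0$, $\overline\eta\ge\eta\ge\underline\eta>0$, $\overline m\ge m\ge\underline m>0$. Moreover $\rho$ is smooth and monotone; for constants $0<\tilde\rho_1\le\tilde\rho_2$ it equals $\frac{\tilde\rho_2-\tilde\rho_1}2\varphi+\frac{\tilde\rho_1+\tilde\rho_2}2$ for $|\varphi|<1+\frac{\tilde\rho_1}{\tilde\rho_2-\tilde\rho_1}$ and is constant on each of $\varphi>1+\frac{2\tilde\rho_1}{\tilde\rho_2-\tilde\rho_1}$ and $\varphi<-1-\frac{2\tilde\rho_1}{\tilde\rho_2-\tilde\rho_1}$ ($\rho$ constant if $\tilde\rho_1=\tilde\rho_2$). $F=F_++F_-:\mathbb R\to\mathbb R$ is continuously differentiable, $F_+$ convex, $F_-$ concave (both differentiable). There are $C>0$ and $q\in[1,4]$ if $n=3$, $q\in[1,\infty)$ if $n=2$, with $|F(x)|\le C(1+|x|^q)$, $|F_\pm'(x)|\le C(1+|x|^{q-1})$. $F_+'$, viewed as an operator $H^1(\Omega)\to H^1(\Omega)^*$, is Newton (slantly) differentiable with Newton derivative $G$ satisfying $(G(\varphi)\delta\varphi,\delta\varphi)\ge0$ for all $\varphi,\delta\varphi\in H^1(\Omega)$. *)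

theory Defs
  imports "HOL-Analysis.Analysis"
begin

primrec C_k :: "nat \<Rightarrow> ('a::real_normed_vector \<Rightarrow> real) \<Rightarrow> bool" where
  "C_k 0 f \<longleftrightarrow> continuous_on UNIV f"
| "C_k (Suc n) f \<longleftrightarrow> (\<forall>x. f differentiable (at x)) \<and>
     (\<forall>h. C_k n (\<lambda>x. frechet_derivative f (at x) h))"

definition smooth :: "('a::real_normed_vector \<Rightarrow> real) \<Rightarrow> bool" where
  "smooth f \<longleftrightarrow> (\<forall>n. C_k n f)"

definition test_functions :: "(real^'n) set \<Rightarrow> (real^'n \<Rightarrow> real) set" where
  "test_functions \<Omega> =
     {\<psi>. smooth \<psi> \<and> compact (closure {x. \<psi> x \<noteq> 0}) \<and> closure {x. \<psi> x \<noteq> 0} \<subseteq> \<Omega>}"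

text \<open>
  Elements of function spaces over \<open>\<Omega>\<close> are represented by total functions, whose values outside
  \<open>\<Omega>\<close> (outside \<open>closure \<Omega>\<close> for the finite element spaces) play no role. Classes modulo null sets
  are represented by their members.
\<close>

definition locally_integrable :: "(real^'n) set \<Rightarrow> (real^'n \<Rightarrow> 'b::euclidean_space) \<Rightarrow> bool" where
  "locally_integrable \<Omega> f \<longleftrightarrow> (\<forall>K. compact K \<and> K \<subseteq> \<Omega> \<longrightarrow> integrable (lebesgue_on K) f)"

definition is_weak_grad :: "(real^'n) set \<Rightarrow> (real^'n \<Rightarrow> real) \<Rightarrow> (real^'n \<Rightarrow> real^'n) \<Rightarrow> bool" where
  "is_weak_grad \<Omega> v G \<longleftrightarrow> locally_integrable \<Omega> v \<and> locally_integrable \<Omega> G \<and>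
     (\<forall>\<psi>\<in>test_functions \<Omega>. \<forall>i.
        (LINT x|lebesgue_on \<Omega>. v x * frechet_derivative \<psi> (at x) (axis i 1))
        = - (LINT x|lebesgue_on \<Omega>. G x $ i * \<psi> x))"

text \<open>The weak gradient, unique up to a null set where it exists.\<close>

definition grad :: "(real^'n) set \<Rightarrow> (real^'n \<Rightarrow> real) \<Rightarrow> real^'n \<Rightarrow> real^'n" where
  "grad \<Omega> v = (SOME G. is_weak_grad \<Omega> v G)"

definition L2_space :: "(real^'n) set \<Rightarrow> (real^'n \<Rightarrow> 'b::euclidean_space) set" where
  "L2_space \<Omega> = {f. f \<in> borel_measurable (lebesgue_on \<Omega>) \<and>
                     integrable (lebesgue_on \<Omega>) (\<lambda>x. (norm (f x))\<^sup>2)}"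

definition L2_mean_zero :: "(real^'n) set \<Rightarrow> (real^'n \<Rightarrow> real) set" where
  "L2_mean_zero \<Omega> = {f \<in> L2_space \<Omega>. (LINT x|lebesgue_on \<Omega>. f x) = 0}"

text \<open>For matrix-valued functions the inner product of the type is the Frobenius product.\<close>

definition L2_inner ::
  "(real^'n) set \<Rightarrow> (real^'n \<Rightarrow> 'b::euclidean_space) \<Rightarrow> (real^'n \<Rightarrow> 'b) \<Rightarrow> real" where
  "L2_inner \<Omega> f g = (LINT x|lebesgue_on \<Omega>. f x \<bullet> g x)"

text \<open>
  Extended-valued, since without regularity of \<open>\<Omega>\<close> an \<open>H1\<close> function need not have a finite norm
  for exponents above 2.
\<close>

definition Lp_norm :: "(real^'n) set \<Rightarrow> real \<Rightarrow> (real^'n \<Rightarrow> 'b::euclidean_space) \<Rightarrow> ennreal" where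
  "Lp_norm \<Omega> p f =
     (let I = (\<integral>\<^sup>+x. ennreal (norm (f x) powr p) \<partial>lebesgue_on \<Omega>)
      in if I = \<infinity> then \<infinity> else ennreal (enn2real I powr (1 / p)))"

definition H1 :: "(real^'n) set \<Rightarrow> (real^'n \<Rightarrow> real) set" where
  "H1 \<Omega> = {v \<in> L2_space \<Omega>. \<exists>G \<in> L2_space \<Omega>. is_weak_grad \<Omega> v G}"

definition H1_norm :: "(real^'n) set \<Rightarrow> (real^'n \<Rightarrow> real) \<Rightarrow> real" where
  "H1_norm \<Omega> v = sqrt (L2_inner \<Omega> v v + L2_inner \<Omega> (grad \<Omega> v) (grad \<Omega> v))"

definition H1_dual :: "(real^'n) set \<Rightarrow> ((real^'n \<Rightarrow> real) \<Rightarrow> real) set" where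
  "H1_dual \<Omega> = {l.
     (\<forall>u\<in>H1 \<Omega>. \<forall>v\<in>H1 \<Omega>. \<forall>a b. l (\<lambda>x. a * u x + b * v x) = a * l u + b * l v) \<and>
     (\<exists>M. \<forall>v\<in>H1 \<Omega>. \<bar>l v\<bar> \<le> M * H1_norm \<Omega> v)}"

text \<open>
  The scalar function \<open>f\<close> acts as the operator sending \<open>\<phi>\<close> in \<open>H1\<close> to the functional
  \<open>\<psi> \<mapsto> (f \<circ> \<phi>, \<psi>)\<close> in the dual of \<open>H1\<close>, and \<open>G \<phi> \<delta> \<psi>\<close> is the duality pairing of \<open>G(\<phi>)\<delta>\<close>
  with \<open>\<psi>\<close>. The last clause of \<open>newton_derivative\<close> says that the dual norm of
  \<open>f(\<phi> + h) - f(\<phi>) - G(\<phi> + h)h\<close> is \<open>o(\<parallel>h\<parallel>)\<close>; the derivative is evaluated at \<open>\<phi> + h\<close>.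
\<close>

definition acts_to_dual :: "(real^'n) set \<Rightarrow> (real \<Rightarrow> real) \<Rightarrow> bool" where
  "acts_to_dual \<Omega> f \<longleftrightarrow>
     (\<forall>\<phi>\<in>H1 \<Omega>. (\<forall>\<psi>\<in>H1 \<Omega>. integrable (lebesgue_on \<Omega>) (\<lambda>x. f (\<phi> x) * \<psi> x)) \<and>
                (\<lambda>\<psi>. L2_inner \<Omega> (\<lambda>x. f (\<phi> x)) \<psi>) \<in> H1_dual \<Omega>)"

definition newton_derivative ::
  "(real^'n) set \<Rightarrow> (real \<Rightarrow> real) \<Rightarrow>
   ((real^'n \<Rightarrow> real) \<Rightarrow> (real^'n \<Rightarrow> real) \<Rightarrow> (real^'n \<Rightarrow> real) \<Rightarrow> real) \<Rightarrow> bool" where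
  "newton_derivative \<Omega> f G \<longleftrightarrow>
     acts_to_dual \<Omega> f \<and>
     (\<forall>\<phi>\<in>H1 \<Omega>.
        (\<forall>\<delta>\<in>H1 \<Omega>. G \<phi> \<delta> \<in> H1_dual \<Omega>) \<and>
        (\<forall>\<delta>\<in>H1 \<Omega>. \<forall>\<delta>'\<in>H1 \<Omega>. \<forall>a b. \<forall>\<psi>\<in>H1 \<Omega>.
           G \<phi> (\<lambda>x. a * \<delta> x + b * \<delta>' x) \<psi> = a * G \<phi> \<delta> \<psi> + b * G \<phi> \<delta>' \<psi>) \<and>
        (\<exists>M. \<forall>\<delta>\<in>H1 \<Omega>. \<forall>\<psi>\<in>H1 \<Omega>. \<bar>G \<phi> \<delta> \<psi>\<bar> \<le> M * H1_norm \<Omega> \<delta> * H1_norm \<Omega> \<psi>)) \<and>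
     (\<forall>\<phi>\<in>H1 \<Omega>. \<forall>e>0. \<exists>d>0. \<forall>h\<in>H1 \<Omega>. H1_norm \<Omega> h < d \<longrightarrow>
        (\<forall>\<psi>\<in>H1 \<Omega>.
           \<bar>L2_inner \<Omega> (\<lambda>x. f (\<phi> x + h x)) \<psi> - L2_inner \<Omega> (\<lambda>x. f (\<phi> x)) \<psi>
              - G (\<lambda>x. \<phi> x + h x) h \<psi>\<bar>
           \<le> e * H1_norm \<Omega> h * H1_norm \<Omega> \<psi>))"

definition conforming_mesh :: "(real^'n) set \<Rightarrow> (real^'n) set set \<Rightarrow> bool" where
  "conforming_mesh \<Omega> \<T> \<longleftrightarrow>
     triangulation \<T> \<and> (\<forall>T\<in>\<T>. int CARD('n) simplex T) \<and> \<Union>\<T> = closure \<Omega>"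

lemma finite_multiindices: "finite {\<alpha> :: 'n::finite \<Rightarrow> nat. sum \<alpha> UNIV \<le> j}"
proof (rule finite_subset)
  show "{\<alpha> :: 'n \<Rightarrow> nat. sum \<alpha> UNIV \<le> j} \<subseteq> PiE UNIV (\<lambda>_. {..j})"
  proof
    fix \<alpha> :: "'n \<Rightarrow> nat" assume "\<alpha> \<in> {\<alpha>. sum \<alpha> UNIV \<le> j}"
    moreover have "\<alpha> i \<le> sum \<alpha> UNIV" for i
      by (rule member_le_sum) simp_all
    ultimately have "\<alpha> i \<le> j" for i
      by (metis (mono_tags) mem_Collect_eq le_trans)
    then show "\<alpha> \<in> PiE UNIV (\<lambda>_. {..j})"
      by (simp add: PiE_UNIV_domain)
  qed
  show "finite (PiE (UNIV :: 'n set) (\<lambda>_. {..j}))"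
    by (rule finite_PiE) simp_all
qed

definition polynomial_deg_le :: "nat \<Rightarrow> (real^'n \<Rightarrow> real) \<Rightarrow> bool" where
  "polynomial_deg_le j p \<longleftrightarrow>
     (\<exists>c :: ('n \<Rightarrow> nat) \<Rightarrow> real. \<forall>x.
        p x = (\<Sum>\<alpha> | sum \<alpha> UNIV \<le> j. c \<alpha> * (\<Prod>i\<in>UNIV. (x $ i) ^ \<alpha> i)))"

definition FE_space :: "nat \<Rightarrow> (real^'n) set \<Rightarrow> (real^'n) set set \<Rightarrow> (real^'n \<Rightarrow> real) set" where
  "FE_space j \<Omega> \<T> = {f. continuous_on (closure \<Omega>) f \<and>
     (\<forall>T\<in>\<T>. \<exists>p. polynomial_deg_le j p \<and> (\<forall>x\<in>T. f x = p x))}"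

definition jac :: "(real^'n) set \<Rightarrow> (real^'n \<Rightarrow> real^'n) \<Rightarrow> real^'n \<Rightarrow> real^'n^'n" where
  "jac \<Omega> v x = (\<chi> i. grad \<Omega> (\<lambda>y. v y $ i) x)"

definition divergence :: "(real^'n) set \<Rightarrow> (real^'n \<Rightarrow> real^'n) \<Rightarrow> real^'n \<Rightarrow> real" where
  "divergence \<Omega> v x = (\<Sum>i\<in>UNIV. jac \<Omega> v x $ i $ i)"

definition symgrad :: "(real^'n) set \<Rightarrow> (real^'n \<Rightarrow> real^'n) \<Rightarrow> real^'n \<Rightarrow> real^'n^'n" where
  "symgrad \<Omega> v x = (1/2) *\<^sub>R (jac \<Omega> v x + transpose (jac \<Omega> v x))"

definition H_div :: "(real^'n) set \<Rightarrow> (real^'n) set set \<Rightarrow> (real^'n \<Rightarrow> real^'n) set" where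
  "H_div \<Omega> \<T> = {v. (\<forall>i. (\<lambda>x. v x $ i) \<in> FE_space 2 \<Omega> \<T>) \<and>
     (\<forall>q \<in> FE_space 1 \<Omega> \<T> \<inter> L2_mean_zero \<Omega>. L2_inner \<Omega> (divergence \<Omega> v) q = 0) \<and>
     (\<forall>x\<in>frontier \<Omega>. v x = 0)}"

text \<open>\<open>jac \<Omega> v x *v u x\<close> is \<open>(u \<cdot> \<nabla>)v\<close> at \<open>x\<close>.\<close>

definition trilinear ::
  "(real^'n) set \<Rightarrow> (real^'n \<Rightarrow> real^'n) \<Rightarrow> (real^'n \<Rightarrow> real^'n) \<Rightarrow> (real^'n \<Rightarrow> real^'n) \<Rightarrow> real"
  where
  "trilinear \<Omega> u v w =
     1/2 * (LINT x|lebesgue_on \<Omega>. (jac \<Omega> v x *v u x) \<bullet> w x)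
     - 1/2 * (LINT x|lebesgue_on \<Omega>. (jac \<Omega> w x *v u x) \<bullet> v x)"

text \<open>
  A projection is an operator that is the identity on its target space. Linearity is deliberately
  not required: a linear projection satisfying both stability bounds at exponent 2 would be
  orthogonal both in \<open>L2\<close> and for the Dirichlet form, which is impossible.
\<close>

definition stable_projection ::
  "(real^'n) set \<Rightarrow> (real^'n) set set \<Rightarrow> ((real^'n \<Rightarrow> real) \<Rightarrow> real^'n \<Rightarrow> real) \<Rightarrow> bool" where
  "stable_projection \<Omega> \<T> P \<longleftrightarrow>
     (\<forall>v\<in>H1 \<Omega>. P v \<in> FE_space 1 \<Omega> \<T>) \<and>
     (\<forall>u\<in>H1 \<Omega>. \<forall>v\<in>H1 \<Omega>. (AE x in lebesgue_on \<Omega>. u x = v x) \<longrightarrow>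
        (\<forall>x\<in>closure \<Omega>. P u x = P v x)) \<and>
     (\<forall>v\<in>FE_space 1 \<Omega> \<T>. \<forall>x\<in>closure \<Omega>. P v x = v x) \<and>
     (\<forall>v\<in>H1 \<Omega>. \<forall>p\<ge>1. (CARD('n) = 3 \<longrightarrow> p < 6) \<longrightarrow> Lp_norm \<Omega> p (P v) \<le> Lp_norm \<Omega> p v) \<and>
     (\<forall>v\<in>H1 \<Omega>. \<forall>r\<in>{1..2}. Lp_norm \<Omega> r (grad \<Omega> (P v)) \<le> Lp_norm \<Omega> r (grad \<Omega> v))"

definition density_profile :: "real \<Rightarrow> real \<Rightarrow> (real \<Rightarrow> real) \<Rightarrow> bool" where
  "density_profile \<rho>1 \<rho>2 \<rho> \<longleftrightarrow>
     (if \<rho>1 = \<rho>2 then \<exists>c. \<forall>s. \<rho> s = c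
      else
        (\<forall>s. \<bar>s\<bar> < 1 + \<rho>1 / (\<rho>2 - \<rho>1) \<longrightarrow> \<rho> s = (\<rho>2 - \<rho>1) / 2 * s + (\<rho>1 + \<rho>2) / 2) \<and>
        (\<exists>c. \<forall>s. s > 1 + 2 * \<rho>1 / (\<rho>2 - \<rho>1) \<longrightarrow> \<rho> s = c) \<and>
        (\<exists>c. \<forall>s. s < - 1 - 2 * \<rho>1 / (\<rho>2 - \<rho>1) \<longrightarrow> \<rho> s = c))"

text \<open>Unlike \<open>powr\<close>, this has the value 1 at base and exponent 0.\<close>

definition abs_pow :: "real \<Rightarrow> real \<Rightarrow> real" where
  "abs_pow x s = (if s = 0 then 1 else \<bar>x\<bar> powr s)"

end

theory Submission
  imports Defs "HOL-Homology.Homology" "HOL-Library.Function_Algebras"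
begin

text \<open>
  The discrete equations are a square system on a finite-dimensional space. Testing them with
  \<open>v\<^sub>h\<close>, \<open>\<mu>\<^sub>h\<close> and \<open>(\<phi>\<^sub>h - P \<phi>\<^sub>k) / \<tau>\<close> cancels the trilinear form and all coupling terms and, \<open>Fp\<close>
  being convex, leaves a bound for \<open>v\<^sub>h\<close> and for the gradients of \<open>\<phi>\<^sub>h\<close> and \<open>\<mu>\<^sub>h\<close>; shifting the last
  two test functions by small constants bounds the mean values as well. So the residual points
  outwards on a large sphere, and it has a zero inside because otherwise the sphere would be
  contractible. The mass term alone makes the velocity form coercive, so that Korn's inequality is
  not needed.

  The gradient \<open>grad \<Omega>\<close> is a choice among the weak gradients. It depends linearly on finite element
  functions up to null sets, because it agrees almost everywhere with the elementwise classical
  gradient: the latter is a weak gradient, and weak gradients are unique.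
\<close>

section \<open>Zeros of vector fields\<close>

text \<open>The finite element spaces are sets of functions whose dimension depends on the mesh, so
  the topological argument runs in coordinates: an orthonormal basis for an auxiliary inner product
  turns the residual into a field on real sequences that vanish from some index on, which is also
  how the spheres of homology are represented. As the spaces carry no topology of their own,
  continuity is asked along finite linear combinations only.

  The unknown is \<open>\<psi> = \<phi>\<^sub>h - P \<phi>\<^sub>k\<close> instead of
  \<open>\<phi>\<^sub>h\<close>. The second equation then contains no data, and once the third one
  is divided by \<tau>, both couplings of \<psi> and \<mu> are the same symmetric form and \<psi>
  itself is the test function. The nonlinearity enters the estimate through its sign in
  \<open>N 0 \<psi> \<le> N \<psi> \<psi>\<close>, which is monotonicity of the derivative of
  \<open>Fp\<close>, and through a bound on a ball, which is compactness.

  Apart from the force, every function in the integrands is essentially bounded, because piecewise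
  polynomials on a bounded domain and their gradients are. Integrability thus reduces to closure
  properties of one class of functions.\<close>

lemma homotopic_with_canon_normalize:
  fixes n :: nat and h :: "real \<times> (nat \<Rightarrow> real) \<Rightarrow> nat \<Rightarrow> real"
  defines "S \<equiv> {x. (\<Sum>i<n. (x i)\<^sup>2) = 1 \<and> (\<forall>i\<ge>n. x i = 0)}"
  assumes cont: "\<And>i. i < n \<Longrightarrow> continuous_on ({0..1} \<times> S) (\<lambda>y. h y i)"
    and nonzero: "\<And>t x. t \<in> {0..1} \<Longrightarrow> x \<in> S \<Longrightarrow> \<exists>i<n. h (t, x) i \<noteq> 0"
  shows "homotopic_with_canon (\<lambda>x. True) S S
           (\<lambda>x i. if i < n then h (0, x) i / sqrt (\<Sum>j<n. (h (0, x) j)\<^sup>2) else 0)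
           (\<lambda>x i. if i < n then h (1, x) i / sqrt (\<Sum>j<n. (h (1, x) j)\<^sup>2) else 0)"
proof -
  define N where "N y = (\<Sum>j<n. (h y j)\<^sup>2)" for y
  \<comment> \<open>Radial projection back to the sphere. The value \<open>0\<close> from
    \<open>n\<close> on is what membership in \<open>S\<close> demands.\<close>
  define k where "k y = (\<lambda>i. if i < n then h y i / sqrt (N y) else 0)" for y
  have Npos: "N y > 0" if yS: "y \<in> {0..1} \<times> S" for y
  proof -
    obtain t x where y: "y = (t, x)" by (cases y)
    obtain i where i: "i < n" "h y i \<noteq> 0" using nonzero[of t x] yS y by auto
    have "0 < (h y i)\<^sup>2" using i by simp
    also have "\<dots> \<le> N y" unfolding N_def using i
      by (intro member_le_sum[where f = "\<lambda>j. (h y j)\<^sup>2"]) auto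
    finally show ?thesis .
  qed
  have contN: "continuous_on ({0..1} \<times> S) N"
    unfolding N_def by (intro continuous_intros cont) auto
  have "continuous_on ({0..1} \<times> S) (\<lambda>y. k y i)" for i
  proof (cases "i < n")
    case True
    have "continuous_on ({0..1} \<times> S) (\<lambda>y. h y i / sqrt (N y))"
      using Npos by (intro continuous_intros cont True contN) fastforce
    then show ?thesis using True by (simp add: k_def)
  qed (simp add: k_def)
  then have contk: "continuous_on ({0..1} \<times> S) k"
    by (rule continuous_on_coordinatewise_then_product)
  have "k y \<in> S" if "y \<in> {0..1} \<times> S" for y
  proof -
    have "(\<Sum>i<n. (k y i)\<^sup>2) = (\<Sum>i<n. (h y i)\<^sup>2 / N y)"
      using Npos[OF that] by (intro sum.cong) (auto simp: k_def power_divide)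
    also have "\<dots> = 1" using Npos[OF that] by (simp add: N_def flip: sum_divide_distrib)
    finally show ?thesis by (simp add: S_def k_def)
  qed
  then have "k ` ({0..1} \<times> S) \<subseteq> S" by blast
  then show ?thesis
    unfolding homotopic_with_def using contk
    by (intro exI[of _ k])
      (auto simp: k_def N_def)
qed

text \<open>Without a zero, the normalized field on the unit sphere could be deformed in two ways:
  into a constant map, by shrinking the argument to the centre, and into the identity, along the
  segment from \<open>f x\<close> to \<open>x\<close>. The segment avoids \<open>0\<close> because
  its product with \<open>x\<close> stays positive. The sphere would then be contractible.\<close>

lemma zero_if_outward_on_sphere:
  fixes f :: "(nat \<Rightarrow> real) \<Rightarrow> nat \<Rightarrow> real"
  assumes cont: "\<And>i. i < n \<Longrightarrow> continuous_on UNIV (\<lambda>x. f x i)"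
    and outward: "\<And>x. (\<Sum>i<n. (x i)\<^sup>2) = 1 \<Longrightarrow> \<forall>i\<ge>n. x i = 0 \<Longrightarrow> (\<Sum>i<n. f x i * x i) > 0"
  shows "\<exists>x. (\<forall>i\<ge>n. x i = 0) \<and> (\<forall>i<n. f x i = 0)"
proof (rule ccontr)
  assume "\<not> ?thesis"
  then have nz: "\<exists>i<n. f x i \<noteq> 0" if "\<forall>i\<ge>n. x i = 0" for x using that by blast
  define S where "S \<equiv> {x::nat \<Rightarrow> real. (\<Sum>i<n. (x i)\<^sup>2) = 1 \<and> (\<forall>i\<ge>n. x i = 0)}"
  have n: "n > 0" using nz[of "\<lambda>_. 0"] by auto
  define R where "R \<equiv> \<lambda>u::(nat \<Rightarrow> real) \<Rightarrow> nat \<Rightarrow> real. \<lambda>x i. if i <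
    n then u x i / sqrt (\<Sum>j<n. (u x j)\<^sup>2) else 0"
  have cS: "continuous_on X (\<lambda>y. snd y i)" for X :: "(real \<times> (nat \<Rightarrow> real)) set" and i
    by (rule continuous_on_product_then_coordinatewise[OF continuous_on_snd[OF continuous_on_id]])
  note hom = homotopic_with_canon_normalize[of n, folded S_def]
  have "homotopic_with_canon (\<lambda>x. True) S S (R (\<lambda>x. f (\<lambda>i. 0 * x i))) (R (\<lambda>x. f (\<lambda>i. 1 * x i)))"
  proof -
    have c: "continuous_on ({0..1} \<times> S) (\<lambda>y. f (\<lambda>i. fst y * snd y i) i)" if "i < n" for i
    proof -
      have "continuous_on ({0..1} \<times> S) (\<lambda>y. \<lambda>i. fst y * snd y i)"
        by (intro continuous_on_coordinatewise_then_product continuous_intros cS)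
      from continuous_on_compose2[OF cont[OF that] this] show ?thesis by simp
    qed
    have "\<exists>i<n. f (\<lambda>i. fst (t, x) * snd (t, x) i) i \<noteq> 0" if "t \<in> {0..1}" "x \<in> S" for t :: real and x
      using that by (intro nz) (simp add: S_def)
    from hom[of "\<lambda>y. f (\<lambda>i. fst y * snd y i)", OF c this]
    show ?thesis unfolding R_def fst_conv snd_conv .
  qed
  moreover have "homotopic_with_canon (\<lambda>x. True) S S (R (\<lambda>x i. f x i)) (R (\<lambda>x i. x i))"
  proof -
    define h where "h = (\<lambda>(y::real \<times> (nat \<Rightarrow> real)) i. fst y * snd y i + (1 - fst y) * f (snd y) i)"
    have c: "continuous_on ({0..1} \<times> S) (\<lambda>y. h y i)" if "i < n" for i
    proof -
      have "continuous_on ({0..1} \<times> S) (\<lambda>y. f (snd y) i)"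
        using continuous_on_compose2[OF cont[OF that] continuous_on_snd[OF continuous_on_id]]
        by simp
      then show ?thesis unfolding h_def by (intro continuous_intros cS)
    qed
    have "\<exists>i<n. h (t, x) i \<noteq> 0" if t: "t \<in> {0..1}" and x: "x \<in> S" for t x
    proof -
      have "(\<Sum>i<n. h (t, x) i * x i) = t * (\<Sum>i<n. (x i)\<^sup>2) + (1 - t) * (\<Sum>i<n. f x i * x i)"
        by (simp add: h_def sum_distrib_left sum.distrib[symmetric] algebra_simps power2_eq_square)
      moreover have "(\<Sum>i<n. (x i)\<^sup>2) = 1" "(\<Sum>i<n. f x i * x i) > 0"
        using x outward by (auto simp: S_def)
      ultimately have "(\<Sum>i<n. h (t, x) i * x i) > 0"
        using t by (cases "t = 0") (auto intro!: add_pos_nonneg mult_nonneg_nonneg)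
      then have "(\<Sum>i<n. h (t, x) i * x i) \<noteq> 0" by simp
      then show ?thesis by (metis (mono_tags, lifting) lessThan_iff mult_zero_left sum.neutral)
    qed
    from hom[of h, OF c this]
    have "homotopic_with_canon (\<lambda>x. True) S S (R (\<lambda>x i. h (0, x) i)) (R (\<lambda>x i. h (1, x) i))"
      unfolding R_def .
    then show ?thesis by (simp add: h_def)
  qed
  ultimately have "homotopic_with_canon (\<lambda>x. True) S S (R (\<lambda>x. f (\<lambda>i. 0))) (R (\<lambda>x. x))"
    by (simp add: homotopic_with_trans)
  moreover have "R (\<lambda>x. x) x = id x" if "x \<in> S" for x
    using that by (auto simp: R_def S_def)
  ultimately have "homotopic_with_canon (\<lambda>x. True) S S (\<lambda>x. R (\<lambda>x. f (\<lambda>i. 0)) (\<lambda>_. 0)) id"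
    by (elim homotopic_with_eq) (auto simp: R_def)
  then have "contractible S"
    unfolding contractible_def using homotopic_with_sym by blast
  \<comment> \<open>The unit sphere in \<open>n\<close> coordinates is
    \<open>nsphere (n - 1)\<close>, whose points use the indices up to \<open>n - 1\<close>. Here
    \<open>n > 0\<close>, since a field without components vanishes trivially.\<close>
  moreover obtain p where p: "n = Suc p" using n by (cases n) auto
  have "nsphere p = top_of_set S"
    unfolding nsphere S_def p
    by (auto simp: euclidean_product_topology lessThan_Suc_atMost Suc_le_eq
      intro!: arg_cong[where f = top_of_set])
  ultimately show False
    using non_contractible_space_nsphere[of p] by (simp add: contractible_space_top_of_set)
qed

text \<open>Linearity is asked on the set \<open>X\<close> only: forms built from
  \<open>grad\<close> are linear on finite element functions, whereas for a function without weak
  gradient the choice made by \<open>grad\<close> is arbitrary.\<close>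

definition linear_form_on :: "'a::real_vector set \<Rightarrow> ('a \<Rightarrow> real) \<Rightarrow> bool" where
  "linear_form_on X l \<longleftrightarrow>
     (\<forall>x\<in>X. \<forall>y\<in>X. \<forall>a b. l (a *\<^sub>R x + b *\<^sub>R y) = a * l x + b * l y)"

definition bilinear_form_on ::
  "'a::real_vector set \<Rightarrow> 'b::real_vector set \<Rightarrow> ('a \<Rightarrow> 'b \<Rightarrow> real) \<Rightarrow> bool" where
  "bilinear_form_on X Y b \<longleftrightarrow>
     (\<forall>y\<in>Y. linear_form_on X (\<lambda>x. b x y)) \<and> (\<forall>x\<in>X. linear_form_on Y (b x))"

definition inner_product_on :: "'a::real_vector set \<Rightarrow> ('a \<Rightarrow> 'a \<Rightarrow> real) \<Rightarrow> bool" where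
  "inner_product_on X b \<longleftrightarrow> bilinear_form_on X X b \<and>
     (\<forall>x\<in>X. \<forall>y\<in>X. b x y = b y x) \<and> (\<forall>x\<in>X. x \<noteq> 0 \<longrightarrow> b x x > 0)"

lemma linear_form_onD:
  assumes "linear_form_on X l" "subspace X"
  shows "x \<in> X \<Longrightarrow> y \<in> X \<Longrightarrow> l (x + y) = l x + l y"
    and "x \<in> X \<Longrightarrow> l (a *\<^sub>R x) = a * l x"
    and "l 0 = 0"
    and "x \<in> X \<Longrightarrow> y \<in> X \<Longrightarrow> l (x - y) = l x - l y"
proof -
  have *: "l (a *\<^sub>R x + b *\<^sub>R y) = a * l x + b * l y" if "x \<in> X" "y \<in> X" for a b x y
    using assms that unfolding linear_form_on_def by blast
  show "l (x + y) = l x + l y" if "x \<in> X" "y \<in> X" using *[OF that, of 1 1] by simp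
  show "l (a *\<^sub>R x) = a * l x" if "x \<in> X" using *[OF that that, of a 0] by simp
  show "l 0 = 0" using *[OF subspace_0[OF assms(2)] subspace_0[OF assms(2)], of 0 0] by simp
  show "l (x - y) = l x - l y" if "x \<in> X" "y \<in> X" using *[OF that, of 1 "-1"] by simp
qed

lemma linear_form_on_sum:
  assumes l: "linear_form_on X l" and X: "subspace X" and e: "\<And>i. i \<in> I \<Longrightarrow> e i \<in> X"
  shows "l (\<Sum>i\<in>I. c i *\<^sub>R e i) = (\<Sum>i\<in>I. c i * l (e i))"
  using e
proof (induction I rule: infinite_finite_induct)
  case (insert i I)
  have "(\<Sum>i\<in>I. c i *\<^sub>R e i) \<in> X"
    using insert.prems by (intro subspace_sum[OF X] subspace_scale[OF X]) auto
  then show ?case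
    using insert by (simp add: linear_form_onD[OF l X] subspace_scale[OF X])
qed (simp_all add: linear_form_onD[OF l X])

lemma bilinear_form_onD:
  assumes "bilinear_form_on X Y b"
  shows "y \<in> Y \<Longrightarrow> linear_form_on X (\<lambda>x. b x y)" "x \<in> X \<Longrightarrow> linear_form_on Y (b x)"
  using assms by (auto simp: bilinear_form_on_def)

lemma inner_product_onD:
  assumes "inner_product_on X b"
  shows "bilinear_form_on X X b"
    and "x \<in> X \<Longrightarrow> y \<in> X \<Longrightarrow> b x y = b y x"
    and "x \<in> X \<Longrightarrow> x \<noteq> 0 \<Longrightarrow> b x x > 0"
  using assms by (auto simp: inner_product_on_def)

text \<open>Pairing a vanishing combination with \<open>e j\<close> isolates its coefficient, so the
  system is independent. The bound guarantees that an orthonormal system of maximal length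
  exists.\<close>

lemma orthonormal_imp_card_le:
  fixes e :: "nat \<Rightarrow> 'a::real_vector"
  assumes X: "subspace X" "X \<subseteq> span B" "finite B"
    and ip: "bilinear_form_on X X ip"
    and e: "\<And>i. i < n \<Longrightarrow> e i \<in> X"
    and on: "\<And>i j. i < n \<Longrightarrow> j < n \<Longrightarrow> ip (e i) (e j) = (if i = j then 1 else 0)"
  shows "n \<le> card B"
proof -
  have inj: "inj_on e {..<n}"
    using on by (intro inj_onI) (metis lessThan_iff zero_neq_one)
  have "independent (e ` {..<n})"
  proof (rule independent_if_scalars_zero)
    fix u x assume u: "(\<Sum>x\<in>e ` {..<n}. u x *\<^sub>R x) = 0" and "x \<in> e ` {..<n}"
    then obtain j where j: "j < n" "x = e j" by auto
    have "(\<Sum>i<n. u (e i) *\<^sub>R e i) = 0" using u by (simp add: sum.reindex[OF inj])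
    then have "ip (\<Sum>i<n. u (e i) *\<^sub>R e i) (e j) = 0"
      using linear_form_onD(3)[OF bilinear_form_onD(1)[OF ip e[OF j(1)]] X(1)] by simp
    moreover have "ip (\<Sum>i<n. u (e i) *\<^sub>R e i) (e j) = (\<Sum>i<n. u (e i) * ip (e i) (e j))"
      using e by (intro linear_form_on_sum[OF bilinear_form_onD(1)[OF ip e[OF j(1)]] X(1)]) auto
    moreover have "\<dots> = (\<Sum>i<n. if i = j then u (e i) else 0)"
      using on j by (intro sum.cong) auto
    ultimately show "u x = 0" using j by simp
  qed simp
  moreover have "e ` {..<n} \<subseteq> span B" using e X(2) by auto
  ultimately have "card (e ` {..<n}) \<le> card B"
    using independent_span_bound[OF X(3)] by blast
  then show ?thesis by (simp add: card_image[OF inj])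
qed

text \<open>An orthonormal system of maximal length spans \<open>X\<close>: otherwise the part of
  some \<open>x\<close> orthogonal to it could be normalized and appended.\<close>

lemma orthonormal_basis_on:
  fixes X :: "'a::real_vector set"
  assumes X: "subspace X" "X \<subseteq> span B" "finite B" and ip: "inner_product_on X ip"
  obtains n :: nat and e where "\<And>i. i < n \<Longrightarrow> e i \<in> X"
    and "\<And>i j. i < n \<Longrightarrow> j < n \<Longrightarrow> ip (e i) (e j) = (if i = j then 1 else 0)"
    and "\<And>x. x \<in> X \<Longrightarrow> x = (\<Sum>i<n. ip x (e i) *\<^sub>R e i)"
proof -
  define on where "on n e \<longleftrightarrow> (\<forall>i<n. e i \<in> X) \<and>
    (\<forall>i<n. \<forall>j<n. ip (e i) (e j) = (if i = j then 1 else 0))" for n :: nat and e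
  note ipD = inner_product_onD[OF ip]
  note lin1 = bilinear_form_onD(1)[OF ipD(1)] and lin2 = bilinear_form_onD(2)[OF ipD(1)]
  have bound: "n \<le> card B" if "\<exists>e. on n e" for n
    using that orthonormal_imp_card_le[OF X ipD(1)] unfolding on_def by blast
  have ex0: "\<exists>e. on 0 e" by (simp add: on_def)
  define n where "n = (GREATEST n. \<exists>e. on n e)"
  have "\<exists>e. on n e" unfolding n_def
    by (rule GreatestI_nat[where P = "\<lambda>n. \<exists>e. on n e", OF ex0]) (use bound in blast)
  then obtain e where e: "on n e" ..
  have max: "\<not> on (Suc n) e'" for e'
  proof
    assume "on (Suc n) e'"
    then have "Suc n \<le> n" unfolding n_def
      by (intro Greatest_le_nat[where P = "\<lambda>n. \<exists>e. on n e" and b = "card B"]) (use bound in blast)+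
    then show False by simp
  qed
  have eX: "e i \<in> X" if "i < n" for i using e that by (auto simp: on_def)
  have eo: "ip (e i) (e j) = (if i = j then 1 else 0)" if "i < n" "j < n" for i j
    using e that by (auto simp: on_def)
  have "x = (\<Sum>i<n. ip x (e i) *\<^sub>R e i)" if x: "x \<in> X" for x
  proof (rule ccontr)
    define p where "p = (\<Sum>i<n. ip x (e i) *\<^sub>R e i)"
    define r where "r = x - p"
    assume "\<not> ?thesis"
    then have r0: "r \<noteq> 0" by (simp add: r_def p_def)
    have pX: "p \<in> X" unfolding p_def by (intro subspace_sum subspace_scale X eX) auto
    then have rX: "r \<in> X" unfolding r_def by (intro subspace_diff X x)
    have orth: "ip r (e j) = 0" if j: "j < n" for j
    proof -
      have "ip p (e j) = (\<Sum>i<n. ip x (e i) * ip (e i) (e j))"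
        unfolding p_def using eX by (intro linear_form_on_sum[OF lin1[OF eX[OF j]] X(1)]) auto
      also have "\<dots> = (\<Sum>i<n. if i = j then ip x (e i) else 0)"
        using j eo by (intro sum.cong) auto
      also have "\<dots> = ip x (e j)" using j by simp
      finally show ?thesis
        unfolding r_def by (simp add: linear_form_onD(4)[OF lin1[OF eX[OF j]] X(1) x pX])
    qed
    define s where "s = sqrt (ip r r)"
    have s: "s > 0" "s * s = ip r r" using ipD(3)[OF rX r0] by (auto simp: s_def)
    define u where "u = (1 / s) *\<^sub>R r"
    have uX: "u \<in> X" unfolding u_def by (intro subspace_scale X rX)
    have "ip u u = (1 / s) * ((1 / s) * ip r r)"
      unfolding u_def
      by (simp only: linear_form_onD(2)[OF lin1[OF subspace_scale[OF X(1) rX]] X(1) rX]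
          linear_form_onD(2)[OF lin2[OF rX] X(1) rX])
    then have uu: "ip u u = 1" unfolding s(2)[symmetric] using s(1) by simp
    have ue: "ip u (e j) = 0" if "j < n" for j
      unfolding u_def
      by (simp add: linear_form_onD(2)[OF lin1[OF eX[OF that]] X(1) rX] orth[OF that])
    then have eu: "ip (e j) u = 0" if "j < n" for j
      using ipD(2)[OF eX[OF that] uX] that by simp
    have "on (Suc n) (e(n := u))"
      using eX eo uX uu ue eu by (auto simp: on_def less_Suc_eq)
    then show False using max by blast
  qed
  with that[of n e] eX eo show ?thesis by blast
qed

text \<open>Each coefficient in an orthonormal basis is at most the norm, so the sum of all
  \<open>\<bar>l (e i)\<bar>\<close> serves as \<open>C\<close>.\<close>

lemma linear_form_on_bounded:
  fixes X :: "'a::real_vector set"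
  assumes X: "subspace X" "X \<subseteq> span B" "finite B" and ip: "inner_product_on X ip"
    and l: "linear_form_on X l"
  obtains C where "C \<ge> 0" "\<And>x. x \<in> X \<Longrightarrow> \<bar>l x\<bar> \<le> C * sqrt (ip x x)"
proof -
  obtain n and e :: "nat \<Rightarrow> 'a" where e: "\<And>i. i < n \<Longrightarrow> e i \<in> X"
    and on: "\<And>i j. i < n \<Longrightarrow> j < n \<Longrightarrow> ip (e i) (e j) = (if i = j then 1 else 0)"
    and ex: "\<And>x. x \<in> X \<Longrightarrow> x = (\<Sum>i<n. ip x (e i) *\<^sub>R e i)"
    using orthonormal_basis_on[OF X ip] by blast
  note lin = bilinear_form_onD(2)[OF inner_product_onD(1)[OF ip]]
  have "\<bar>l x\<bar> \<le> (\<Sum>i<n. \<bar>l (e i)\<bar>) * sqrt (ip x x)" if x: "x \<in> X" for x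
  proof -
    have "ip x x = ip x (\<Sum>i<n. ip x (e i) *\<^sub>R e i)" using ex[OF x] by simp
    also have "\<dots> = (\<Sum>i<n. ip x (e i) * ip x (e i))"
      using e by (intro linear_form_on_sum[OF lin[OF x] X(1)]) auto
    finally have ipx: "ip x x = (\<Sum>i<n. (ip x (e i))\<^sup>2)" by (simp add: power2_eq_square)
    have coef: "\<bar>ip x (e i)\<bar> \<le> sqrt (ip x x)" if "i < n" for i
      unfolding ipx using that
      by (intro real_le_rsqrt) (auto intro!: member_le_sum[where f = "\<lambda>i. (ip x (e i))\<^sup>2"])
    have "l x = l (\<Sum>i<n. ip x (e i) *\<^sub>R e i)" using ex[OF x] by simp
    also have "\<dots> = (\<Sum>i<n. ip x (e i) * l (e i))"
      using e by (intro linear_form_on_sum[OF l X(1)]) auto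
    also have "\<bar>\<dots>\<bar> \<le> (\<Sum>i<n. \<bar>l (e i)\<bar> * sqrt (ip x x))"
      by (rule order.trans[OF sum_abs])
        (auto intro!: sum_mono mult_left_mono coef simp: abs_mult mult.commute)
    finally show ?thesis by (simp add: sum_distrib_right)
  qed
  then show ?thesis by (intro that[of "\<Sum>i<n. \<bar>l (e i)\<bar>"]) (auto intro: sum_nonneg)
qed

text \<open>The residuals against an orthonormal basis are the components of a vector field in
  coordinates, and \<open>R x x\<close> is a positive multiple of its product with the position. A
  zero of the field annihilates the basis and hence, by linearity, all of \<open>X\<close>.\<close>

lemma form_zero_if_positive_on_sphere:
  fixes X :: "'a::real_vector set"
  assumes X: "subspace X" "X \<subseteq> span B" "finite B" and ip: "inner_product_on X ip"
    and lin: "\<And>x. x \<in> X \<Longrightarrow> linear_form_on X (R x)"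
    and cont: "\<And>n (e :: nat \<Rightarrow> 'a) z. (\<And>i. i < n \<Longrightarrow> e i \<in> X) \<Longrightarrow> z \<in> X \<Longrightarrow>
      continuous_on UNIV (\<lambda>c::nat \<Rightarrow> real. R (\<Sum>i<n. c i *\<^sub>R e i) z)"
    and r: "r > 0" and pos: "\<And>x. x \<in> X \<Longrightarrow> ip x x = r\<^sup>2 \<Longrightarrow> R x x > 0"
  shows "\<exists>x\<in>X. \<forall>z\<in>X. R x z = 0"
proof -
  obtain n and e :: "nat \<Rightarrow> 'a" where e: "\<And>i. i < n \<Longrightarrow> e i \<in> X"
    and on: "\<And>i j. i < n \<Longrightarrow> j < n \<Longrightarrow> ip (e i) (e j) = (if i = j then 1 else 0)"
    and ex: "\<And>x. x \<in> X \<Longrightarrow> x = (\<Sum>i<n. ip x (e i) *\<^sub>R e i)"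
    using orthonormal_basis_on[OF X ip] by blast
  note ipD = inner_product_onD[OF ip]
  \<comment> \<open>The basis is scaled by \<open>r\<close>, so that coordinates on the unit sphere
    describe the sphere of radius \<open>r\<close> for \<open>ip\<close>.\<close>
  define E where "E c = (\<Sum>i<n. c i *\<^sub>R (r *\<^sub>R e i))" for c :: "nat \<Rightarrow> real"
  have reX: "r *\<^sub>R e i \<in> X" if "i < n" for i using e[OF that] by (intro subspace_scale X)
  have EX: "E c \<in> X" for c unfolding E_def by (intro subspace_sum subspace_scale X e) auto
  have "\<exists>c. (\<forall>i\<ge>n. c i = 0) \<and> (\<forall>i<n. R (E c) (e i) = 0)"
  proof (rule zero_if_outward_on_sphere)
    show "continuous_on UNIV (\<lambda>c. R (E c) (e i))" if "i < n" for i
      unfolding E_def using reX e[OF that] by (intro cont) auto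
    fix c :: "nat \<Rightarrow> real" assume c: "(\<Sum>i<n. (c i)\<^sup>2) = 1"
    have coef: "ip (E c) (e j) = r * c j" if j: "j < n" for j
    proof -
      have "ip (E c) (e j) = (\<Sum>i<n. c i * ip (r *\<^sub>R e i) (e j))"
        unfolding E_def using reX
        by (intro linear_form_on_sum[OF bilinear_form_onD(1)[OF ipD(1) e[OF j]] X(1)]) auto
      also have "\<dots> = (\<Sum>i<n. if i = j then r * c j else 0)"
        using linear_form_onD(2)[OF bilinear_form_onD(1)[OF ipD(1) e[OF j]] X(1) e] j
        by (intro sum.cong) (auto simp: on)
      finally show ?thesis using j by simp
    qed
    have "ip (E c) (E c) = (\<Sum>i<n. c i * ip (E c) (r *\<^sub>R e i))"
      using linear_form_on_sum[OF bilinear_form_onD(2)[OF ipD(1) EX] X(1), of "{..<n}"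
        "\<lambda>i. r *\<^sub>R e i" c c] reX
      by (simp add: E_def)
    also have "\<dots> = (\<Sum>i<n. r\<^sup>2 * (c i)\<^sup>2)"
      using linear_form_onD(2)[OF bilinear_form_onD(2)[OF ipD(1) EX] X(1) e]
      by (intro sum.cong) (auto simp: coef power2_eq_square)
    also have "\<dots> = r\<^sup>2" using c by (simp flip: sum_distrib_left)
    finally have "R (E c) (E c) > 0" by (intro pos EX)
    also have "R (E c) (E c) = (\<Sum>i<n. c i * R (E c) (r *\<^sub>R e i))"
      using linear_form_on_sum[OF lin[OF EX] X(1), of "{..<n}" "\<lambda>i. r *\<^sub>R e i" c c] reX
      by (simp add: E_def)
    also have "\<dots> = r * (\<Sum>i<n. R (E c) (e i) * c i)"
      using linear_form_onD(2)[OF lin[OF EX] X(1) e]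
      by (auto simp: sum_distrib_left mult_ac intro!: sum.cong)
    finally show "(\<Sum>i<n. R (E c) (e i) * c i) > 0"
      using r by (simp add: zero_less_mult_iff)
  qed
  then obtain c where c: "\<And>i. i < n \<Longrightarrow> R (E c) (e i) = 0" by blast
  have "R (E c) z = 0" if z: "z \<in> X" for z
  proof -
    have "R (E c) z = R (E c) (\<Sum>i<n. ip z (e i) *\<^sub>R e i)" using ex[OF z] by simp
    also have "\<dots> = (\<Sum>i<n. ip z (e i) * R (E c) (e i))"
      using e by (intro linear_form_on_sum[OF lin[OF EX] X(1)]) auto
    finally show ?thesis using c by simp
  qed
  then show ?thesis using EX by blast
qed

text \<open>The coordinates of the ball lie in a cube, which is compact in the product topology
  although it has infinitely many factors; the coordinates from \<open>n\<close> on do not influence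
  \<open>f\<close>.\<close>

lemma bounded_on_inner_product_ball:
  fixes X :: "'a::real_vector set"
  assumes X: "subspace X" "X \<subseteq> span B" "finite B" and ip: "inner_product_on X ip"
    and cont: "\<And>n (e :: nat \<Rightarrow> 'a). (\<And>i. i < n \<Longrightarrow> e i \<in> X) \<Longrightarrow>
      continuous_on UNIV (\<lambda>c::nat \<Rightarrow> real. f (\<Sum>i<n. c i *\<^sub>R e i) :: real)"
  obtains C where "C > 0" "\<And>x. x \<in> X \<Longrightarrow> ip x x \<le> r\<^sup>2 \<Longrightarrow> \<bar>f x\<bar> \<le> C"
proof -
  obtain n and e :: "nat \<Rightarrow> 'a" where e: "\<And>i. i < n \<Longrightarrow> e i \<in> X"
    and on: "\<And>i j. i < n \<Longrightarrow> j < n \<Longrightarrow> ip (e i) (e j) = (if i = j then 1 else 0)"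
    and ex: "\<And>x. x \<in> X \<Longrightarrow> x = (\<Sum>i<n. ip x (e i) *\<^sub>R e i)"
    using orthonormal_basis_on[OF X ip] by blast
  note lin = bilinear_form_onD(2)[OF inner_product_onD(1)[OF ip]]
  define K where "K = (\<Pi>\<^sub>E i\<in>UNIV. {-\<bar>r\<bar>..\<bar>r\<bar>} :: (nat \<Rightarrow> real) set)"
  have "compactin euclidean K"
    unfolding K_def euclidean_product_topology[symmetric] by (simp add: compactin_PiE)
  then have "compact K" by simp
  then have "compact ((\<lambda>c. f (\<Sum>i<n. c i *\<^sub>R e i)) ` K)"
    by (intro compact_continuous_image continuous_on_subset[OF cont[OF e]]) auto
  from compact_imp_bounded[OF this]
  obtain C where C: "C > 0" "\<And>c. c \<in> K \<Longrightarrow> \<bar>f (\<Sum>i<n. c i *\<^sub>R e i)\<bar> \<le> C"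
    by (auto simp: bounded_pos)
  have "\<bar>f x\<bar> \<le> C" if x: "x \<in> X" and xr: "ip x x \<le> r\<^sup>2" for x
  proof -
    define c where "c i = (if i < n then ip x (e i) else 0)" for i
    have xc: "x = (\<Sum>i<n. c i *\<^sub>R e i)" using ex[OF x] by (simp add: c_def)
    have "ip x x = ip x (\<Sum>i<n. ip x (e i) *\<^sub>R e i)" using ex[OF x] by simp
    also have "\<dots> = (\<Sum>i<n. ip x (e i) * ip x (e i))"
      using e by (intro linear_form_on_sum[OF lin[OF x] X(1)]) auto
    finally have ipx: "ip x x = (\<Sum>i<n. (ip x (e i))\<^sup>2)" by (simp add: power2_eq_square)
    have "\<bar>c i\<bar> \<le> \<bar>r\<bar>" for i
    proof (cases "i < n")
      case True
      then have "(ip x (e i))\<^sup>2 \<le> ip x x"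
        unfolding ipx by (intro member_le_sum[where f = "\<lambda>i. (ip x (e i))\<^sup>2"]) auto
      with xr have "(ip x (e i))\<^sup>2 \<le> r\<^sup>2" by simp
      then show ?thesis using True by (simp add: c_def abs_le_square_iff)
    qed (simp add: c_def)
    then have "c \<in> K" by (auto simp: K_def abs_le_iff minus_le_iff)
    then show ?thesis using C(2) xc by metis
  qed
  with that C(1) show ?thesis by blast
qed

section \<open>A saddle point system with a monotone nonlinearity\<close>

lemma bilinear_form_on_pairI:
  assumes "\<And>x x' y a b. x \<in> X \<Longrightarrow> x' \<in> X \<Longrightarrow> y \<in> Y \<Longrightarrow> f (a *\<^sub>R x + b *\<^sub>R x') y = a * f x y + b * f x' y"
    and "\<And>x y y' a b. x \<in> X \<Longrightarrow> y \<in> Y \<Longrightarrow> y' \<in> Y \<Longrightarrow> f x (a *\<^sub>R y + b *\<^sub>R y') = a * f x y + b * f x y'"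
  shows "bilinear_form_on X Y f"
  using assms by (simp add: bilinear_form_on_def linear_form_on_def)

lemma bilinear_form_on_combine:
  assumes "bilinear_form_on X Y f"
  shows "x \<in> X \<Longrightarrow> x' \<in> X \<Longrightarrow> y \<in> Y \<Longrightarrow> f (a *\<^sub>R x + b *\<^sub>R x') y = a * f x y + b * f x' y"
    and "x \<in> X \<Longrightarrow> y \<in> Y \<Longrightarrow> y' \<in> Y \<Longrightarrow> f x (a *\<^sub>R y + b *\<^sub>R y') = a * f x y + b * f x y'"
  using assms by (simp_all add: bilinear_form_on_def linear_form_on_def)

lemma Times_subset_span:
  fixes X :: "'a::real_vector set" and Y :: "'b::real_vector set"
  assumes "X \<subseteq> span B" "Y \<subseteq> span C"
  shows "X \<times> Y \<subseteq> span ((\<lambda>x. (x, 0)) ` B \<union> (\<lambda>y. (0, y)) ` C)"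
proof clarify
  fix x y assume "x \<in> X" "y \<in> Y"
  have l1: "linear (\<lambda>x::'a. (x, 0::'b))" and l2: "linear (\<lambda>y::'b. (0::'a, y))"
    by (auto intro!: linearI)
  have "(x, 0::'b) \<in> span ((\<lambda>x. (x, 0)) ` B)"
    unfolding linear_span_image[OF l1] using assms(1) \<open>x \<in> X\<close> by blast
  moreover have "(0::'a, y) \<in> span ((\<lambda>y. (0, y)) ` C)"
    unfolding linear_span_image[OF l2] using assms(2) \<open>y \<in> Y\<close> by blast
  ultimately have "(x, 0) + (0, y) \<in> span ((\<lambda>x. (x, 0)) ` B \<union> (\<lambda>y. (0, y)) ` C)"
    by (intro span_add) (meson span_mono subsetD sup_ge1 sup_ge2)+
  then show "(x, y) \<in> span ((\<lambda>x. (x, 0)) ` B \<union> (\<lambda>y. (0, y)) ` C)" by simp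
qed

text \<open>
  The vector \<open>u\<close> plays the role of the constant function 1. The energy controls \<open>\<psi>\<close> and \<open>\<mu>\<close> only up
  to their means \<open>s\<close> and \<open>t\<close>: that of \<open>\<psi>\<close> is recovered from the second equation tested with \<open>u\<close>,
  that of \<open>\<mu>\<close> from the third one. Hence the test vector \<open>(v, \<mu> + b s u, \<psi> - g t u)\<close>. Since \<open>N\<close> has
  no growth bound, the weight \<open>g\<close> of \<open>t\<^sup>2\<close> in the norm is chosen after the radius of the sphere.
\<close>

lemma saddle_system_solvable:
  fixes V :: "'v::real_vector set" and S :: "'s::real_vector set"
  assumes V: "subspace V" "V \<subseteq> span BV" "finite BV"
    and S: "subspace S" "S \<subseteq> span BS" "finite BS"
    and ipV: "inner_product_on V ipV"
    and B: "bilinear_form_on V V B" "\<And>v. v \<in> V \<Longrightarrow> c * ipV v v \<le> B v v"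
    and K: "bilinear_form_on V S K"
    and l: "linear_form_on V l"
    and A: "bilinear_form_on S S A" "\<And>x y. x \<in> S \<Longrightarrow> y \<in> S \<Longrightarrow> A x y = A y x"
      "\<And>x. x \<in> S \<Longrightarrow> 0 \<le> A x x"
    and M: "bilinear_form_on S S M" "\<And>x. x \<in> S \<Longrightarrow> c * A x x \<le> M x x"
    and P: "bilinear_form_on S S P" "\<And>x y. x \<in> S \<Longrightarrow> y \<in> S \<Longrightarrow> P x y = P y x"
    and c: "c > 0"
    and u: "u \<in> S" "P u u > 0"
      "\<And>x. x \<in> S \<Longrightarrow> A x u = 0" "\<And>x. x \<in> S \<Longrightarrow> M x u = 0"
    and definite: "\<And>x. x \<in> S \<Longrightarrow> A x x = 0 \<Longrightarrow> P x u = 0 \<Longrightarrow> x = 0"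
    and N: "\<And>x. x \<in> S \<Longrightarrow> linear_form_on S (N x)" "\<And>x. x \<in> S \<Longrightarrow> N 0 x \<le> N x x"
    and cont: "\<And>n (e :: nat \<Rightarrow> 's) z. (\<And>i. i < n \<Longrightarrow> e i \<in> S) \<Longrightarrow> z \<in> S \<Longrightarrow>
      continuous_on UNIV (\<lambda>c::nat \<Rightarrow> real. N (\<Sum>i<n. c i *\<^sub>R e i) z)"
  shows "\<exists>v\<in>V. \<exists>\<psi>\<in>S. \<exists>\<mu>\<in>S. \<forall>w\<in>V. \<forall>\<Phi>\<in>S. \<forall>\<Psi>\<in>S.
    B v w - K w \<mu> + l w = 0 \<and>
    P \<psi> \<Phi> + M \<mu> \<Phi> + K v \<Phi> = 0 \<and>
    A \<psi> \<Psi> + N \<psi> \<Psi> - P \<mu> \<Psi> = 0"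
proof -
  note Bc = bilinear_form_on_combine[OF B(1)] and Kc = bilinear_form_on_combine[OF K]
    and Ac = bilinear_form_on_combine[OF A(1)] and Mc = bilinear_form_on_combine[OF M(1)]
    and Pc = bilinear_form_on_combine[OF P(1)]
    and Vc = bilinear_form_on_combine[OF inner_product_onD(1)[OF ipV]]
  have memV: "a *\<^sub>R x + b *\<^sub>R y \<in> V" if "x \<in> V" "y \<in> V" for a b x y
    using that by (intro subspace_add subspace_scale V)
  have memS: "a *\<^sub>R x + b *\<^sub>R y \<in> S" if "x \<in> S" "y \<in> S" for a b x y
    using that by (intro subspace_add subspace_scale S)
  have lc: "l (a *\<^sub>R x + b *\<^sub>R y) = a * l x + b * l y" if "x \<in> V" "y \<in> V" for a b x y
    using l that unfolding linear_form_on_def by blast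
  have Nc: "N z (a *\<^sub>R x + b *\<^sub>R y) = a * N z x + b * N z y" if "z \<in> S" "x \<in> S" "y \<in> S"
    for a b x y z
    using N(1) that unfolding linear_form_on_def by blast
  have V0: "0 \<in> V" and S0: "0 \<in> S" using subspace_0 V S by auto
  have ipV0: "ipV v v \<ge> 0" if "v \<in> V" for v
    using inner_product_onD(3)[OF ipV that]
      linear_form_onD(3)[OF bilinear_form_onD(1)[OF inner_product_onD(1)[OF ipV] V0] V(1)]
    by (cases "v = 0") auto
  \<comment> \<open>What the semidefinite form \<open>A\<close> misses is caught by the pairing with
    \<open>u\<close>; \<open>definite\<close> says that nothing escapes both.\<close>
  define ipS where "ipS x y = A x y + P x u * P y u" for x y
  have ipS: "inner_product_on S ipS"
    unfolding inner_product_on_def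
  proof (intro conjI ballI impI bilinear_form_on_pairI)
    show "ipS x x > 0" if "x \<in> S" "x \<noteq> 0" for x
      using A(3)[OF that(1)] definite[OF that(1)] that(2) not_sum_power2_lt_zero
      by (auto simp: ipS_def add_nonneg_eq_0_iff less_le)
  qed (auto simp: ipS_def Ac Pc u(1) A(2) algebra_simps)
  obtain L1 where L1: "L1 \<ge> 0" "\<And>v. v \<in> V \<Longrightarrow> \<bar>l v\<bar> \<le> L1 * sqrt (ipV v v)"
    using linear_form_on_bounded[OF V ipV l] by blast
  obtain k where k: "k \<ge> 0" "\<And>v. v \<in> V \<Longrightarrow> \<bar>K v u\<bar> \<le> k * sqrt (ipV v v)"
    using linear_form_on_bounded[OF V ipV bilinear_form_onD(1)[OF K u(1)]] by blast
  obtain L3 where L3: "L3 \<ge> 0" "\<And>x. x \<in> S \<Longrightarrow> \<bar>N 0 x\<bar> \<le> L3 * sqrt (ipS x x)"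
    using linear_form_on_bounded[OF S ipS N(1)[OF S0]] by blast
  \<comment> \<open>Chosen such that \<open>b * k\<^sup>2 \<le> c\<close>: the term
    \<open>b * s * K v u\<close>, caused by the shift of the second test vector, is then dominated
    by half of \<open>c * ipV v v\<close> and half of \<open>b * s\<^sup>2\<close>.\<close>
  define b where "b = c / (k\<^sup>2 + 1)"
  have k1: "k\<^sup>2 + 1 > 0" by (simp add: add_nonneg_pos)
  have "b > 0" "b * (k\<^sup>2 + 1) = c" using c k1 by (simp_all add: b_def)
  then have b: "b > 0" "b * k\<^sup>2 \<le> c" by (auto simp: algebra_simps)
  \<comment> \<open>The coercivity that remains after half of the velocity term and half of each of
    the two mean terms have been spent on absorption.\<close>
  define d where "d = min (min (c / 2) (b / 2)) (1 / 2)"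
  have d: "d > 0" "d \<le> c / 2" "d \<le> b / 2" "d \<le> 1 / 2" using b c by (auto simp: d_def)
  \<comment> \<open>On the sphere \<open>d * r\<^sup>2\<close> has to exceed the linear terms
    \<open>(L1 + L3) * r\<close> and the constant \<open>1 / 2\<close> that the choice of
    \<open>g\<close> leaves over.\<close>
  define r where "r = (L1 + L3 + 1) / d + 1"
  have r: "r \<ge> 1" "d * r \<ge> L1 + L3 + 1" using d L1 L3 by (auto simp: r_def field_simps)
  \<comment> \<open>\<open>ipS\<close> does not involve \<open>g\<close>, so this bound on the
    \<psi>-part of the sphere is available before \<open>g\<close>. With
    \<open>g * C\<^sup>2 = 1\<close>, the term \<open>g * t * N \<psi> u\<close> costs half of
    \<open>g * t\<^sup>2\<close> plus the constant \<open>1 / 2\<close>.\<close>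
  obtain C where C: "C > 0" "\<And>x. x \<in> S \<Longrightarrow> ipS x x \<le> r\<^sup>2 \<Longrightarrow> \<bar>N x u\<bar> \<le> C"
    using bounded_on_inner_product_ball[OF S ipS, of "\<lambda>x. N x u" r] cont u(1) by blast
  define g where "g = 1 / C\<^sup>2"
  have g: "g > 0" "g * C\<^sup>2 = 1" using C(1) by (auto simp: g_def)
  define X where "X = V \<times> S \<times> S"
  define ip where "ip = (\<lambda>(v, \<psi>, \<mu>) (w, \<Phi>, \<Psi>). ipV v w + ipS \<psi> \<Phi> + (A \<mu> \<Psi> + g * (P \<mu> u * P \<Psi> u)))"
  define E1 where "E1 = (\<lambda>(v, \<psi>::'s, \<mu>) w. B v w - K w \<mu> + l w)"
  define E2 where "E2 = (\<lambda>(v, \<psi>, \<mu>) \<Phi>. P \<psi> \<Phi> + M \<mu> \<Phi> + K v \<Phi>)"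
  define E3 where "E3 = (\<lambda>(v::'v, \<psi>, \<mu>) \<Psi>. A \<psi> \<Psi> + N \<psi> \<Psi> - P \<mu> \<Psi>)"
  have E1c: "E1 x (a *\<^sub>R w + b *\<^sub>R w') = a * E1 x w + b * E1 x w' " if "x \<in> X" "w \<in> V" "w' \<in> V"
    for x w w' a b
    using that by (auto simp: E1_def X_def Bc Kc lc algebra_simps)
  have E2c: "E2 x (a *\<^sub>R w + b *\<^sub>R w') = a * E2 x w + b * E2 x w' " if "x \<in> X" "w \<in> S" "w' \<in> S"
    for x w w' a b
    using that by (auto simp: E2_def X_def Pc Mc Kc algebra_simps)
  have E3c: "E3 x (a *\<^sub>R w + b *\<^sub>R w') = a * E3 x w + b * E3 x w' " if "x \<in> X" "w \<in> S" "w' \<in> S"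
    for x w w' a b
    using that by (auto simp: E3_def X_def Pc Ac Nc algebra_simps)
  \<comment> \<open>The shifted test vectors, expanded by linearity. The slots are crossed: at
    \<open>z = x\<close> the component \<psi> tests the third equation and \<mu> the second.\<close>
  define R where "R x =
    (\<lambda>(w, \<Phi>, \<Psi>). E1 x w + (E2 x \<Psi> + b * P \<Phi> u * E2 x u) + (E3 x \<Phi> - g * P \<Psi> u * E3 x u))" for x
  have X: "subspace X"
    unfolding X_def by (intro subspace_Times V S)
  obtain BX where BX: "X \<subseteq> span BX" "finite BX"
    unfolding X_def using Times_subset_span[OF V(2) Times_subset_span[OF S(2) S(2)]] V(3) S(3)
    by blast
  have A0: "A \<mu> u = 0" "M \<mu> u = 0" if "\<mu> \<in> S" for \<mu> using u(3,4) that by auto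
  have ipX: "inner_product_on X ip"
    unfolding inner_product_on_def
  proof (intro conjI ballI impI bilinear_form_on_pairI)
    note ipSc = bilinear_form_on_combine[OF inner_product_onD(1)[OF ipS]]
    show "ip (a *\<^sub>R x + b *\<^sub>R x') y = a * ip x y + b * ip x' y"
      if "x \<in> X" "x' \<in> X" "y \<in> X" for a b x x' y
      using that by (auto simp: ip_def X_def Vc ipSc Ac Pc u(1) algebra_simps)
    show "ip y (a *\<^sub>R x + b *\<^sub>R x') = a * ip y x + b * ip y x'"
      if "y \<in> X" "x \<in> X" "x' \<in> X" for a b x x' y
      using that by (auto simp: ip_def X_def Vc ipSc Ac Pc u(1) algebra_simps)
    show "ip x y = ip y x" if "x \<in> X" "y \<in> X" for x y
      using that inner_product_onD(2)[OF ipV] inner_product_onD(2)[OF ipS] A(2)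
      by (auto simp: ip_def X_def)
    show "ip x x > 0" if x: "x \<in> X" "x \<noteq> 0" for x
    proof -
      obtain v \<psi> \<mu> where xe: "x = (v, \<psi>, \<mu>)" by (cases x)
      have mem: "v \<in> V" "\<psi> \<in> S" "\<mu> \<in> S" using x(1) by (auto simp: xe X_def)
      have 1: "ipV v v \<ge> 0" "v \<noteq> 0 \<Longrightarrow> ipV v v > 0" using ipV0 inner_product_onD(3)[OF ipV] mem
        by auto
      have 2: "ipS \<psi> \<psi> \<ge> 0" "\<psi> \<noteq> 0 \<Longrightarrow> ipS \<psi> \<psi> > 0"
        using A(3) inner_product_onD(3)[OF ipS] mem by (auto simp: ipS_def)
      have 3: "A \<mu> \<mu> + g * (P \<mu> u * P \<mu> u) \<ge> 0" using A(3) mem g(1) by simp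
      have 4: "A \<mu> \<mu> + g * (P \<mu> u * P \<mu> u) > 0" if "\<mu> \<noteq> 0"
      proof (cases "P \<mu> u = 0")
        case True
        then have "A \<mu> \<mu> \<noteq> 0" using definite mem that by blast
        then show ?thesis using A(3)[OF mem(3)] True by simp
      next
        case False
        then have "g * (P \<mu> u * P \<mu> u) > 0" using g(1) by (auto simp: zero_less_mult_iff)
        then show ?thesis using A(3)[OF mem(3)] by simp
      qed
      show ?thesis using 1 2 3 4 x(2) unfolding xe ip_def by (auto simp: zero_prod_def)
    qed
  qed
  have Rlin: "linear_form_on X (R x)" if x: "x \<in> X" for x
    unfolding linear_form_on_def
  proof (intro ballI allI)
    fix y z p q assume "y \<in> X" "z \<in> X"
    then show "R x (p *\<^sub>R y + q *\<^sub>R z) = p * R x y + q * R x z"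
      unfolding X_def R_def
      by (auto simp: E1c[OF x] E2c[OF x] E3c[OF x] Pc u(1) algebra_simps)
  qed
  have energy: "R x x > 0" if x: "x \<in> X" "ip x x = r\<^sup>2" for x
  proof -
    obtain v \<psi> \<mu> where xe: "x = (v, \<psi>, \<mu>)" by (cases x)
    have mem: "v \<in> V" "\<psi> \<in> S" "\<mu> \<in> S" using x(1) by (auto simp: xe X_def)
    define s t where "s = P \<psi> u" and "t = P \<mu> u"
    have norm: "ipV v v + (A \<psi> \<psi> + s * s) + (A \<mu> \<mu> + g * (t * t)) = r\<^sup>2"
      using x(2) by (simp add: xe ip_def ipS_def s_def t_def)
    have nn: "ipV v v \<ge> 0" "A \<psi> \<psi> \<ge> 0" "A \<mu> \<mu> \<ge> 0" "s * s \<ge> 0" "g * (t * t) \<ge> 0"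
      using ipV0 A(3) mem g(1) by auto
    have ipSr: "ipS \<psi> \<psi> \<le> r\<^sup>2" and ipVr: "ipV v v \<le> r\<^sup>2"
      unfolding ipS_def s_def[symmetric] using norm nn by linarith+
    have sqr: "sqrt (ipS \<psi> \<psi>) \<le> r" "sqrt (ipV v v) \<le> r"
      using ipSr ipVr r(1) by (auto intro!: real_le_lsqrt)
    have e1: "\<bar>l v\<bar> \<le> L1 * r"
      using L1(2)[OF mem(1)] mult_left_mono[OF sqr(2) L1(1)] by linarith
    have e2: "\<bar>N 0 \<psi>\<bar> \<le> L3 * r"
      using L3(2)[OF mem(2)] mult_left_mono[OF sqr(1) L3(1)] by linarith
    have e3: "- (b * s * K v u) \<le> b / 2 * (s * s) + c / 2 * ipV v v"
    proof -
      have "- (s * K v u) \<le> (s * s + (K v u)\<^sup>2) / 2"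
        using zero_le_power2[of "s + K v u"] unfolding power2_sum by (simp add: power2_eq_square)
      moreover have "(K v u)\<^sup>2 \<le> k\<^sup>2 * ipV v v"
      proof -
        have "\<bar>K v u\<bar>\<^sup>2 \<le> (k * sqrt (ipV v v))\<^sup>2" using k(2)[OF mem(1)] by (intro power_mono) auto
        then show ?thesis using nn(1) by (simp add: power_mult_distrib)
      qed
      ultimately have "- (s * K v u) \<le> (s * s + k\<^sup>2 * ipV v v) / 2" by simp
      then have "b * - (s * K v u) \<le> b * ((s * s + k\<^sup>2 * ipV v v) / 2)"
        using b(1) by (intro mult_left_mono) auto
      moreover have "b * k\<^sup>2 * ipV v v \<le> c * ipV v v" using b(2) nn(1) by (intro mult_right_mono)
      ultimately show ?thesis by (simp add: algebra_simps)
    qed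
    have e4: "g * t * N \<psi> u \<le> g / 2 * (t * t) + 1 / 2"
    proof -
      have "t * N \<psi> u \<le> (t * t + (N \<psi> u)\<^sup>2) / 2"
        using zero_le_power2[of "t - N \<psi> u"] unfolding power2_diff by (simp add: power2_eq_square)
      moreover have "(N \<psi> u)\<^sup>2 \<le> C\<^sup>2"
        using C(2)[OF mem(2) ipSr] C(1) by (simp add: abs_le_square_iff[symmetric])
      ultimately have "t * N \<psi> u \<le> (t * t + C\<^sup>2) / 2" by simp
      then have "g * (t * N \<psi> u) \<le> g * ((t * t + C\<^sup>2) / 2)"
        using g(1) by (intro mult_left_mono) auto
      then show ?thesis using g(2) by (simp add: algebra_simps add_divide_distrib)
    qed
    \<comment> \<open>\<open>K v \<mu>\<close> cancels between the first two equations and, by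
      symmetry of \<open>P\<close>, \<open>P \<psi> \<mu>\<close> between the last two. The shifts
      by \<open>u\<close> do not meet \<open>A\<close> and \<open>M\<close>, which vanish against
      \<open>u\<close>.\<close>
    have "R x x = B v v + l v + M \<mu> \<mu> + b * (s * s) + b * s * K v u + A \<psi> \<psi> + N \<psi> \<psi>
        - g * t * N \<psi> u + g * (t * t)"
      using mem P(2)[OF mem(2,3)]
      by (simp add: xe R_def E1_def E2_def E3_def s_def t_def A0 algebra_simps)
    moreover have "N 0 \<psi> \<le> N \<psi> \<psi>" "c * ipV v v \<le> B v v" "c * A \<mu> \<mu> \<le> M \<mu> \<mu>"
      using N(2) B(2) M(2) mem by auto
    moreover have "d * ipV v v \<le> c / 2 * ipV v v" "d * (s * s) \<le> b / 2 * (s * s)"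
      "d * A \<psi> \<psi> \<le> 1 * A \<psi> \<psi>" "d * A \<mu> \<mu> \<le> c * A \<mu> \<mu>" "d * (g * (t * t)) \<le> 1 / 2 * (g * (t * t))"
      using d c nn by (intro mult_right_mono; simp)+
    moreover have "d * r\<^sup>2 = d * ipV v v + d * A \<psi> \<psi> + d * (s * s) + d * A \<mu> \<mu> + d * (g * (t * t))"
      unfolding norm[symmetric] by (simp add: algebra_simps)
    ultimately have "R x x \<ge> d * r\<^sup>2 - L1 * r - L3 * r - 1 / 2"
      using e1 e2 e3 e4 by linarith
    moreover have "d * r\<^sup>2 - L1 * r - L3 * r - 1 / 2 > 0"
    proof -
      have "(L1 + L3 + 1) * r \<le> d * r * r" using r by (intro mult_right_mono) auto
      then show ?thesis using r(1) by (simp add: algebra_simps power2_eq_square)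
    qed
    ultimately show ?thesis by linarith
  qed
  have Rcont: "continuous_on UNIV (\<lambda>c. R (\<Sum>i<n. c i *\<^sub>R e i) z)"
    if e: "\<And>i. i < n \<Longrightarrow> e i \<in> X" and z: "z \<in> X" for n and e :: "nat \<Rightarrow> 'v \<times> 's \<times> 's" and z
  proof -
    obtain w \<Phi> \<Psi> where ze: "z = (w, \<Phi>, \<Psi>)" by (cases z)
    have mem: "w \<in> V" "\<Phi> \<in> S" "\<Psi> \<in> S" using z by (auto simp: ze X_def)
    \<comment> \<open>The vector with which the third equation is actually tested. Apart from
      \<open>N \<psi> \<Phi>'\<close> and the constant \<open>l w\<close>, the residual is linear in
      \<open>x\<close>.\<close>
    define \<Phi>' where "\<Phi>' = 1 *\<^sub>R \<Phi> + (- (g * P \<Psi> u)) *\<^sub>R u"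
    have P': "\<Phi>' \<in> S" unfolding \<Phi>'_def by (intro memS mem u(1))
    define L where "L x = R x z - N (fst (snd x)) \<Phi>' - l w" for x
    have N': "N \<psi> \<Phi>' = N \<psi> \<Phi> - g * P \<Psi> u * N \<psi> u" if "\<psi> \<in> S" for \<psi>
      unfolding \<Phi>'_def Nc[OF that mem(2) u(1)] by simp
    have L: "linear_form_on X L"
      unfolding linear_form_on_def
    proof (intro ballI allI)
      fix x y p q assume "x \<in> X" "y \<in> X"
      then show "L (p *\<^sub>R x + q *\<^sub>R y) = p * L x + q * L y"
        unfolding L_def R_def ze E1_def E2_def E3_def X_def using mem u(1)
        by (auto simp: N' memS Bc Kc Mc Ac Pc algebra_simps)
    qed
    have "(\<Sum>i<n. c i *\<^sub>R e i) \<in> X" for c using e by (intro subspace_sum subspace_scale X) auto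
    have fs: "fst (snd (\<Sum>i<n. c i *\<^sub>R e i)) = (\<Sum>i<n. c i *\<^sub>R fst (snd (e i)))" for c
      by (simp add: fst_sum snd_sum)
    have Req: "R (\<Sum>i<n. c i *\<^sub>R e i) z = (\<Sum>i<n. c i * L (e i)) +
      N (\<Sum>i<n. c i *\<^sub>R fst (snd (e i))) \<Phi>' + l w" for c
      using linear_form_on_sum[OF L X, of "{..<n}" e c] e fs[of c] by (simp add: L_def)
    have "fst (snd (e i)) \<in> S" if "i < n" for i using e[OF that] by (auto simp: X_def)
    then have "continuous_on UNIV (\<lambda>c. N (\<Sum>i<n. c i *\<^sub>R fst (snd (e i))) \<Phi>')"
      by (intro cont P')
    moreover have "continuous_on UNIV (\<lambda>c::nat \<Rightarrow> real. \<Sum>i<n. c i * L (e i))"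
      by (intro continuous_on_sum continuous_on_mult_right continuous_on_product_coordinates)
    ultimately show ?thesis
      unfolding Req by (intro continuous_on_add continuous_on_const)
  qed
  have "\<exists>x\<in>X. \<forall>z\<in>X. R x z = 0"
  proof (rule form_zero_if_positive_on_sphere[OF X BX ipX])
    show "r > 0" using r(1) by simp
  qed (fact Rlin Rcont energy)+
  then obtain x where x: "x \<in> X" "\<And>z. z \<in> X \<Longrightarrow> R x z = 0" by blast
  obtain v \<psi> \<mu> where xe: "x = (v, \<psi>, \<mu>)" by (cases x)
  have mem: "v \<in> V" "\<psi> \<in> S" "\<mu> \<in> S" using x(1) by (auto simp: xe X_def)
  have E10: "E1 x 0 = 0" using E1c[OF x(1) V0 V0, of 0 0] by simp
  have E20: "E2 x 0 = 0" using E2c[OF x(1) S0 S0, of 0 0] by simp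
  have E30: "E3 x 0 = 0" using E3c[OF x(1) S0 S0, of 0 0] by simp
  have P0: "P 0 u = 0" using Pc(1)[OF S0 S0 u(1), of 0 0] by simp
  have 1: "E1 x w = 0" if "w \<in> V" for w
    using x(2)[of "(w, 0, 0)"] that S0 by (simp add: X_def R_def E20 E30 P0)
  have 2: "E3 x \<Phi> + b * P \<Phi> u * E2 x u = 0" if "\<Phi> \<in> S" for \<Phi>
    using x(2)[of "(0, \<Phi>, 0)"] that S0 V0 by (simp add: X_def R_def E10 E20 P0)
  have 3: "E2 x \<Psi> - g * P \<Psi> u * E3 x u = 0" if "\<Psi> \<in> S" for \<Psi>
    using x(2)[of "(0, 0, \<Psi>)"] that S0 V0 by (simp add: X_def R_def E10 E30 P0)
  \<comment> \<open>Testing with \<open>u\<close> gives two linear equations for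
    \<open>E2 x u\<close> and \<open>E3 x u\<close>, with determinant
    \<open>1 + g * b * (P u u * P u u) > 0\<close>. Both residuals vanish, and so the shifts drop
    out of all other equations.\<close>
  have "E2 x u * (1 + g * b * (P u u * P u u)) = 0"
    using 2[OF u(1)] 3[OF u(1)] by (simp add: algebra_simps eq_neg_iff_add_eq_0[symmetric])
  moreover have "1 + g * b * (P u u * P u u) > 0" using g(1) b(1) by (simp add: add_pos_nonneg)
  ultimately have u2: "E2 x u = 0" by auto
  then have u3: "E3 x u = 0" using 2[OF u(1)] by simp
  have 4: "E2 x \<Phi> = 0" if "\<Phi> \<in> S" for \<Phi> using 3[OF that] u3 by simp
  have 5: "E3 x \<Psi> = 0" if "\<Psi> \<in> S" for \<Psi> using 2[OF that] u2 by simp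
  have "\<forall>w\<in>V. \<forall>\<Phi>\<in>S. \<forall>\<Psi>\<in>S. B v w - K w \<mu> + l w = 0 \<and>
      P \<psi> \<Phi> + M \<mu> \<Phi> + K v \<Phi> = 0 \<and> A \<psi> \<Psi> + N \<psi> \<Psi> - P \<mu> \<Psi> = 0"
  proof (intro ballI)
    fix w \<Phi> \<Psi> assume "w \<in> V" "\<Phi> \<in> S" "\<Psi> \<in> S"
    then show "B v w - K w \<mu> + l w = 0 \<and> P \<psi> \<Phi> + M \<mu> \<Phi> + K v \<Phi> = 0 \<and>
        A \<psi> \<Psi> + N \<psi> \<Psi> - P \<mu> \<Psi> = 0"
      using 1[of w] 4[of \<Phi>] 5[of \<Psi>] by (simp add: xe E1_def E2_def E3_def)
  qed
  then show ?thesis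
    by (intro rev_bexI[OF mem(1)] rev_bexI[OF mem(2)] rev_bexI[OF mem(3)])
qed

section \<open>Smooth functions and test functions\<close>

lemma C_k_SucD: "C_k (Suc n) f \<Longrightarrow> C_k n f"
proof (induction n arbitrary: f)
  case 0
  then have "continuous (at x) f" for x
    using differentiable_imp_continuous_within by auto
  then show ?case by (simp add: continuous_at_imp_continuous_on)
qed auto

lemma C_k_const: "C_k n (\<lambda>x. c)"
  by (induction n arbitrary: c) auto

text \<open>Replaces the choice \<open>frechet_derivative\<close> by an explicit derivative, so that
  inductions can compute with it.\<close>

lemma C_k_SucI:
  assumes d: "\<And>x. (f has_derivative D x) (at x)" and "\<And>h. C_k n (\<lambda>x. D x h)"
  shows "C_k (Suc n) f"
  using assms(2) d by (auto simp: differentiable_def simp flip: frechet_derivative_at[OF d])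

lemma C_k_SucE:
  assumes "C_k (Suc n) f"
  obtains D where "\<And>x. (f has_derivative D x) (at x)" "\<And>h. C_k n (\<lambda>x. D x h)"
  using assms by (auto simp: frechet_derivative_works intro: that)

lemma C_k_add: "C_k n f \<Longrightarrow> C_k n g \<Longrightarrow> C_k n (\<lambda>x. f x + g x)"
proof (induction n arbitrary: f g)
  case (Suc n)
  obtain D E where "\<And>x. (f has_derivative D x) (at x)" "\<And>h. C_k n (\<lambda>x. D x h)"
    "\<And>x. (g has_derivative E x) (at x)" "\<And>h. C_k n (\<lambda>x. E x h)"
    using Suc.prems by (metis C_k_SucE)
  then show ?case
    by (intro C_k_SucI[where D = "\<lambda>x h. D x h + E x h"] Suc.IH has_derivative_add)
qed (auto intro: continuous_on_add)

lemma C_k_mult: "C_k n f \<Longrightarrow> C_k n g \<Longrightarrow> C_k n (\<lambda>x. f x * g x)"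
proof (induction n arbitrary: f g)
  case (Suc n)
  obtain D E where "\<And>x. (f has_derivative D x) (at x)" "\<And>h. C_k n (\<lambda>x. D x h)"
    "\<And>x. (g has_derivative E x) (at x)" "\<And>h. C_k n (\<lambda>x. E x h)"
    using Suc.prems by (metis C_k_SucE)
  then show ?case
    using Suc.prems[THEN C_k_SucD]
    by (intro C_k_SucI[where D = "\<lambda>x h. f x * E x h + D x h * g x"] C_k_add Suc.IH
      has_derivative_mult)
qed (auto intro: continuous_on_mult)

lemma C_k_bounded_linear:
  assumes "bounded_linear f"
  shows "C_k n f"
proof (cases n)
  case 0
  then show ?thesis using assms by (simp add: linear_continuous_on)
next
  case (Suc m)
  have "(f has_derivative f) (at x)" for x by (rule bounded_linear_imp_has_derivative[OF assms])
  then show ?thesis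
    using frechet_derivative_at[of f f] by (auto simp: Suc C_k_const differentiable_def)
qed

lemma C_k_sum: "(\<And>i. i \<in> I \<Longrightarrow> C_k n (f i)) \<Longrightarrow> C_k n (\<lambda>x. \<Sum>i\<in>I. f i x)"
  by (induction I rule: infinite_finite_induct) (auto intro: C_k_const C_k_add)

lemma C_k_prod: "(\<And>i. i \<in> I \<Longrightarrow> C_k n (f i)) \<Longrightarrow> C_k n (\<lambda>x. \<Prod>i\<in>I. f i x)"
  by (induction I rule: infinite_finite_induct) (auto intro: C_k_const C_k_mult)

lemma C_k_power: "C_k n f \<Longrightarrow> C_k n (\<lambda>x. f x ^ m)"
  by (induction m) (auto intro: C_k_const C_k_mult)

lemma smooth_polynomial:
  assumes "polynomial_deg_le j p"
  shows "smooth p"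
proof -
  obtain c :: "('a \<Rightarrow> nat) \<Rightarrow> real" where
    "p = (\<lambda>x. \<Sum>\<alpha> | sum \<alpha> UNIV \<le> j. c \<alpha> * (\<Prod>i\<in>UNIV. (x $ i) ^ \<alpha> i))"
    using assms by (auto simp: polynomial_deg_le_def fun_eq_iff)
  then show ?thesis
    by (auto simp: smooth_def intro!: C_k_sum C_k_mult C_k_const C_k_prod C_k_power
        C_k_bounded_linear[OF bounded_linear_vec_nth])
qed

lemma smooth_differentiable: "smooth f \<Longrightarrow> f differentiable (at x)"
  by (auto simp: smooth_def dest: spec[of _ "Suc 0"])

lemma smooth_continuous: "smooth f \<Longrightarrow> continuous_on UNIV f"
  by (auto simp: smooth_def dest: spec[of _ 0])

lemma smooth_continuous_derivative: "smooth f \<Longrightarrow>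
  continuous_on UNIV (\<lambda>x. frechet_derivative f (at x) h)"
  by (auto simp: smooth_def dest: spec[of _ "Suc 0"])

text \<open>The classical flat function, with a factor \<open>1 / t ^ j\<close> that makes the
  family closed under differentiation up to linear combinations. Smoothness becomes an induction for
  all \<open>j\<close> at once.\<close>

definition flat_exp :: "real \<Rightarrow> nat \<Rightarrow> real \<Rightarrow> real" where
  "flat_exp a j t = (if t > 0 then exp (- (a / t)) / t ^ j else 0)"

text \<open>From \<open>(1 + x / m) ^ m \<le> exp x\<close> at \<open>x = a / t\<close>.\<close>

lemma flat_exp_le:
  assumes "a > 0"
  shows "\<exists>C. \<forall>t. \<bar>flat_exp a j t\<bar> \<le> C * t\<^sup>2"
proof (intro exI allI)
  fix t :: real
  \<comment> \<open>Two powers of \<open>t\<close> survive the division by \<open>t ^ j\<close>,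
    enough for a vanishing derivative at \<open>0\<close>.\<close>
  define m where "m = j + 2"
  have m: "m > 0" by (simp add: m_def)
  show "\<bar>flat_exp a j t\<bar> \<le> (m / a) ^ m * t\<^sup>2"
  proof (cases "t > 0")
    case True
    have "(a / t / m) ^ m \<le> (1 + a / t / m) ^ m"
      using assms True by (intro power_mono) auto
    also have "\<dots> \<le> exp (a / t)"
      using assms True m by (intro exp_ge_one_plus_x_over_n_power_n)
        (auto simp: less_imp_le[OF divide_pos_pos] intro: order_trans[of _ 0])
    finally have "(a / (m * t)) ^ m \<le> exp (a / t)" by (simp add: mult.commute)
    then have "exp (- (a / t)) \<le> inverse ((a / (m * t)) ^ m)"
      using assms True m unfolding exp_minus by (intro le_imp_inverse_le) auto
    also have "\<dots> = (m / a) ^ m * t ^ m"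
      using assms True m by (simp add: power_divide power_mult_distrib field_simps)
    finally have "exp (- (a / t)) / t ^ j \<le> (m / a) ^ m * t ^ m / t ^ j"
      using True by (intro divide_right_mono) auto
    also have "\<dots> = (m / a) ^ m * t\<^sup>2" using True by (simp add: m_def power_add power2_eq_square)
    finally show ?thesis using True by (simp add: flat_exp_def)
  qed (use assms in \<open>simp add: flat_exp_def\<close>)
qed

text \<open>Only \<open>t = 0\<close> needs an argument beyond calculus: there the quadratic bound
  forces the difference quotient to \<open>0\<close>.\<close>

lemma flat_exp_has_derivative:
  assumes a: "a > 0"
  shows "(flat_exp a j has_real_derivative (a * flat_exp a (j + 2) t - j * flat_exp a (j + 1) t))
    (at t)"
proof -
  consider "t > 0" | "t < 0" | "t = 0" by linarith
  then show ?thesis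
  proof cases
    case 1
    have "((\<lambda>t. exp (- (a / t)) / t ^ j) has_real_derivative (a * flat_exp a (j + 2) t -
      j * flat_exp a (j + 1) t)) (at t)"
    proof (cases j)
      case 0
      then show ?thesis using 1
        by (auto intro!: derivative_eq_intros simp: flat_exp_def power2_eq_square field_simps)
    next
      case (Suc i)
      have e: "((\<lambda>t. exp (- (a / t))) has_real_derivative exp (- (a / t)) * (a / (t * t))) (at t)"
        using 1 by (auto intro!: derivative_eq_intros)
      have p: "((\<lambda>t. t ^ Suc i) has_real_derivative Suc i * t ^ i) (at t)"
        using DERIV_pow[of "Suc i" t] by simp
      show ?thesis using 1 unfolding Suc
        by (intro DERIV_cong[OF DERIV_divide[OF e p]]) (auto simp: flat_exp_def field_simps)
    qed
    then show ?thesis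
      by (rule has_field_derivative_transform_within_open[of _ _ _ "{0<..}"])
        (use 1 in \<open>auto simp: flat_exp_def\<close>)
  next
    case 2
    have "((\<lambda>t. 0) has_real_derivative 0) (at t)" by simp
    then have "(flat_exp a j has_real_derivative 0) (at t)"
      by (rule has_field_derivative_transform_within_open[of _ _ _ "{..<0}"])
        (use 2 in \<open>auto simp: flat_exp_def\<close>)
    then show ?thesis using 2 by (simp add: flat_exp_def)
  next
    case 3
    obtain C where C: "\<And>t. \<bar>flat_exp a j t\<bar> \<le> C * t\<^sup>2" using flat_exp_le[OF a] by blast
    have "((\<lambda>h. flat_exp a j h / h) \<longlongrightarrow> 0) (at 0)"
    proof (rule Lim_null_comparison)
      show "\<forall>\<^sub>F h in at 0. norm (flat_exp a j h / h) \<le> C * \<bar>h\<bar>"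
        using C by (intro eventually_at_filter[THEN iffD2] always_eventually)
          (auto simp: divide_simps power2_eq_square mult.assoc abs_mult_self_eq)
      show "((\<lambda>h. C * \<bar>h\<bar>) \<longlongrightarrow> 0) (at 0)" by (auto intro!: tendsto_eq_intros)
    qed
    then show ?thesis using 3 by (simp add: DERIV_def flat_exp_def)
  qed
qed

lemma C_k_flat_exp_affine:
  fixes l :: "'a::real_normed_vector \<Rightarrow> real"
  assumes a: "a > 0" and l: "bounded_linear l"
  shows "C_k n (\<lambda>x. flat_exp a j (l x + b))"
proof (induction n arbitrary: j)
  case 0
  have "continuous_on UNIV (flat_exp a j)"
    using flat_exp_has_derivative[OF a] by (meson DERIV_continuous continuous_at_imp_continuous_on)
  then show ?case
    using linear_continuous_on[OF l]
    by (auto intro!: continuous_on_compose2[of UNIV "flat_exp a j"] continuous_intros)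
next
  case (Suc n)
  have d: "((\<lambda>x. flat_exp a j (l x + b)) has_derivative
      (\<lambda>h. (a * flat_exp a (j + 2) (l x + b) - j * flat_exp a (j + 1) (l x + b)) * l h))
        (at x)" for x
    using flat_exp_has_derivative[OF a, of j "l x + b"] unfolding has_field_derivative_def
    by (rule has_derivative_compose[rotated])
      (auto intro!: derivative_eq_intros bounded_linear_imp_has_derivative[OF l])
  have "C_k n (\<lambda>x. (a * flat_exp a (j + 2) (l x + b) +
    - (real j * flat_exp a (j + 1) (l x + b))) * l h)" for h
    using C_k_mult[OF C_k_const[of n "- 1"]
      C_k_mult[OF C_k_const[of n "real j"] Suc.IH[of "j + 1"]]]
    by (intro C_k_mult C_k_add C_k_const Suc.IH) simp_all
  then show ?case
    by (intro C_k_SucI[OF d]) simp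
qed


lemma flat_exp_bounds:
  assumes "a > 0"
  shows "0 \<le> flat_exp a 0 t" "flat_exp a 0 t \<le> 1"
  using assms by (simp_all add: flat_exp_def less_imp_le)

text \<open>Smooth approximations of the indicator of an open box: inside, every factor tends to
  \<open>1\<close> as the rate \<open>1 / Suc k\<close> tends to \<open>0\<close>. The arguments are
  written as sums to match the affine form \<open>l x + b\<close>.\<close>

definition bump :: "real^'n \<Rightarrow> real^'n \<Rightarrow> nat \<Rightarrow> real^'n \<Rightarrow> real" where
  "bump a b k x = (\<Prod>i\<in>UNIV. flat_exp (1 / Suc k) 0 (x $ i +
    - a $ i) * flat_exp (1 / Suc k) 0 (- x $ i + b $ i))"

lemma smooth_bump: "smooth (bump a b k)"
proof -
  have "bounded_linear (\<lambda>x::real^'n. - x $ i)" for i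
    by (intro bounded_linear_minus bounded_linear_vec_nth)
  then show ?thesis
    unfolding smooth_def bump_def
    by (intro allI C_k_prod C_k_mult C_k_flat_exp_affine bounded_linear_vec_nth) auto
qed

lemma bump_bounds: "0 \<le> bump a b k x" "bump a b k x \<le> 1"
  unfolding bump_def
  by (auto intro!: prod_nonneg prod_le_1 mult_le_one mult_nonneg_nonneg flat_exp_bounds
    simp del: of_nat_Suc)

lemma bump_outside: "x \<notin> box a b \<Longrightarrow> bump a b k x = 0"
  by (auto simp: bump_def flat_exp_def mem_box_cart)

lemma bump_tendsto:
  assumes "x \<in> box a b"
  shows "(\<lambda>k. bump a b k x) \<longlonglongrightarrow> 1"
proof -
  have "(\<lambda>k. flat_exp (1 / Suc k) 0 t) \<longlonglongrightarrow> 1" if "t > 0" for t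
  proof -
    have "(\<lambda>k. exp (- (1 / real (Suc k) / t))) \<longlonglongrightarrow> exp (- (0 / t))"
      using that by (intro tendsto_intros LIMSEQ_inverse_real_of_nat[unfolded inverse_eq_divide])
        auto
    then show ?thesis using that by (simp add: flat_exp_def)
  qed
  then have "(\<lambda>k. bump a b k x) \<longlonglongrightarrow> (\<Prod>i\<in>(UNIV::'a set). 1 * 1)"
    unfolding bump_def using assms
    by (intro tendsto_intros) (auto simp: mem_box_cart simp del: of_nat_Suc)
  then show ?thesis by simp
qed

lemma bump_test_function:
  assumes "cbox a b \<subseteq> \<Omega>"
  shows "bump a b k \<in> test_functions \<Omega>"
proof -
  have "closure {x. bump a b k x \<noteq> 0} \<subseteq> cbox a b"
    using bump_outside[of _ a b k] box_subset_cbox[of a b] by (intro closure_minimal) blast+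
  then show ?thesis
    using assms smooth_bump
    by (auto simp: test_functions_def compact_eq_bounded_closed
      intro: bounded_subset[OF bounded_cbox])
qed

text \<open>Dominated convergence along the bump functions, which tend to the indicator of the box
  off its null boundary.\<close>

lemma integral_cbox_zero_if_orthogonal_to_test_functions:
  fixes u :: "real^'n \<Rightarrow> real"
  assumes \<Omega>: "\<Omega> \<in> sets lebesgue" and u: "locally_integrable \<Omega> u"
    and orth: "\<And>\<psi>. \<psi> \<in> test_functions \<Omega> \<Longrightarrow> (LINT x|lebesgue_on \<Omega>. u x * \<psi> x) = 0"
    and ab: "cbox a b \<subseteq> \<Omega>"
  shows "integral (cbox a b) u = 0"
proof -
  have ui: "integrable (lebesgue_on (cbox a b)) u"
    using u ab compact_cbox by (auto simp: locally_integrable_def)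
  have uL: "integrable lebesgue (\<lambda>x. indicator (cbox a b) x *\<^sub>R u x)"
    using ui by (simp add: integrable_restrict_space)
  have [measurable]: "(\<lambda>x. bump a b k x) \<in> borel_measurable lebesgue" for k
    by (intro measurable_completion)
      (auto intro!: borel_measurable_continuous_onI smooth_continuous smooth_bump)
  have zero: "(LINT x|lebesgue. indicator (cbox a b) x *\<^sub>R u x * bump a b k x) = 0" for k
  proof -
    have "(LINT x|lebesgue. indicator (cbox a b) x *\<^sub>R u x * bump a b k x) =
        (LINT x|lebesgue. indicator \<Omega> x *\<^sub>R (u x * bump a b k x))"
      using ab box_subset_cbox[of a b] bump_outside[of _ a b k]
      by (intro Bochner_Integration.integral_cong) (auto simp: indicator_def)
    also have "\<dots> = (LINT x|lebesgue_on \<Omega>. u x * bump a b k x)"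
      using \<Omega> by (simp add: integral_restrict_space)
    also have "\<dots> = 0" by (intro orth bump_test_function ab)
    finally show ?thesis .
  qed
  have "(\<lambda>k. LINT x|lebesgue. indicator (cbox a b) x *\<^sub>R u x * bump a b k x) \<longlonglongrightarrow>
      (LINT x|lebesgue. indicator (cbox a b) x *\<^sub>R u x)"
  proof (rule integral_dominated_convergence[where w = "\<lambda>x. norm (indicator (cbox a b) x *\<^sub>R u x)"])
    show "(\<lambda>x. indicator (cbox a b) x *\<^sub>R u x) \<in> borel_measurable lebesgue"
      using uL by auto
    then show "(\<lambda>x. indicator (cbox a b) x *\<^sub>R u x * bump a b k x) \<in> borel_measurable lebesgue"
      for k
      by (intro borel_measurable_times) auto
    show "integrable lebesgue (\<lambda>x. norm (indicator (cbox a b) x *\<^sub>R u x))" using uL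
      by (rule integrable_norm)
    have "AE x in lebesgue. x \<notin> cbox a b - box a b"
      using negligible_frontier_interval[of a b]
      by (intro AE_not_in) (simp add: negligible_iff_null_sets)
    then show "AE x in lebesgue. (\<lambda>k. indicator (cbox a b) x *\<^sub>R u x * bump a b k x) \<longlonglongrightarrow>
      indicator (cbox a b) x *\<^sub>R u x"
    proof eventually_elim
      case (elim x)
      show ?case
      proof (cases "x \<in> box a b")
        case True
        have "(\<lambda>k. indicator (cbox a b) x *\<^sub>R u x * bump a b k x) \<longlonglongrightarrow>
          indicator (cbox a b) x *\<^sub>R u x * 1"
          by (intro tendsto_mult tendsto_const bump_tendsto True)
        then show ?thesis by simp
      qed (use elim in simp)
    qed
    show "AE x in lebesgue. norm (indicator (cbox a b) x *\<^sub>R u x * bump a b k x) \<le>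
      norm (indicator (cbox a b) x *\<^sub>R u x)" for k
      using bump_bounds[of a b k] by (intro AE_I2) (auto simp: abs_mult intro!: mult_left_le)
  qed
  then have "(LINT x|lebesgue. indicator (cbox a b) x *\<^sub>R u x) = 0"
    unfolding zero using LIMSEQ_unique tendsto_const by blast
  then have "(LINT x|lebesgue_on (cbox a b). u x) = 0"
    by (simp add: integral_restrict_space)
  then show ?thesis
    using lebesgue_integral_eq_integral[OF ui] by simp
qed

text \<open>The fundamental lemma of the calculus of variations. All integrals of \<open>u\<close>
  over small cubes vanish, and by Lebesgue differentiation their averages recover \<open>u\<close>
  almost everywhere; countably many closed boxes exhaust \<Omega>.\<close>

lemma AE_zero_if_orthogonal_to_test_functions:
  fixes u :: "real^'n \<Rightarrow> real"
  assumes \<Omega>: "open \<Omega>" and u: "locally_integrable \<Omega> u"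
    and orth: "\<And>\<psi>. \<psi> \<in> test_functions \<Omega> \<Longrightarrow> (LINT x|lebesgue_on \<Omega>. u x * \<psi> x) = 0"
  shows "AE x in lebesgue_on \<Omega>. u x = 0"
proof -
  have \<Omega>s: "\<Omega> \<in> sets lebesgue" using \<Omega> by (simp add: lebesgue_openin)
  have neg: "negligible {x \<in> cbox c d. u x \<noteq> 0}" if cd: "cbox c d \<subseteq> \<Omega>" for c d
  proof -
    \<comment> \<open>Local integrability controls \<open>u\<close> inside the box only. The cutoff
      is integrable on every box, as the differentiation theorem asks.\<close>
    define f where "f x = (if x \<in> cbox c d then u x else 0)" for x
    have "integrable (lebesgue_on (cbox c d)) u"
      using u cd compact_cbox by (auto simp: locally_integrable_def)
    then have "u integrable_on cbox c d" by (simp add: integrable_on_lebesgue_on)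
    then have "f integrable_on UNIV" unfolding f_def by (simp add: integrable_restrict_UNIV)
    then have fi: "f integrable_on cbox a b" for a b by (rule integrable_on_subcbox) simp
    obtain N where N: "negligible N" "\<And>x e. \<lbrakk>x \<notin> N; 0 < e\<rbrakk> \<Longrightarrow>
        \<exists>\<delta>>0. \<forall>h. 0 < h \<and> h < \<delta> \<longrightarrow>
          norm (integral (cbox x (x + h *\<^sub>R One)) f /\<^sub>R h ^ DIM(real^'n) - f x) < e"
      using integrable_ccontinuous_explicit[OF fi] by blast
    have "u x = 0" if x: "x \<in> box c d" "x \<notin> N" for x
    proof (rule ccontr)
      assume "u x \<noteq> 0"
      then obtain \<delta> where \<delta>: "\<delta> > 0" "\<And>h. 0 < h \<Longrightarrow> h < \<delta> \<Longrightarrow>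
          norm (integral (cbox x (x + h *\<^sub>R One)) f /\<^sub>R h ^ DIM(real^'n) - f x) < \<bar>u x\<bar>"
        using N(2)[OF x(2), of "\<bar>u x\<bar>"] by auto
      obtain \<epsilon> where \<epsilon>: "\<epsilon> > 0" "ball x \<epsilon> \<subseteq> box c d"
        using x(1) open_box open_contains_ball by blast
      \<comment> \<open>The displacement from \<open>x\<close> to the opposite corner of the cube
        has length \<open>h * norm One\<close>, so this choice keeps the cube inside the
        box.\<close>
      define h where "h = min (\<delta> / 2) (\<epsilon> / (2 * norm (One :: real^'n)))"
      have One: "norm (One :: real^'n) > 0" by simp
      have h: "h > 0" "h < \<delta>" using \<delta>(1) \<epsilon>(1) One by (auto simp: h_def)
      have "h * norm (One :: real^'n) \<le> \<epsilon> / 2" 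
        using One by (auto simp: h_def min_def field_simps)
      then have hO: "norm (h *\<^sub>R (One :: real^'n)) < \<epsilon>" using h(1) \<epsilon>(1) by simp
      have "cbox x (x + h *\<^sub>R One) \<subseteq> cbox c d"
      proof -
        have "x + h *\<^sub>R One \<in> ball x \<epsilon>" using hO by (simp add: dist_norm)
        then have "x + h *\<^sub>R One \<in> cbox c d" "x \<in> cbox c d" using \<epsilon>(2) x(1) box_subset_cbox[of c d]
          by auto
        then show ?thesis by (auto simp: subset_box mem_box)
      qed
      then have "integral (cbox x (x + h *\<^sub>R One)) f = integral (cbox x (x + h *\<^sub>R One)) u"
        by (intro integral_cong) (auto simp: f_def)
      also have "\<dots> = 0"
        using \<open>cbox x (x + h *\<^sub>R One) \<subseteq> cbox c d\<close> cd
        by (intro integral_cbox_zero_if_orthogonal_to_test_functions[OF \<Omega>s u orth]) auto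
      finally have "norm (f x) < \<bar>u x\<bar>" using \<delta>(2)[OF h] by simp
      then show False using x(1) box_subset_cbox[of c d] by (auto simp: f_def)
    qed
    then have "{x \<in> cbox c d. u x \<noteq> 0} \<subseteq> N \<union> (cbox c d - box c d)" by auto
    then show ?thesis
      using N(1) negligible_frontier_interval negligible_subset negligible_Un by metis
  qed
  obtain D where D: "countable D" "\<And>X. X \<in> D \<Longrightarrow> \<exists>a b. X = cbox a b" "\<Union>D = \<Omega>"
    using open_countable_Union_open_cbox[OF \<Omega>] by metis
  have "negligible {x \<in> X. u x \<noteq> 0}" if "X \<in> D" for X
    using D(2)[OF that] D(3) that neg by blast
  then have "negligible (\<Union>X\<in>D. {x \<in> X. u x \<noteq> 0})"
    using D(1) by (intro negligible_countable_Union) auto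
  also have "(\<Union>X\<in>D. {x \<in> X. u x \<noteq> 0}) = {x \<in> \<Omega>. u x \<noteq> 0}" using D(3) by auto
  finally have "AE x in lebesgue. x \<notin> {x \<in> \<Omega>. u x \<noteq> 0}"
    by (intro AE_not_in) (simp add: negligible_iff_null_sets)
  then show ?thesis
    using \<Omega>s by (subst AE_restrict_space_iff) (auto elim: eventually_mono)
qed

section \<open>Essentially bounded functions and weak gradients\<close>

text \<open>Stable under sums, products and composition with continuous functions, and contained in
  every space needed here as \<Omega> has finite measure. The almost everywhere bound suits
  \<open>grad\<close>, which is determined only up to null sets.\<close>

definition ess_bounded :: "(real^'n) set \<Rightarrow> (real^'n \<Rightarrow> 'b::euclidean_space) \<Rightarrow> bool" where
  "ess_bounded \<Omega> f \<longleftrightarrow> f \<in> borel_measurable (lebesgue_on \<Omega>) \<and>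
     (\<exists>M. AE x in lebesgue_on \<Omega>. norm (f x) \<le> M)"

lemma ess_boundedE:
  assumes "ess_bounded \<Omega> f"
  obtains M where "M \<ge> 0" "f \<in> borel_measurable (lebesgue_on \<Omega>)"
    "AE x in lebesgue_on \<Omega>. norm (f x) \<le> M"
proof -
  obtain M where M: "f \<in> borel_measurable (lebesgue_on \<Omega>)" "AE x in lebesgue_on \<Omega>. norm (f x) \<le> M"
    using assms by (auto simp: ess_bounded_def)
  from M(2) have "AE x in lebesgue_on \<Omega>. norm (f x) \<le> max M 0" by eventually_elim simp
  with M(1) show ?thesis by (intro that[of "max M 0"]) auto
qed

lemma ess_bounded_integrable:
  assumes "\<Omega> \<in> lmeasurable" "ess_bounded \<Omega> f"
  shows "integrable (lebesgue_on \<Omega>) f"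
proof -
  have "finite_measure (lebesgue_on \<Omega>)"
    using assms(1) by (rule finite_measure_lebesgue_on)
  with assms(2) show ?thesis
    by (elim ess_boundedE) (rule finite_measure.integrable_const_bound)
qed

lemma ess_bounded_const: "ess_bounded \<Omega> (\<lambda>x. c)"
  by (auto simp: ess_bounded_def)

lemma ess_bounded_add:
  assumes "ess_bounded \<Omega> f" "ess_bounded \<Omega> g"
  shows "ess_bounded \<Omega> (\<lambda>x. f x + g x)"
proof -
  obtain M where M: "f \<in> borel_measurable (lebesgue_on \<Omega>)" "AE x in lebesgue_on \<Omega>. norm (f x) \<le> M"
    using ess_boundedE[OF assms(1)] by metis
  obtain N where N: "g \<in> borel_measurable (lebesgue_on \<Omega>)" "AE x in lebesgue_on \<Omega>. norm (g x) \<le> N"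
    using ess_boundedE[OF assms(2)] by metis
  from M(2) N(2) have "AE x in lebesgue_on \<Omega>. norm (f x + g x) \<le> M + N"
    by eventually_elim (rule norm_triangle_mono)
  with M(1) N(1) show ?thesis unfolding ess_bounded_def by (intro conjI borel_measurable_add) auto
qed

lemma ess_bounded_scaleR:
  fixes f :: "real^'n \<Rightarrow> real"
  assumes "ess_bounded \<Omega> f" "ess_bounded \<Omega> g"
  shows "ess_bounded \<Omega> (\<lambda>x. f x *\<^sub>R g x)"
proof -
  obtain M where M: "M \<ge> 0" "f \<in> borel_measurable (lebesgue_on \<Omega>)"
    "AE x in lebesgue_on \<Omega>. norm (f x) \<le> M"
    using ess_boundedE[OF assms(1)] .
  obtain N where N: "N \<ge> 0" "g \<in> borel_measurable (lebesgue_on \<Omega>)"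
    "AE x in lebesgue_on \<Omega>. norm (g x) \<le> N"
    using ess_boundedE[OF assms(2)] .
  from M(3) N(3) have "AE x in lebesgue_on \<Omega>. norm (f x *\<^sub>R g x) \<le> M * N"
    by eventually_elim (use M(1) in \<open>simp add: mult_mono\<close>)
  with M(2) N(2) show ?thesis unfolding ess_bounded_def
    by (intro conjI borel_measurable_scaleR) auto
qed

lemma ess_bounded_mult:
  fixes f g :: "real^'n \<Rightarrow> real"
  shows "ess_bounded \<Omega> f \<Longrightarrow> ess_bounded \<Omega> g \<Longrightarrow> ess_bounded \<Omega> (\<lambda>x. f x * g x)"
  using ess_bounded_scaleR[of \<Omega> f g] by simp

lemma ess_bounded_linear:
  assumes "bounded_linear T" "ess_bounded \<Omega> f"
  shows "ess_bounded \<Omega> (\<lambda>x. T (f x))"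
proof -
  obtain M where M: "f \<in> borel_measurable (lebesgue_on \<Omega>)" "AE x in lebesgue_on \<Omega>. norm (f x) \<le> M"
    using assms unfolding ess_bounded_def by blast
  obtain K where K: "K \<ge> 0" "\<And>y. norm (T y) \<le> norm y * K"
    using bounded_linear.nonneg_bounded[OF assms(1)] by blast
  from M(2) have "AE x in lebesgue_on \<Omega>. norm (T (f x)) \<le> M * K"
    by eventually_elim (meson K mult_right_mono order_trans)
  moreover have "(\<lambda>x. T (f x)) \<in> borel_measurable (lebesgue_on \<Omega>)"
    using assms(1) by (intro measurable_compose[OF M(1)] borel_measurable_continuous_onI
      linear_continuous_on)
  ultimately show ?thesis unfolding ess_bounded_def by blast
qed

lemma ess_bounded_sum:
  "(\<And>i. i \<in> I \<Longrightarrow> ess_bounded \<Omega> (f i)) \<Longrightarrow> ess_bounded \<Omega> (\<lambda>x. \<Sum>i\<in>I. f i x)"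
  by (induction I rule: infinite_finite_induct) (auto intro: ess_bounded_const ess_bounded_add)

lemma ess_bounded_inner:
  fixes f g :: "real^'n \<Rightarrow> 'b::euclidean_space"
  assumes "ess_bounded \<Omega> f" "ess_bounded \<Omega> g"
  shows "ess_bounded \<Omega> (\<lambda>x. f x \<bullet> g x)"
  using assms by (subst euclidean_inner)
    (intro ess_bounded_sum ess_bounded_mult ess_bounded_linear[OF bounded_linear_inner_left])

lemma ess_bounded_vec_nth: "ess_bounded \<Omega> f \<Longrightarrow> ess_bounded \<Omega> (\<lambda>x. f x $ i)"
  by (rule ess_bounded_linear[OF bounded_linear_vec_nth])

lemma ess_bounded_vec:
  fixes f :: "real^'n \<Rightarrow> 'm::finite \<Rightarrow> 'b::euclidean_space"
  assumes "\<And>i. ess_bounded \<Omega> (\<lambda>x. f x i)"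
  shows "ess_bounded \<Omega> (\<lambda>x. \<chi> i. f x i)"
proof -
  have ax: "bounded_linear (\<lambda>y::'b. axis i y :: 'b^'m)" for i
    by (intro linear_conv_bounded_linear[THEN iffD1] linearI) (auto simp: axis_def vec_eq_iff)
  have "(\<chi> i. f x i) = (\<Sum>i\<in>UNIV. axis i (f x i))" for x
    by (simp add: vec_eq_iff axis_def if_distrib[of "\<lambda>y. y $ _"] cong: if_cong)
  then show ?thesis
    by (simp add: ess_bounded_sum ess_bounded_linear[OF ax assms])
qed

lemma ess_bounded_compose:
  fixes f :: "real^'n \<Rightarrow> 'b::euclidean_space"
  assumes h: "continuous_on UNIV (h :: 'b \<Rightarrow> 'c::euclidean_space)" and f: "ess_bounded \<Omega> f"
  shows "ess_bounded \<Omega> (\<lambda>x. h (f x))"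
proof -
  obtain M where M: "f \<in> borel_measurable (lebesgue_on \<Omega>)" "AE x in lebesgue_on \<Omega>. norm (f x) \<le> M"
    using f unfolding ess_bounded_def by blast
  have "compact (h ` cball 0 M)"
    by (intro compact_continuous_image continuous_on_subset[OF h]) auto
  then obtain N where N: "\<And>y. y \<in> cball 0 M \<Longrightarrow> norm (h y) \<le> N"
    using compact_imp_bounded bounded_iff by (metis imageI)
  from M(2) have "AE x in lebesgue_on \<Omega>. norm (h (f x)) \<le> N"
    by eventually_elim (simp add: N)
  moreover have "(\<lambda>x. h (f x)) \<in> borel_measurable (lebesgue_on \<Omega>)"
    by (intro measurable_compose[OF M(1)] borel_measurable_continuous_onI h)
  ultimately show ?thesis unfolding ess_bounded_def by blast
qed

lemma ess_bounded_continuous: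
  fixes f :: "real^'n \<Rightarrow> 'b::euclidean_space"
  assumes "bounded \<Omega>" "\<Omega> \<in> sets lebesgue" "continuous_on (closure \<Omega>) f"
  shows "ess_bounded \<Omega> f"
proof -
  have "compact (f ` closure \<Omega>)"
    using assms by (intro compact_continuous_image) (auto simp: compact_closure)
  then obtain N where N: "\<And>y. y \<in> closure \<Omega> \<Longrightarrow> norm (f y) \<le> N"
    using compact_imp_bounded bounded_iff by (metis imageI)
  have "AE x in lebesgue_on \<Omega>. norm (f x) \<le> N"
    using N closure_subset[of \<Omega>] by (intro AE_I2) auto
  moreover have "f \<in> borel_measurable (lebesgue_on \<Omega>)"
    using assms closure_subset
    by (intro continuous_imp_measurable_on_sets_lebesgue continuous_on_subset[OF assms(3)]) auto
  ultimately show ?thesis unfolding ess_bounded_def by blast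
qed

text \<open>Completeness of Lebesgue measure. Through it the chosen function \<open>grad\<close>
  inherits measurability on all of \<Omega> from the elementwise gradient.\<close>

lemma borel_measurable_lebesgue_on_AE:
  fixes f :: "real^'n \<Rightarrow> 'b::euclidean_space"
  assumes \<Omega>: "\<Omega> \<in> sets lebesgue" and f: "f \<in> borel_measurable (lebesgue_on \<Omega>)"
    and fg: "AE x in lebesgue_on \<Omega>. f x = g x"
  shows "g \<in> borel_measurable (lebesgue_on \<Omega>)"
proof -
  have "(\<lambda>x. indicator \<Omega> x *\<^sub>R f x) \<in> borel_measurable lebesgue"
    using f \<Omega> by (simp add: borel_measurable_restrict_space_iff)
  moreover have "AE x in lebesgue. indicator \<Omega> x *\<^sub>R f x = indicator \<Omega> x *\<^sub>R g x"
    using fg \<Omega> by (subst (asm) AE_restrict_space_iff)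
      (auto elim: eventually_mono simp: indicator_def)
  ultimately have "(\<lambda>x. indicator \<Omega> x *\<^sub>R g x) \<in> borel_measurable lebesgue"
    by (rule borel_measurable_AE)
  then show ?thesis using \<Omega> by (simp add: borel_measurable_restrict_space_iff)
qed

lemma ess_bounded_cong_AE:
  assumes "\<Omega> \<in> sets lebesgue" "ess_bounded \<Omega> f" "AE x in lebesgue_on \<Omega>. f x = g x"
  shows "ess_bounded \<Omega> g"
proof -
  obtain M where M: "f \<in> borel_measurable (lebesgue_on \<Omega>)" "AE x in lebesgue_on \<Omega>. norm (f x) \<le> M"
    using assms unfolding ess_bounded_def by blast
  from M(2) assms(3) have "AE x in lebesgue_on \<Omega>. norm (g x) \<le> M" by eventually_elim simp
  then show ?thesis
    using borel_measurable_lebesgue_on_AE[OF assms(1) M(1) assms(3)] unfolding ess_bounded_def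
    by blast
qed

lemma ess_bounded_imp_L2:
  assumes "\<Omega> \<in> lmeasurable" "ess_bounded \<Omega> f"
  shows "f \<in> L2_space \<Omega>"
  using assms ess_bounded_inner[OF assms(2,2)]
  by (auto simp: L2_space_def power2_norm_eq_inner ess_bounded_def[of _ f]
    intro: ess_bounded_integrable)

lemma ess_bounded_imp_locally_integrable:
  assumes "open \<Omega>" "ess_bounded \<Omega> f"
  shows "locally_integrable \<Omega> f"
  unfolding locally_integrable_def
proof (intro allI impI)
  fix K assume K: "compact K \<and> K \<subseteq> \<Omega>"
  have \<Omega>: "\<Omega> \<in> sets lebesgue" using assms(1) by (simp add: lebesgue_openin)
  have Km: "K \<in> lmeasurable" using K by (simp add: lmeasurable_compact)
  obtain M where M: "f \<in> borel_measurable (lebesgue_on \<Omega>)" "AE x in lebesgue_on \<Omega>. norm (f x) \<le> M"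
    using assms unfolding ess_bounded_def by blast
  have "f \<in> borel_measurable (lebesgue_on K)"
    using M(1) K by (meson measurable_restrict_mono)
  moreover have "AE x in lebesgue_on K. norm (f x) \<le> M"
    using M(2) K \<Omega> Km by (subst (asm) AE_restrict_space_iff; simp; subst AE_restrict_space_iff)
      (auto elim: eventually_mono)
  ultimately have "ess_bounded K f" by (auto simp: ess_bounded_def)
  then show "integrable (lebesgue_on K) f" by (rule ess_bounded_integrable[OF Km])
qed

lemma test_function_bounded:
  assumes "\<psi> \<in> test_functions \<Omega>"
  obtains M where "\<And>x. \<bar>\<psi> x\<bar> \<le> M"
proof -
  define K where "K = closure {x. \<psi> x \<noteq> 0}"
  have "compact (\<psi> ` K)"
    using assms unfolding K_def
    by (intro compact_continuous_image continuous_on_subset[OF smooth_continuous])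
      (auto simp: test_functions_def)
  then obtain M where M: "\<And>x. x \<in> K \<Longrightarrow> norm (\<psi> x) \<le> M"
    using compact_imp_bounded bounded_iff by (metis imageI)
  have "\<bar>\<psi> x\<bar> \<le> max M 0" for x
  proof (cases "\<psi> x = 0")
    case False
    then have "x \<in> K" using closure_subset[of "{x. \<psi> x \<noteq> 0}"] unfolding K_def by auto
    then show ?thesis using M[of x] by auto
  qed simp
  then show ?thesis by (rule that)
qed

text \<open>The product lives on the compact support of the test function, where \<open>u\<close> is
  integrable and the other factor bounded.\<close>

lemma locally_integrable_times_test_function:
  fixes u :: "real^'n \<Rightarrow> real"
  assumes \<Omega>: "\<Omega> \<in> sets lebesgue" and u: "locally_integrable \<Omega> u" and \<psi>: "\<psi> \<in> test_functions \<Omega>"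
  shows "integrable (lebesgue_on \<Omega>) (\<lambda>x. u x * \<psi> x)"
proof -
  define K where "K = closure {x. \<psi> x \<noteq> 0}"
  have K: "compact K" "K \<subseteq> \<Omega>" using \<psi> by (auto simp: K_def test_functions_def)
  have Ks: "K \<in> sets lebesgue" using K(1) by (simp add: lmeasurable_compact fmeasurableD)
  have "integrable (lebesgue_on K) u" using u K by (simp add: locally_integrable_def)
  then have uK: "integrable lebesgue (\<lambda>x. indicator K x *\<^sub>R u x)"
    using Ks by (simp add: integrable_restrict_space)
  obtain M where M: "\<And>x. \<bar>\<psi> x\<bar> \<le> M" using test_function_bounded[OF \<psi>] by blast
  have m: "\<psi> \<in> borel_measurable lebesgue"
    using \<psi> by (intro measurable_completion)
      (auto intro!: borel_measurable_continuous_onI smooth_continuous simp: test_functions_def)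
  have "integrable lebesgue (\<lambda>x. (indicator K x *\<^sub>R u x) * \<psi> x)"
  proof (rule Bochner_Integration.integrable_bound)
    show "integrable lebesgue (\<lambda>x. M * (indicator K x *\<^sub>R u x))" using uK by simp
    show "(\<lambda>x. (indicator K x *\<^sub>R u x) * \<psi> x) \<in> borel_measurable lebesgue"
      using uK m by (intro borel_measurable_times) auto
    show "AE x in lebesgue. norm (indicator K x *\<^sub>R u x * \<psi> x) \<le> norm (M * (indicator K x *\<^sub>R u x))"
    proof (rule AE_I2)
      fix x
      have "\<bar>\<psi> x\<bar> * \<bar>u x\<bar> \<le> \<bar>M\<bar> * \<bar>u x\<bar>" using M[of x] by (intro mult_right_mono) auto
      then show "norm (indicator K x *\<^sub>R u x * \<psi> x) \<le> norm (M * (indicator K x *\<^sub>R u x))"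
        by (auto simp: indicator_def abs_mult mult.commute)
    qed
  qed
  also have "(\<lambda>x. (indicator K x *\<^sub>R u x) * \<psi> x) = (\<lambda>x. indicator \<Omega> x *\<^sub>R (u x * \<psi> x))"
  proof
    fix x
    have "x \<in> K" if "\<psi> x \<noteq> 0" using closure_subset[of "{x. \<psi> x \<noteq> 0}"] that unfolding K_def by auto
    then show "(indicator K x *\<^sub>R u x) * \<psi> x = indicator \<Omega> x *\<^sub>R (u x * \<psi> x)"
      using K(2) by (cases "\<psi> x = 0") (auto simp: indicator_def)
  qed
  finally show ?thesis using \<Omega> by (simp add: integrable_restrict_space)
qed

lemma is_weak_grad_cong:
  assumes "\<And>x. x \<in> \<Omega> \<Longrightarrow> u x = v x"
  shows "is_weak_grad \<Omega> u G \<longleftrightarrow> is_weak_grad \<Omega> v G"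
proof -
  have "integrable (lebesgue_on K) u \<longleftrightarrow> integrable (lebesgue_on K) v" if "K \<subseteq> \<Omega>" for K
    using assms that by (intro Bochner_Integration.integrable_cong) auto
  moreover have "(LINT x|lebesgue_on \<Omega>. u x * d x) = (LINT x|lebesgue_on \<Omega>. v x * d x)" for d
    using assms by (intro Bochner_Integration.integral_cong) auto
  ultimately show ?thesis by (simp add: is_weak_grad_def locally_integrable_def cong: conj_cong)
qed

text \<open>Both functions have the same weak gradients, so the choice returns the same one: the
  equality holds everywhere, not just almost everywhere. Values outside \<Omega> can thus be changed
  freely.\<close>

lemma grad_cong:
  assumes "\<And>x. x \<in> \<Omega> \<Longrightarrow> u x = v x"
  shows "grad \<Omega> u = grad \<Omega> v"
  using is_weak_grad_cong[of \<Omega> u v, OF assms] by (simp add: grad_def)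

text \<open>Each component of the difference is orthogonal to all test functions.\<close>

lemma weak_grad_unique:
  fixes G H :: "real^'n \<Rightarrow> real^'n"
  assumes \<Omega>: "open \<Omega>" and G: "is_weak_grad \<Omega> v G" and H: "is_weak_grad \<Omega> v H"
  shows "AE x in lebesgue_on \<Omega>. G x = H x"
proof -
  have \<Omega>s: "\<Omega> \<in> sets lebesgue" using \<Omega> by (simp add: lebesgue_openin)
  have li: "locally_integrable \<Omega> (\<lambda>x. G x $ i)" "locally_integrable \<Omega> (\<lambda>x. H x $ i)" for i
    using G H by (auto simp: is_weak_grad_def locally_integrable_def
      intro!: integrable_bounded_linear[OF bounded_linear_vec_nth])
  have "AE x in lebesgue_on \<Omega>. G x $ i - H x $ i = 0" for i
  proof (rule AE_zero_if_orthogonal_to_test_functions[OF \<Omega>])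
    show "locally_integrable \<Omega> (\<lambda>x. G x $ i - H x $ i)"
      using li[of i] by (auto simp: locally_integrable_def)
    fix \<psi> assume \<psi>: "\<psi> \<in> test_functions \<Omega>"
    define d where "d = (LINT x|lebesgue_on \<Omega>. v x * frechet_derivative \<psi> (at x) (axis i 1))"
    have "d = - (LINT x|lebesgue_on \<Omega>. G x $ i * \<psi> x)" "d = - (LINT x|lebesgue_on \<Omega>. H x $ i * \<psi> x)"
      using G H \<psi> unfolding is_weak_grad_def d_def by blast+
    then have "(LINT x|lebesgue_on \<Omega>. G x $ i * \<psi> x) = (LINT x|lebesgue_on \<Omega>. H x $ i * \<psi> x)"
      by simp
    then show "(LINT x|lebesgue_on \<Omega>. (G x $ i - H x $ i) * \<psi> x) = 0"
      using li[THEN locally_integrable_times_test_function[OF \<Omega>s _ \<psi>]]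
      by (simp add: left_diff_distrib)
  qed
  then have "AE x in lebesgue_on \<Omega>. \<forall>i\<in>UNIV. G x $ i - H x $ i = 0"
    by (intro AE_finite_allI) auto
  then show ?thesis by eventually_elim (simp add: vec_eq_iff)
qed

section \<open>Piecewise smooth functions on a mesh\<close>

lemma smooth_mult: "smooth f \<Longrightarrow> smooth g \<Longrightarrow> smooth (\<lambda>x. f x * g x)"
  by (simp add: smooth_def C_k_mult)

text \<open>The partial derivatives are bounded by compactness; convexity then allows the mean value
  inequality.\<close>

lemma smooth_lipschitz_on:
  fixes f :: "real^'n \<Rightarrow> real"
  assumes f: "smooth f" and T: "compact T" "convex T"
  obtains L where "L \<ge> 0" "\<And>x y. x \<in> T \<Longrightarrow> y \<in> T \<Longrightarrow> \<bar>f x - f y\<bar> \<le> L * norm (x - y)"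
proof -
  define D where "D x = frechet_derivative f (at x)" for x
  have D: "(f has_derivative D x) (at x)" for x
    using smooth_differentiable[OF f] by (simp add: D_def frechet_derivative_works)
  have "\<exists>M. \<forall>x\<in>T. \<bar>D x (axis i 1)\<bar> \<le> M" for i
  proof -
    have "compact ((\<lambda>x. D x (axis i 1)) ` T)" unfolding D_def
      by (intro compact_continuous_image T
        continuous_on_subset[OF smooth_continuous_derivative[OF f]]) auto
    from compact_imp_bounded[OF this] show ?thesis by (auto simp: bounded_iff)
  qed
  then obtain M where M: "\<And>i x. x \<in> T \<Longrightarrow> \<bar>D x (axis i 1)\<bar> \<le> M i" by metis
  define L where "L = (\<Sum>i\<in>UNIV. \<bar>M i\<bar>)"
  have L0: "L \<ge> 0" by (simp add: L_def sum_nonneg)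
  have on: "onorm (D x) \<le> L" if x: "x \<in> T" for x
  proof (rule onorm_le)
    fix h
    have lin: "linear (D x)" using D by (rule has_derivative_linear)
    have "D x h = D x (\<Sum>i\<in>UNIV. h $ i *\<^sub>R axis i 1)"
      using basis_expansion[of h] by (simp add: scalar_mult_eq_scaleR)
    also have "\<dots> = (\<Sum>i\<in>UNIV. h $ i * D x (axis i 1))"
      by (simp add: linear_sum[OF lin] linear_scale[OF lin])
    also have "norm \<dots> \<le> (\<Sum>i\<in>UNIV. \<bar>M i\<bar> * norm h)"
      unfolding real_norm_def
    proof (rule order.trans[OF sum_abs sum_mono])
      fix i
      have "\<bar>D x (axis i 1)\<bar> \<le> \<bar>M i\<bar>" using M[OF x, of i] by linarith
      then show "\<bar>h $ i * D x (axis i 1)\<bar> \<le> \<bar>M i\<bar> * norm h"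
        unfolding abs_mult by (subst mult.commute) (intro mult_mono component_le_norm_cart; simp)
    qed
    finally show "norm (D x h) \<le> L * norm h" by (simp add: L_def sum_distrib_right)
  qed
  have "norm (f x - f y) \<le> L * norm (x - y)" if "x \<in> T" "y \<in> T" for x y
    using differentiable_bound[OF T(2) has_derivative_at_withinI[OF D] on that] by simp
  then show ?thesis using L0 by (intro that[of L]) auto
qed

text \<open>The value \<open>0\<close> off the open elements keeps the function Borel and bounded
  everywhere; the points of the closed domain concerned form a null set.\<close>

definition pw_grad :: "(real^'n) set set \<Rightarrow> (real^'n \<Rightarrow> real) \<Rightarrow> real^'n \<Rightarrow> real^'n" where
  "pw_grad \<T> f x =
     (if x \<in> \<Union>(interior ` \<T>) then \<chi> i. frechet_derivative f (at x) (axis i 1) else 0)"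

text \<open>Every piece extends smoothly to the whole space, so derivatives stay bounded up to the
  faces of the element.\<close>

definition pw_smooth :: "(real^'n) set set \<Rightarrow> (real^'n \<Rightarrow> real) \<Rightarrow> bool" where
  "pw_smooth \<T> f \<longleftrightarrow> (\<forall>T\<in>\<T>. \<exists>p. smooth p \<and> (\<forall>x\<in>T. f x = p x))"

lemma FE_space_pw_smooth: "f \<in> FE_space j \<Omega> \<T> \<Longrightarrow> pw_smooth \<T> f"
  unfolding FE_space_def pw_smooth_def using smooth_polynomial by blast

lemma pw_smooth_has_derivative:
  assumes "pw_smooth \<T> f" "T \<in> \<T>" "x \<in> interior T"
  shows "(f has_derivative frechet_derivative f (at x)) (at x)"
proof -
  obtain p where p: "smooth p" "\<And>x. x \<in> T \<Longrightarrow> f x = p x" using assms by (auto simp: pw_smooth_def)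
  have d: "(p has_derivative frechet_derivative p (at x)) (at x)"
    using smooth_differentiable[OF p(1)] by (simp add: frechet_derivative_works)
  have "(f has_derivative frechet_derivative p (at x)) (at x)"
    by (rule has_derivative_transform_within_open[OF d open_interior assms(3)])
      (use p(2) interior_subset[of T] in auto)
  then show ?thesis using frechet_derivative_at by metis
qed

lemma pw_grad_eq:
  assumes "T \<in> \<T>" "x \<in> interior T" "\<And>x. x \<in> T \<Longrightarrow> f x = p x" "smooth p"
  shows "pw_grad \<T> f x = (\<chi> i. frechet_derivative p (at x) (axis i 1))"
proof -
  have d: "(p has_derivative frechet_derivative p (at x)) (at x)"
    using smooth_differentiable[OF assms(4)] by (simp add: frechet_derivative_works)
  have "(f has_derivative frechet_derivative p (at x)) (at x)"
    by (rule has_derivative_transform_within_open[OF d open_interior assms(2)])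
      (use assms(3) interior_subset[of T] in auto)
  then have "frechet_derivative f (at x) = frechet_derivative p (at x)"
    using frechet_derivative_at by metis
  then show ?thesis using assms(1,2) by (auto simp: pw_grad_def)
qed

lemma pw_grad_combine:
  assumes "pw_smooth \<T> f" "pw_smooth \<T> g"
  shows "pw_grad \<T> (\<lambda>x. a * f x + b * g x) x = a *\<^sub>R pw_grad \<T> f x + b *\<^sub>R pw_grad \<T> g x"
proof (cases "x \<in> \<Union>(interior ` \<T>)")
  case True
  then obtain T where "T \<in> \<T>" "x \<in> interior T" by blast
  then have d: "(f has_derivative frechet_derivative f (at x)) (at x)"
    "(g has_derivative frechet_derivative g (at x)) (at x)"
    using assms by (auto intro: pw_smooth_has_derivative)
  have "((\<lambda>x. a * f x + b * g x) has_derivative (\<lambda>h. a * frechet_derivative f (at x) h +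
    b * frechet_derivative g (at x) h)) (at x)"
    by (intro has_derivative_add has_derivative_mult_right d)
  then show ?thesis using True
    by (simp add: pw_grad_def vec_eq_iff frechet_derivative_at[symmetric])
next
  case False
  then show ?thesis by (simp add: pw_grad_def)
qed

lemma pw_grad_bounded:
  assumes f: "pw_smooth \<T> f" and fin: "finite \<T>" and T: "\<And>T. T \<in> \<T> \<Longrightarrow> compact T"
  obtains M where "\<And>x. norm (pw_grad \<T> f x) \<le> M"
proof -
  have "\<exists>M. \<forall>x\<in>interior T. norm (pw_grad \<T> f x) \<le> M" if t: "T \<in> \<T>" for T
  proof -
    obtain p where p: "smooth p" "\<And>x. x \<in> T \<Longrightarrow> f x = p x" using f t by (auto simp: pw_smooth_def)
    have "continuous_on UNIV (\<lambda>x. \<chi> i. frechet_derivative p (at x) (axis i 1))"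
      by (intro continuous_on_vec_lambda smooth_continuous_derivative p)
    then have "compact ((\<lambda>x. \<chi> i. frechet_derivative p (at x) (axis i 1)) ` T)"
      by (intro compact_continuous_image T t) (auto elim: continuous_on_subset)
    from compact_imp_bounded[OF this] obtain M where
      "\<And>x. x \<in> T \<Longrightarrow> norm (\<chi> i. frechet_derivative p (at x) (axis i 1)) \<le> M"
        by (auto simp: bounded_iff)
    then show ?thesis using pw_grad_eq[OF t _ p(2,1)] interior_subset[of T]
      by (intro exI[of _ M]) auto
  qed
  then obtain M where M: "\<And>T x. T \<in> \<T> \<Longrightarrow> x \<in> interior T \<Longrightarrow> norm (pw_grad \<T> f x) \<le> M T" by metis
  have "norm (pw_grad \<T> f x) \<le> (\<Sum>T\<in>\<T>. \<bar>M T\<bar>)" for x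
  proof (cases "x \<in> \<Union>(interior ` \<T>)")
    case True
    then obtain T where t: "T \<in> \<T>" "x \<in> interior T" by blast
    have "norm (pw_grad \<T> f x) \<le> \<bar>M T\<bar>" using M[OF t] by linarith
    also have "\<dots> \<le> (\<Sum>T\<in>\<T>. \<bar>M T\<bar>)" using fin t by (intro member_le_sum) auto
    finally show ?thesis .
  qed (simp add: pw_grad_def sum_nonneg)
  then show ?thesis by (rule that)
qed

lemma pw_grad_borel:
  assumes f: "pw_smooth \<T> f"
  shows "pw_grad \<T> f \<in> borel_measurable borel"
proof -
  define U where "U = \<Union>(interior ` \<T>)"
  have "continuous_on (interior T) (pw_grad \<T> f)" if t: "T \<in> \<T>" for T
  proof -
    obtain p where p: "smooth p" "\<And>x. x \<in> T \<Longrightarrow> f x = p x" using f t by (auto simp: pw_smooth_def)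
    have "continuous_on UNIV (\<lambda>x. \<chi> i. frechet_derivative p (at x) (axis i 1))"
      by (intro continuous_on_vec_lambda smooth_continuous_derivative p)
    then have "continuous_on (interior T) (\<lambda>x. \<chi> i. frechet_derivative p (at x) (axis i 1))"
      by (rule continuous_on_subset) simp
    then show ?thesis
      by (rule continuous_on_eq) (simp add: pw_grad_eq[OF t _ p(2,1)])
  qed
  then have "continuous_on U (pw_grad \<T> f)"
    unfolding U_def by (intro continuous_on_open_Union) auto
  moreover have "open U" unfolding U_def by auto
  ultimately have "(\<lambda>x. indicator U x *\<^sub>R pw_grad \<T> f x) \<in> borel_measurable borel"
    by (intro borel_measurable_continuous_on_indicator) auto
  also have "(\<lambda>x. indicator U x *\<^sub>R pw_grad \<T> f x) = pw_grad \<T> f"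
    by (auto simp: pw_grad_def U_def indicator_def fun_eq_iff)
  finally show ?thesis .
qed

lemma conforming_meshD:
  assumes "conforming_mesh \<Omega> \<T>"
  shows "finite \<T>" "\<Union>\<T> = closure \<Omega>"
    and "T \<in> \<T> \<Longrightarrow> compact T" "T \<in> \<T> \<Longrightarrow> convex T" "T \<in> \<T> \<Longrightarrow> T \<subseteq> closure \<Omega>"
    and "T \<in> \<T> \<Longrightarrow> closure (interior T) = T"
proof -
  show "finite \<T>" "\<Union>\<T> = closure \<Omega>" "T \<in> \<T> \<Longrightarrow> T \<subseteq> closure \<Omega>"
    using assms by (auto simp: conforming_mesh_def triangulation_def)
  have s: "int CARD('a) simplex T" if "T \<in> \<T>" using assms that by (auto simp: conforming_mesh_def)
  show c: "compact T" "convex T" if "T \<in> \<T>"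
    using s[OF that] by (auto intro: compact_simplex convex_simplex)
  show "closure (interior T) = T" if t: "T \<in> \<T>"
  proof -
    \<comment> \<open>In full dimension the interior is the relative interior, which is nonempty for
      a nonempty convex set.\<close>
    have d: "aff_dim T = int DIM(real^'a)" using aff_dim_simplex[OF s[OF t]] by simp
    have "interior T = rel_interior T"
      using interior_rel_interior[OF d] by simp
    moreover have "rel_interior T \<noteq> {}"
      using rel_interior_eq_empty[OF c(2)[OF t]] d by auto
    ultimately show ?thesis
      using convex_closure_interior[OF c(2)[OF t]] c(1)[OF t] by (simp add: compact_imp_closed)
  qed
qed

text \<open>A point of the closed domain in no open element lies on the frontier of one of finitely
  many convex sets, and such frontiers are null.\<close>

lemma negligible_mesh_skeleton:
  assumes "conforming_mesh \<Omega> \<T>"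
  shows "negligible (closure \<Omega> - \<Union>(interior ` \<T>))"
proof -
  have "closure \<Omega> - \<Union>(interior ` \<T>) \<subseteq> (\<Union>T\<in>\<T>. frontier T)"
  proof
    fix x assume x: "x \<in> closure \<Omega> - \<Union>(interior ` \<T>)"
    then obtain T where T: "T \<in> \<T>" "x \<in> T" using conforming_meshD(2)[OF assms] by blast
    then have "x \<in> frontier T" using x closure_subset[of T] by (auto simp: frontier_def)
    then show "x \<in> (\<Union>T\<in>\<T>. frontier T)" using T(1) by blast
  qed
  moreover have "negligible (\<Union>T\<in>\<T>. frontier T)"
    using conforming_meshD[OF assms]
    by (intro negligible_Union) (auto intro: negligible_convex_frontier)
  ultimately show ?thesis by (rule negligible_subset[rotated])
qed


lemma pw_grad_ess_bounded:
  assumes mesh: "conforming_mesh \<Omega> \<T>" and f: "pw_smooth \<T> f"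
  shows "ess_bounded \<Omega> (pw_grad \<T> f)"
proof -
  obtain M where M: "\<And>x. norm (pw_grad \<T> f x) \<le> M"
    using pw_grad_bounded[OF f conforming_meshD(1)[OF mesh] conforming_meshD(3)[OF mesh]] by metis
  have "pw_grad \<T> f \<in> borel_measurable lebesgue"
    using pw_grad_borel[OF f] by (intro measurable_completion) simp
  then show ?thesis
    unfolding ess_bounded_def using M by (auto intro: measurable_restrict_space1)
qed

lemma difference_quotient_LIMSEQ:
  fixes f :: "'a::real_normed_vector \<Rightarrow> real"
  assumes "(f has_derivative D) (at x)"
  shows "(\<lambda>k. (f (x + (1 / Suc k) *\<^sub>R e) - f x) / (1 / Suc k)) \<longlonglongrightarrow> D e"
proof -
  have "((\<lambda>t::real. f (x + t *\<^sub>R e)) has_derivative (\<lambda>t. D (t *\<^sub>R e))) (at 0)"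
    by (rule has_derivative_compose[of "\<lambda>t::real. x + t *\<^sub>R e" "\<lambda>t. t *\<^sub>R e" 0 UNIV f D])
      (use assms in \<open>auto intro!: derivative_eq_intros\<close>)
  moreover have "D (t *\<^sub>R e) = D e * t" for t
    using linear_scale[OF has_derivative_linear[OF assms]] by (simp add: mult.commute)
  ultimately have "((\<lambda>t::real. f (x + t *\<^sub>R e)) has_real_derivative D e) (at 0)"
    by (simp add: has_field_derivative_def)
  then have "((\<lambda>h. (f (x + h *\<^sub>R e) - f x) / h) \<longlongrightarrow> D e) (at 0)"
    by (simp add: DERIV_def)
  moreover have "filterlim (\<lambda>k. 1 / real (Suc k)) (at 0) sequentially"
    using LIMSEQ_inverse_real_of_nat by (auto simp: filterlim_at inverse_eq_divide)
  ultimately show ?thesis by (rule filterlim_compose)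
qed

text \<open>Restricted to the segment from \<open>y\<close> to \<open>x\<close>, the pieces form a
  finite closed cover of an interval, on which Lipschitz bounds glue without loss in the constant.
  The complement of \<Omega>, which is rarely convex, will be one of the pieces.\<close>

lemma lipschitz_if_lipschitz_on_finite_closed_cover:
  fixes h :: "'a::real_normed_vector \<Rightarrow> real"
  assumes fin: "finite I" and closed: "\<And>i. i \<in> I \<Longrightarrow> closed (C i)" and cover: "(\<Union>i\<in>I. C i) = UNIV"
    and lip: "\<And>i x y. i \<in> I \<Longrightarrow> x \<in> C i \<Longrightarrow> y \<in> C i \<Longrightarrow> \<bar>h x - h y\<bar> \<le> L * norm (x - y)"
    and L: "L \<ge> 0"
  shows "\<bar>h x - h y\<bar> \<le> L * norm (x - y)"
proof -
  define v where "v = x - y"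
  define k where "k s = h (y + s *\<^sub>R v)" for s :: real
  have "(L * norm v)-lipschitz_on {0..1} k"
  proof (rule lipschitz_on_closed_Union)
    show "(L * norm v)-lipschitz_on ((\<lambda>s. y + s *\<^sub>R v) -` C i) k" if i: "i \<in> I" for i
    proof (rule lipschitz_onI)
      fix s t assume "s \<in> (\<lambda>s. y + s *\<^sub>R v) -` C i" "t \<in> (\<lambda>s. y + s *\<^sub>R v) -` C i"
      then have "\<bar>k s - k t\<bar> \<le> L * norm ((y + s *\<^sub>R v) - (y + t *\<^sub>R v))"
        unfolding k_def by (intro lip[OF i]) auto
      also have "(y + s *\<^sub>R v) - (y + t *\<^sub>R v) = (s - t) *\<^sub>R v" by (simp add: algebra_simps)
      finally show "dist (k s) (k t) \<le> L * norm v * dist s t"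
        by (simp add: dist_real_def mult_ac)
    qed (use L in simp)
    show "closed ((\<lambda>s. y + s *\<^sub>R v) -` C i)" if "i \<in> I" for i
      by (intro continuous_closed_vimage closed that continuous_intros)
    show "{0..1} \<subseteq> (\<Union>i\<in>I. (\<lambda>s. y + s *\<^sub>R v) -` C i)"
      using cover by blast
  qed (use fin L in auto)
  then have "dist (k 1) (k 0) \<le> L * norm v * dist 1 (0::real)"
    by (rule lipschitz_onD) auto
  then show ?thesis by (simp add: k_def v_def dist_real_def)
qed

text \<open>
  Integration by parts without boundary terms: the product with a test function is globally
  Lipschitz, the integrals of its difference quotients vanish by translation invariance, and the
  quotients converge boundedly almost everywhere.
\<close>

lemma is_weak_grad_pw_grad:
  fixes f :: "real^'n \<Rightarrow> real"
  assumes \<Omega>: "open \<Omega>" "bounded \<Omega>" and mesh: "conforming_mesh \<Omega> \<T>"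
    and cont: "continuous_on (closure \<Omega>) f" and pw: "pw_smooth \<T> f"
  shows "is_weak_grad \<Omega> f (pw_grad \<T> f)"
proof -
  have \<Omega>s: "\<Omega> \<in> sets lebesgue" using \<Omega> by (simp add: lebesgue_openin)
  have "ess_bounded \<Omega> (pw_grad \<T> f)" by (rule pw_grad_ess_bounded[OF mesh pw])
  moreover have "ess_bounded \<Omega> f" by (rule ess_bounded_continuous[OF \<Omega>(2) \<Omega>s cont])
  ultimately have li: "locally_integrable \<Omega> f" "locally_integrable \<Omega> (pw_grad \<T> f)"
    by (auto intro: ess_bounded_imp_locally_integrable[OF \<Omega>(1)])
  have li_i: "locally_integrable \<Omega> (\<lambda>x. pw_grad \<T> f x $ i)" for i
    using li by (auto simp: locally_integrable_def
      intro!: integrable_bounded_linear[OF bounded_linear_vec_nth])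
  have "(LINT x|lebesgue_on \<Omega>. f x * frechet_derivative \<psi> (at x) (axis i 1)) =
      - (LINT x|lebesgue_on \<Omega>. pw_grad \<T> f x $ i * \<psi> x)"
    if \<psi>: "\<psi> \<in> test_functions \<Omega>" for \<psi> i
  proof -
    define e :: "real^'n" where "e = axis i 1"
    define K where "K = closure {x. \<psi> x \<noteq> 0}"
    define d where "d x = frechet_derivative \<psi> (at x) e" for x
    define h where "h x = (if x \<in> \<Omega> then f x * \<psi> x else 0)" for x
    define U where "U = \<Union>(interior ` \<T>)"
    define g where "g x = (if x \<in> \<Omega> then f x * d x + pw_grad \<T> f x $ i * \<psi> x else 0)" for x
    have K: "compact K" "K \<subseteq> \<Omega>" and sm: "smooth \<psi>" using \<psi> by (auto simp: K_def test_functions_def)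
    have out: "\<psi> x = 0" if "x \<notin> K" for x
      using that closure_subset[of "{x. \<psi> x \<noteq> 0}"] unfolding K_def by auto
    have D\<psi>: "(\<psi> has_derivative frechet_derivative \<psi> (at x)) (at x)" for x
      using smooth_differentiable[OF sm] by (simp add: frechet_derivative_works)
    have dout: "d x = 0" if "x \<notin> K" for x
    proof -
      have "((\<lambda>x. 0) has_derivative (\<lambda>x. 0)) (at x)" by simp
      then have "(\<psi> has_derivative (\<lambda>x. 0)) (at x)"
        by (rule has_derivative_transform_within_open[where s = "- K"])
          (use that out K(1) in \<open>auto simp: compact_imp_closed open_Compl\<close>)
      from frechet_derivative_at[OF this] show ?thesis by (metis d_def)
    qed
    have "smooth d" using sm unfolding smooth_def d_def by (metis C_k.simps(2))
    have "closure {x. d x \<noteq> 0} \<subseteq> K"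
      using dout K(1) by (intro closure_minimal) (auto simp: compact_imp_closed)
    then have dtest: "d \<in> test_functions \<Omega>"
      using \<open>smooth d\<close> K bounded_subset[OF compact_imp_bounded[OF K(1)]]
      by (auto simp: test_functions_def compact_eq_bounded_closed)
    obtain L where L: "L \<ge> 0" "\<And>x y. \<bar>h x - h y\<bar> \<le> L * norm (x - y)"
    proof -
      have "\<exists>L. L \<ge> 0 \<and> (\<forall>x\<in>T. \<forall>y\<in>T. \<bar>h x - h y\<bar> \<le> L * norm (x - y))" if T: "T \<in> \<T>" for T
      proof -
        obtain p where p: "smooth p" "\<And>x. x \<in> T \<Longrightarrow> f x = p x" using pw T
          by (auto simp: pw_smooth_def)
        \<comment> \<open>This includes the points of \<open>T\<close> outside \<Omega>: both sides
          vanish there, because the support of \<psi> lies in \<Omega>.\<close>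
        have "h x = p x * \<psi> x" if "x \<in> T" for x
          using p(2)[OF that] out[of x] K(2) by (auto simp: h_def)
        then show ?thesis
          using smooth_lipschitz_on[OF smooth_mult[OF p(1) sm] conforming_meshD(3)[OF mesh T]
            conforming_meshD(4)[OF mesh T]]
          by (metis (no_types, lifting))
      qed
      then obtain L where L: "\<And>T. T \<in> \<T> \<Longrightarrow> L T \<ge> 0"
        "\<And>T x y. T \<in> \<T> \<Longrightarrow> x \<in> T \<Longrightarrow> y \<in> T \<Longrightarrow> \<bar>h x - h y\<bar> \<le> L T * norm (x - y)" by metis
      have fin: "finite \<T>" by (rule conforming_meshD(1)[OF mesh])
      have L0: "(\<Sum>T\<in>\<T>. L T) \<ge> 0" using L(1) by (rule sum_nonneg)
      have "\<bar>h x - h y\<bar> \<le> (\<Sum>T\<in>\<T>. L T) * norm (x - y)" for x y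
      proof (rule lipschitz_if_lipschitz_on_finite_closed_cover[of "insert (- \<Omega>) \<T>" "\<lambda>T. T"])
        show "(\<Union>T\<in>insert (- \<Omega>) \<T>. T) = UNIV"
          using conforming_meshD(2)[OF mesh] closure_subset[of \<Omega>] by auto
        show "closed T" if "T \<in> insert (- \<Omega>) \<T>" for T
          using that \<Omega>(1) conforming_meshD(3)[OF mesh] by (auto simp: compact_imp_closed)
        show "\<bar>h x - h y\<bar> \<le> (\<Sum>T\<in>\<T>. L T) * norm (x - y)"
          if T: "T \<in> insert (- \<Omega>) \<T>" "x \<in> T" "y \<in> T" for T x y
        proof (cases "T \<in> \<T>")
          case True
          have "L T \<le> (\<Sum>T\<in>\<T>. L T)" using True fin L(1) by (intro member_le_sum) auto
          then have "L T * norm (x - y) \<le> (\<Sum>T\<in>\<T>. L T) * norm (x - y)"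
            by (intro mult_right_mono) auto
          then show ?thesis using L(2)[OF True T(2,3)] by linarith
        next
          case False
          then show ?thesis using T L0 by (simp add: h_def)
        qed
      qed (use fin L0 in auto)
      then show ?thesis using that L0 by blast
    qed
    have hcont: "continuous_on UNIV h"
    proof -
      have "L-lipschitz_on UNIV h" using L by (intro lipschitz_onI) (auto simp: dist_norm)
      then show ?thesis by (rule lipschitz_on_continuous_on)
    qed
    obtain r where r: "r > 0" "\<Omega> \<subseteq> cball 0 r" using \<Omega>(2) by (auto simp: bounded_pos subset_iff)
    \<comment> \<open>The translations have length at most \<open>1\<close>, so all difference
      quotients vanish outside this one ball and \<open>L\<close> times its indicator dominates
      them.\<close>
    define B where "B = cball (0::real^'n) (r + 1)"
    define \<Delta> where "\<Delta> k x = (h (x + (1 / Suc k) *\<^sub>R e) - h x) / (1 / Suc k)" for k x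
    have ne: "norm e = 1" by (simp add: e_def)
    have hB: "h x = 0" if "x \<notin> cball 0 r" for x using that r(2) by (auto simp: h_def)
    have \<Delta>B: "\<Delta> k x = 0" if "x \<notin> B" for k x
    proof -
      define c where "c = (1 / Suc k) *\<^sub>R e"
      have "norm c \<le> 1" using ne by (simp add: c_def)
      moreover have "norm x > r + 1" using that by (simp add: B_def)
      moreover have "norm x - norm c \<le> norm (x + c)" using norm_triangle_ineq2[of x "- c"] by simp
      ultimately have "norm (x + c) > r" "norm x > r" by linarith+
      then show ?thesis unfolding \<Delta>_def c_def[symmetric] by (simp add: hB)
    qed
    have hi: "integrable lborel h"
    proof -
      have "integrable lborel (\<lambda>x. indicator (cball 0 r) x *\<^sub>R h x)"
        using borel_integrable_compact[of "cball 0 r" h] continuous_on_subset[OF hcont] by auto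
      also have "(\<lambda>x. indicator (cball 0 r) x *\<^sub>R h x) = h"
        using hB by (auto simp: indicator_def fun_eq_iff)
      finally show ?thesis .
    qed
    have tr: "integrable lborel (\<lambda>x. h (x + c))" "(LINT x|lborel. h (x + c)) = (LINT x|lborel. h x)"
      for c
    proof -
      have m: "h \<in> borel_measurable borel" by (intro borel_measurable_continuous_onI hcont)
      have d: "distr lborel borel ((+) c) = (lborel :: (real^'n) measure)"
        by (rule lborel_distr_plus)
      show "(LINT x|lborel. h (x + c)) = (LINT x|lborel. h x)"
        using integral_distr[of "(+) c" lborel borel h] m by (simp add: d add.commute)
      show "integrable lborel (\<lambda>x. h (x + c))"
        using integrable_distr_eq[of "(+) c" lborel borel h] m hi by (simp add: d add.commute)
    qed
    have \<Delta>0: "(LINT x|lborel. \<Delta> k x) = 0" for k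
      unfolding \<Delta>_def using tr hi by simp
    have lim: "(\<lambda>k. \<Delta> k x) \<longlonglongrightarrow> g x" if x: "x \<in> \<Omega> \<Longrightarrow> x \<in> U" for x
    proof (cases "x \<in> \<Omega>")
      case True
      then obtain T where T: "T \<in> \<T>" "x \<in> interior T" using x by (auto simp: U_def)
      have "((\<lambda>x. f x * \<psi> x) has_derivative (\<lambda>v. f x * frechet_derivative \<psi> (at x) v +
        frechet_derivative f (at x) v * \<psi> x)) (at x)"
        by (intro has_derivative_mult pw_smooth_has_derivative[OF pw T] D\<psi>)
      then have "(h has_derivative (\<lambda>v. f x * frechet_derivative \<psi> (at x) v +
        frechet_derivative f (at x) v * \<psi> x)) (at x)"
        by (rule has_derivative_transform_within_open[OF _ \<Omega>(1) True]) (simp add: h_def)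
      from difference_quotient_LIMSEQ[OF this, of e] show ?thesis
        using T True by (auto simp: \<Delta>_def g_def d_def pw_grad_def e_def)
    next
      case False
      \<comment> \<open>Outside \<Omega>, boundary included, \<open>x\<close> has a neighbourhood
        disjoint from \<open>K\<close>, where \<open>h\<close> is \<open>0\<close>.\<close>
      have "((\<lambda>x. 0) has_derivative (\<lambda>x. 0)) (at x)" by simp
      then have "(h has_derivative (\<lambda>x. 0)) (at x)"
        by (rule has_derivative_transform_within_open[where s = "- K"])
          (use False out K in \<open>auto simp: compact_imp_closed open_Compl h_def\<close>)
      from difference_quotient_LIMSEQ[OF this, of e] show ?thesis
        using False by (simp add: \<Delta>_def g_def)
    qed
    have int1: "integrable (lebesgue_on \<Omega>) (\<lambda>x. f x * d x)"
      by (rule locally_integrable_times_test_function[OF \<Omega>s li(1) dtest])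
    have int2: "integrable (lebesgue_on \<Omega>) (\<lambda>x. pw_grad \<T> f x $ i * \<psi> x)"
      by (rule locally_integrable_times_test_function[OF \<Omega>s li_i \<psi>])
    have g_eq: "g = (\<lambda>x. indicator \<Omega> x *\<^sub>R (f x * d x + pw_grad \<T> f x $ i * \<psi> x))"
      by (auto simp: g_def indicator_def)
    have gi: "integrable lebesgue g"
      unfolding g_eq using \<Omega>s int1 int2 by (subst integrable_restrict_space[symmetric]) auto
    have "(\<lambda>k. LINT x|lebesgue. \<Delta> k x) \<longlonglongrightarrow> (LINT x|lebesgue. g x)"
    proof (rule integral_dominated_convergence[where w = "\<lambda>x. indicator B x * L"])
      show "g \<in> borel_measurable lebesgue" using gi by simp
      have "continuous_on UNIV (\<Delta> k)" for k
        unfolding \<Delta>_def by (intro continuous_intros continuous_on_compose2[OF hcont]) auto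
      then show "\<Delta> k \<in> borel_measurable lebesgue" for k
        by (intro measurable_completion) (simp add: borel_measurable_continuous_onI)
      show "integrable lebesgue (\<lambda>x. indicator B x * L)"
        unfolding B_def using lmeasurable_cball[of "0::real^'n" "r + 1"]
        by (intro integrable_mult_left integrable_real_indicator) (auto simp: fmeasurable_def)
      have "AE x in lebesgue. x \<notin> closure \<Omega> - U"
        using negligible_mesh_skeleton[OF mesh] unfolding U_def
        by (intro AE_not_in) (simp add: negligible_iff_null_sets)
      then show "AE x in lebesgue. (\<lambda>k. \<Delta> k x) \<longlonglongrightarrow> g x"
        by eventually_elim (use closure_subset[of \<Omega>] lim in blast)
      show "AE x in lebesgue. norm (\<Delta> k x) \<le> indicator B x * L" for k
      proof (rule AE_I2)
        fix x
        have "\<bar>h (x + (1 / Suc k) *\<^sub>R e) - h x\<bar> \<le> L * (1 / Suc k)"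
          using L(2)[of "x + (1 / Suc k) *\<^sub>R e" x] ne by simp
        then have "\<bar>h (x + (1 / Suc k) *\<^sub>R e) - h x\<bar> * Suc k \<le> L"
          by (simp add: pos_le_divide_eq del: of_nat_Suc)
        then have "\<bar>\<Delta> k x\<bar> \<le> L" by (simp add: \<Delta>_def abs_mult del: of_nat_Suc)
        then show "norm (\<Delta> k x) \<le> indicator B x * L" using \<Delta>B[of x k] by (auto simp: indicator_def)
      qed
    qed
    moreover have "(LINT x|lebesgue. \<Delta> k x) = 0" for k
    proof -
      have "continuous_on UNIV (\<Delta> k)"
        unfolding \<Delta>_def by (intro continuous_intros continuous_on_compose2[OF hcont]) auto
      then have "\<Delta> k \<in> borel_measurable lborel" by (simp add: borel_measurable_continuous_onI)
      from integral_completion[OF this] show ?thesis by (simp add: \<Delta>0)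
    qed
    ultimately have "(\<lambda>k::nat. 0::real) \<longlonglongrightarrow> (LINT x|lebesgue. g x)" by simp
    then have "(LINT x|lebesgue. g x) = 0" by (simp add: LIMSEQ_const_iff)
    then have "(LINT x|lebesgue_on \<Omega>. f x * d x + pw_grad \<T> f x $ i * \<psi> x) = 0"
      unfolding g_eq using \<Omega>s by (simp add: integral_restrict_space)
    then show ?thesis using int1 int2 by (simp add: d_def e_def)
  qed
  with li show ?thesis by (auto simp: is_weak_grad_def)
qed

section \<open>Finite element spaces\<close>

text \<open>Measurability of \<open>F\<close> comes from the identity itself, by completeness. This
  suits integrands that contain \<open>grad\<close> of a linear combination.\<close>

lemma LINT_combine_AE:
  fixes f g F :: "real^'n \<Rightarrow> real"
  assumes \<Omega>: "\<Omega> \<in> sets lebesgue" and "integrable (lebesgue_on \<Omega>) f" "integrable (lebesgue_on \<Omega>) g"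
    and F: "AE x in lebesgue_on \<Omega>. F x = a * f x + b * g x"
  shows "(LINT x|lebesgue_on \<Omega>. F x) = a * (LINT x|lebesgue_on \<Omega>. f x) +
    b * (LINT x|lebesgue_on \<Omega>. g x)"
proof -
  have m: "(\<lambda>x. a * f x + b * g x) \<in> borel_measurable (lebesgue_on \<Omega>)"
    using assms(2,3) by (intro borel_measurable_add borel_measurable_times) auto
  have F': "AE x in lebesgue_on \<Omega>. a * f x + b * g x = F x" using F by eventually_elim simp
  have "(LINT x|lebesgue_on \<Omega>. F x) = (LINT x|lebesgue_on \<Omega>. a * f x + b * g x)"
    by (rule integral_cong_AE[OF borel_measurable_lebesgue_on_AE[OF \<Omega> m F'] m F])
  then show ?thesis using assms(2,3) by simp
qed

lemma polynomial_deg_le_combine: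
  assumes "polynomial_deg_le j p" "polynomial_deg_le j q"
  shows "polynomial_deg_le j (\<lambda>x. a * p x + b * q x)"
proof -
  obtain c d where
    "\<And>x. p x = (\<Sum>\<alpha> | sum \<alpha> UNIV \<le> j. c \<alpha> * (\<Prod>i\<in>UNIV. (x $ i) ^ \<alpha> i))"
    "\<And>x. q x = (\<Sum>\<alpha> | sum \<alpha> UNIV \<le> j. d \<alpha> * (\<Prod>i\<in>UNIV. (x $ i) ^ \<alpha> i))"
    using assms unfolding polynomial_deg_le_def by blast
  then show ?thesis unfolding polynomial_deg_le_def
    by (intro exI[of _ "\<lambda>\<alpha>. a * c \<alpha> + b * d \<alpha>"])
      (simp add: sum_distrib_left sum.distrib[symmetric] algebra_simps)
qed

lemma polynomial_deg_le_const: "polynomial_deg_le j (\<lambda>x :: real^'n. c)"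
  unfolding polynomial_deg_le_def
proof (intro exI allI)
  fix x :: "real^'n"
  have "(\<Sum>\<alpha> | sum \<alpha> UNIV \<le> j. (if \<alpha> = (\<lambda>_. 0) then c else 0) * (\<Prod>i\<in>UNIV. (x $ i) ^ \<alpha> i)) =
      (\<Sum>\<alpha> | sum \<alpha> UNIV \<le> j. if \<alpha> = (\<lambda>_::'n. 0) then c else 0)"
    by (intro sum.cong) auto
  also have "\<dots> = c" by (subst sum.delta[OF finite_multiindices]) auto
  finally show "c = (\<Sum>\<alpha> | sum \<alpha> UNIV \<le>
    j. (if \<alpha> = (\<lambda>_. 0) then c else 0) * (\<Prod>i\<in>UNIV. (x $ i) ^ \<alpha> i))" ..
qed

lemma FE_space_combine:
  assumes "f \<in> FE_space j \<Omega> \<T>" "g \<in> FE_space j \<Omega> \<T>"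
  shows "(\<lambda>x. a * f x + b * g x) \<in> FE_space j \<Omega> \<T>"
  unfolding FE_space_def
proof (intro CollectI conjI ballI)
  show "continuous_on (closure \<Omega>) (\<lambda>x. a * f x + b * g x)"
    using assms unfolding FE_space_def by (intro continuous_intros) auto
  fix T assume T: "T \<in> \<T>"
  obtain p q where "polynomial_deg_le j p" "\<forall>x\<in>T. f x = p x" "polynomial_deg_le j q"
    "\<forall>x\<in>T. g x = q x"
    using assms T unfolding FE_space_def by blast
  then show "\<exists>p. polynomial_deg_le j p \<and> (\<forall>x\<in>T. a * f x + b * g x = p x)"
    by (intro exI[of _ "\<lambda>x. a * p x + b * q x"]) (auto intro: polynomial_deg_le_combine)
qed

lemma FE_space_cong:
  assumes "\<Union>\<T> = closure \<Omega>" "\<And>x. x \<in> closure \<Omega> \<Longrightarrow> f x = g x"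
  shows "f \<in> FE_space j \<Omega> \<T> \<longleftrightarrow> g \<in> FE_space j \<Omega> \<T>"
proof -
  have "(\<forall>x\<in>T. f x = p x) \<longleftrightarrow> (\<forall>x\<in>T. g x = p x)" if "T \<in> \<T>" for T p
  proof -
    have "f x = g x" if "x \<in> T" for x using assms that \<open>T \<in> \<T>\<close> by blast
    then show ?thesis by auto
  qed
  moreover have "continuous_on (closure \<Omega>) f \<longleftrightarrow> continuous_on (closure \<Omega>) g"
    using assms(2) by (intro continuous_on_cong) auto
  ultimately show ?thesis unfolding FE_space_def by auto
qed

lemma FE_space_const: "(\<lambda>x. c) \<in> FE_space j \<Omega> \<T>"
  unfolding FE_space_def using polynomial_deg_le_const by (auto intro!: exI[of _ "\<lambda>x. c"])

locale fe_mesh =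
  fixes \<Omega> :: "(real^'n) set" and \<T> :: "(real^'n) set set"
  assumes open_domain: "open \<Omega>" and bounded_domain: "bounded \<Omega>" and mesh: "conforming_mesh \<Omega> \<T>"
begin

lemma domain_sets: "\<Omega> \<in> sets lebesgue"
  using open_domain by (simp add: lebesgue_openin)

lemma domain_lmeasurable: "\<Omega> \<in> lmeasurable"
  using open_domain bounded_domain by (simp add: lmeasurable_open)

lemma FE_is_weak_grad:
  assumes "f \<in> FE_space j \<Omega> \<T>"
  shows "is_weak_grad \<Omega> f (pw_grad \<T> f)"
  using assms by (intro is_weak_grad_pw_grad open_domain bounded_domain mesh FE_space_pw_smooth)
    (auto simp: FE_space_def)

lemma FE_weak_grad:
  assumes "f \<in> FE_space j \<Omega> \<T>"
  shows "is_weak_grad \<Omega> f (grad \<Omega> f)"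
  unfolding grad_def by (rule someI[of "is_weak_grad \<Omega> f", OF FE_is_weak_grad[OF assms]])

lemma FE_grad_AE:
  assumes "f \<in> FE_space j \<Omega> \<T>"
  shows "AE x in lebesgue_on \<Omega>. grad \<Omega> f x = pw_grad \<T> f x"
proof -
  show ?thesis by (rule
    weak_grad_unique[OF open_domain FE_weak_grad[OF assms] FE_is_weak_grad[OF assms]])
qed

lemma FE_grad_ess_bounded:
  assumes f: "f \<in> FE_space j \<Omega> \<T>"
  shows "ess_bounded \<Omega> (grad \<Omega> f)"
proof -
  have "ess_bounded \<Omega> (pw_grad \<T> f)"
    by (rule pw_grad_ess_bounded[OF mesh FE_space_pw_smooth[OF f]])
  moreover have "AE x in lebesgue_on \<Omega>. pw_grad \<T> f x = grad \<Omega> f x"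
    using FE_grad_AE[OF f] by eventually_elim simp
  ultimately show ?thesis by (rule ess_bounded_cong_AE[OF domain_sets])
qed

lemma FE_ess_bounded: "f \<in> FE_space j \<Omega> \<T> \<Longrightarrow> ess_bounded \<Omega> f"
  by (rule ess_bounded_continuous[OF bounded_domain domain_sets]) (simp add: FE_space_def)

lemma FE_H1:
  assumes f: "f \<in> FE_space j \<Omega> \<T>"
  shows "f \<in> H1 \<Omega>"
proof -
  show ?thesis
    using FE_weak_grad[OF f] FE_ess_bounded[OF f] FE_grad_ess_bounded[OF f]
    by (auto simp: H1_def intro: ess_bounded_imp_L2[OF domain_lmeasurable])
qed

lemma FE_grad_combine:
  assumes f: "f \<in> FE_space j \<Omega> \<T>" and g: "g \<in> FE_space j \<Omega> \<T>"
  shows "AE x in lebesgue_on \<Omega>. grad \<Omega> (\<lambda>x. a * f x + b * g x) x = a *\<^sub>R grad \<Omega> f x +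
    b *\<^sub>R grad \<Omega> g x"
  using FE_grad_AE[OF f] FE_grad_AE[OF g] FE_grad_AE[OF FE_space_combine[OF f g]]
  by eventually_elim (simp add: pw_grad_combine FE_space_pw_smooth[OF f] FE_space_pw_smooth[OF g])

lemma FE_grad_const: "AE x in lebesgue_on \<Omega>. grad \<Omega> (\<lambda>x. c) x = 0"
  using FE_grad_AE[OF FE_space_const[of c]] by eventually_elim (simp add: pw_grad_def vec_eq_iff)

text \<open>On each element the gradient is continuous and vanishes on a dense set, so the function
  is constant there. It then takes finitely many values on the connected set
  \<open>closure \<Omega>\<close> and, being continuous, only one; no chain of neighbouring elements
  has to be followed.\<close>

lemma FE_constant_if_grad_zero:
  assumes f: "f \<in> FE_space j \<Omega> \<T>" and zero: "AE x in lebesgue_on \<Omega>. grad \<Omega> f x = 0"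
    and conn: "connected \<Omega>"
  shows "\<exists>c. \<forall>x\<in>closure \<Omega>. f x = c"
proof -
  have AE0: "AE x in lebesgue_on \<Omega>. pw_grad \<T> f x = 0"
    using FE_grad_AE[OF f] zero by eventually_elim simp
  have "\<exists>c. \<forall>x\<in>T. f x = c" if T: "T \<in> \<T>" for T
  proof -
    obtain p where p: "smooth p" "\<And>x. x \<in> T \<Longrightarrow> f x = p x"
      using FE_space_pw_smooth[OF f] T by (auto simp: pw_smooth_def)
    define G where "G x = (\<chi> i. frechet_derivative p (at x) (axis i 1))" for x
    have Gc: "continuous_on UNIV G" unfolding G_def
      by (intro continuous_on_vec_lambda smooth_continuous_derivative p)
    \<comment> \<open>The gradient is known to vanish only at points of \<Omega>, while an open
      element may contain boundary points of \<Omega>, for instance on a slit. As \<Omega> is dense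
      in its closure, \<open>W\<close> is dense in the element.\<close>
    define W where "W = \<Omega> \<inter> interior T"
    have "open {x. G x \<noteq> 0}" using Gc by (intro open_Collect_neq) auto
    then have "open (W \<inter> {x. G x \<noteq> 0})" using open_domain by (auto simp: W_def)
    moreover have "negligible (W \<inter> {x. G x \<noteq> 0})"
    proof -
      have "AE x in lebesgue. x \<in> \<Omega> \<longrightarrow> pw_grad \<T> f x = 0"
        using AE0 domain_sets by (subst (asm) AE_restrict_space_iff) auto
      then have "AE x in lebesgue. x \<notin> W \<inter> {x. G x \<noteq> 0}"
        by eventually_elim (auto simp: W_def G_def pw_grad_eq[OF T _ p(2,1)])
      then show ?thesis by (simp add: negligible_iff_null_sets
        completion.AE_iff_null_sets[symmetric] AE_iff_null_sets open_domain
          \<open>open (W \<inter> {x. G x \<noteq> 0})\<close>)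
    qed
    ultimately have "W \<inter> {x. G x \<noteq> 0} = {}" using open_not_negligible by blast
    then have GW: "G x = 0" if "x \<in> W" for x using that by auto
    have "interior T \<subseteq> closure W"
    proof -
      have "interior T \<subseteq> closure \<Omega>" using conforming_meshD(5)[OF mesh T] interior_subset[of T]
        by blast
      then show ?thesis using open_Int_closure_subset[OF open_interior, of T \<Omega>]
        by (auto simp: W_def Int_commute)
    qed
    then have "T \<subseteq> closure W"
      using conforming_meshD(6)[OF mesh T] closure_minimal[of "interior T" "closure W"] by simp
    moreover have "closure W \<subseteq> {x. G x = 0}"
      using Gc GW by (intro closure_minimal closed_Collect_eq) auto
    ultimately have GT: "G x = 0" if "x \<in> T" for x using that by auto
    have Dp: "(p has_derivative frechet_derivative p (at x)) (at x)" for x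
      using smooth_differentiable[OF p(1)] by (simp add: frechet_derivative_works)
    have "(p has_derivative (\<lambda>h. 0)) (at x within T)" if x: "x \<in> T" for x
    proof -
      have lin: "linear (frechet_derivative p (at x))" using Dp by (rule has_derivative_linear)
      have "frechet_derivative p (at x) h = 0" for h
      proof -
        have "frechet_derivative p (at x) h =
          frechet_derivative p (at x) (\<Sum>i\<in>UNIV. h $ i *\<^sub>R axis i 1)"
          using basis_expansion[of h] by (simp add: scalar_mult_eq_scaleR)
        also have "\<dots> = (\<Sum>i\<in>UNIV. h $ i * frechet_derivative p (at x) (axis i 1))"
          by (simp add: linear_sum[OF lin] linear_scale[OF lin])
        also have "\<dots> = 0" using GT[OF x] by (simp add: G_def vec_eq_iff)
        finally show ?thesis .
      qed
      then have "frechet_derivative p (at x) = (\<lambda>h. 0)" by (simp add: fun_eq_iff)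
      then show ?thesis using has_derivative_at_withinI[OF Dp[of x]] by simp
    qed
    then obtain c where "\<And>x. x \<in> T \<Longrightarrow> p x = c"
      using has_derivative_zero_constant[OF conforming_meshD(4)[OF mesh T]] by blast
    then show ?thesis using p(2) by auto
  qed
  then obtain c where c: "\<And>T x. T \<in> \<T> \<Longrightarrow> x \<in> T \<Longrightarrow> f x = c T" by metis
  have "f ` closure \<Omega> \<subseteq> c ` \<T>" using c conforming_meshD(2)[OF mesh] by fastforce
  then have "finite (f ` closure \<Omega>)" using conforming_meshD(1)[OF mesh] finite_subset by blast
  then have "f constant_on closure \<Omega>"
    using f conn by (intro continuous_finite_range_constant)
      (auto simp: FE_space_def connected_imp_connected_closure)
  then show ?thesis by (auto simp: constant_on_def)
qed

end

text \<open>With pointwise scaling, \<open>subspace\<close>, \<open>span\<close> and the forms above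
  apply to sets of functions.\<close>

instantiation "fun" :: (type, real_vector) real_vector
begin

definition scaleR_fun :: "real \<Rightarrow> ('a \<Rightarrow> 'b) \<Rightarrow> 'a \<Rightarrow> 'b" where
  "scaleR_fun a f = (\<lambda>x. a *\<^sub>R f x)"

instance
  by standard (simp_all add: scaleR_fun_def fun_eq_iff scaleR_add_left scaleR_add_right)

end

lemma scaleR_fun_apply: "(a *\<^sub>R f) x = a *\<^sub>R f x"
  by (simp add: scaleR_fun_def)

lemma sum_fun_apply: "(\<Sum>i\<in>I. f i) x = (\<Sum>i\<in>I. f i x)"
  by (induction I rule: infinite_finite_induct) auto

section \<open>Derivatives of convex functions and the nonlinear integral operator\<close>

lemma convex_deriv_above_tangent:
  fixes f :: "real \<Rightarrow> real"
  assumes "convex_on UNIV f" "\<And>s. f differentiable (at s)"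
  shows "deriv f y * (z - y) \<le> f z - f y"
proof -
  have "(f has_field_derivative deriv f y) (at y)"
    using assms(2) by (simp add: DERIV_deriv_iff_real_differentiable)
  then show ?thesis using convex_on_imp_above_tangent[OF assms(1), of y z] by simp
qed

lemma convex_deriv_mono:
  fixes f :: "real \<Rightarrow> real"
  assumes "convex_on UNIV f" "\<And>s. f differentiable (at s)"
  shows "0 \<le> (deriv f y - deriv f x) * (y - x)"
  using convex_deriv_above_tangent[OF assms, of x y] convex_deriv_above_tangent[OF assms, of y x]
  by (simp add: algebra_simps)

text \<open>The tangent inequality bounds \<open>deriv f y\<close> above by the secant slope from
  \<open>y\<close> to \<open>s + h\<close> with \<open>h > 0\<close>, and below by that with
  \<open>h < 0\<close>. The secant slopes are continuous in \<open>y\<close>, and at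
  \<open>y = s\<close> they are close to \<open>deriv f s\<close> for small
  \<open>h\<close>.\<close>

lemma convex_deriv_continuous:
  fixes f :: "real \<Rightarrow> real"
  assumes f: "convex_on UNIV f" and d: "\<And>s. f differentiable (at s)"
  shows "continuous_on UNIV (deriv f)"
proof -
  have "isCont (deriv f) s" for s
    unfolding isCont_def
  proof (rule order_tendstoI)
    have D: "((\<lambda>h. (f (s + h) - f s) / h) \<longlongrightarrow> deriv f s) (at 0)"
      using d[of s] DERIV_deriv_iff_real_differentiable[of f s] by (simp add: DERIV_def)
    have fs: "isCont f s" using d[of s] by (simp add: differentiable_imp_continuous_within)
    have Q: "((\<lambda>y. (f (s + h) - f y) / (s + h - y)) \<longlongrightarrow> (f (s + h) - f s) / h) (at s)" if "h \<noteq> 0"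
      for h
      using that fs by (auto intro!: tendsto_eq_intros simp: isCont_def)
    fix a
    {
      assume "deriv f s < a"
      then have "\<forall>\<^sub>F h in at_right 0. (f (s + h) - f s) / h < a"
        using D by (intro order_tendstoD(2)) (auto elim: filterlim_mono simp: at_le)
      then have "\<forall>\<^sub>F h in at_right 0. (f (s + h) - f s) / h < a \<and> 0 < h"
        by (simp add: eventually_conj eventually_at_right_less)
      then obtain h where h: "(f (s + h) - f s) / h < a" "h > 0"
        using eventually_happens'[OF trivial_limit_at_right_real] by blast
      have "\<forall>\<^sub>F y in at s. y < s + h"
        using h(2) by (intro order_tendstoD(2)[OF tendsto_ident_at]) simp
      then show "\<forall>\<^sub>F y in at s. deriv f y < a"
        using order_tendstoD(2)[OF Q[OF less_imp_neq[OF h(2), symmetric]] h(1)]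
      proof eventually_elim
        case (elim y)
        have "deriv f y \<le> (f (s + h) - f y) / (s + h - y)"
          using convex_deriv_above_tangent[OF f d, of y "s + h"] elim(1)
          by (simp add: pos_le_divide_eq)
        then show ?case using elim by linarith
      qed
    }
    {
      assume "a < deriv f s"
      then have "\<forall>\<^sub>F h in at_left 0. a < (f (s + h) - f s) / h"
        using D by (intro order_tendstoD(1)) (auto elim: filterlim_mono simp: at_le)
      then have "\<forall>\<^sub>F h in at_left 0. a < (f (s + h) - f s) / h \<and> h < 0"
        by (simp add: eventually_conj eventually_at_left_field lt_ex) 
      then obtain h where h: "a < (f (s + h) - f s) / h" "h < 0"
        using eventually_happens'[OF trivial_limit_at_left_real] by blast
      have "\<forall>\<^sub>F y in at s. s + h < y"
        using h(2) by (intro order_tendstoD(1)[OF tendsto_ident_at]) simp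
      then show "\<forall>\<^sub>F y in at s. a < deriv f y"
        using order_tendstoD(1)[OF Q[OF less_imp_neq[OF h(2)]] h(1)]
      proof eventually_elim
        case (elim y)
        have "(f (s + h) - f y) / (s + h - y) \<le> deriv f y"
          using convex_deriv_above_tangent[OF f d, of y "s + h"] elim(1)
          by (simp add: neg_divide_le_eq)
        then show ?case using elim by linarith
      qed
    }
  qed
  then show ?thesis by (simp add: continuous_at_imp_continuous_on)
qed

text \<open>Dominated convergence along sequences of coefficients: a convergent sequence is bounded
  in each coordinate, so almost everywhere all arguments of \<open>h\<close> stay in one compact
  interval.\<close>

lemma continuous_on_integral_superposition:
  fixes h :: "real \<Rightarrow> real" and e :: "nat \<Rightarrow> real^'n \<Rightarrow> real"
  assumes \<Omega>: "\<Omega> \<in> lmeasurable" and h: "continuous_on UNIV h" and w: "ess_bounded \<Omega> w"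
    and e: "\<And>i. i < n \<Longrightarrow> ess_bounded \<Omega> (e i)" and z: "ess_bounded \<Omega> z"
  shows "continuous_on UNIV (\<lambda>c::nat \<Rightarrow> real. LINT x|lebesgue_on \<Omega>. h (w x +
    (\<Sum>i<n. c i * e i x)) * z x)"
  unfolding continuous_on_sequentially comp_def
proof (intro allI ballI impI, elim conjE)
  fix X :: "nat \<Rightarrow> nat \<Rightarrow> real" and c assume X: "X \<longlonglongrightarrow> c"
  have Xi: "(\<lambda>k. X k i) \<longlonglongrightarrow> c i" for i
  proof -
    have "continuous_on UNIV (\<lambda>x::nat \<Rightarrow> real. x i)" by (rule continuous_on_product_coordinates)
    then have "isCont (\<lambda>x::nat \<Rightarrow> real. x i) c"
      unfolding continuous_on_eq_continuous_at[OF open_UNIV] by blast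
    then show ?thesis using X by (rule isCont_tendsto_compose)
  qed
  have "\<exists>R. \<forall>k. \<bar>X k i\<bar> \<le> R" for i
    using convergent_imp_Bseq[OF convergentI[OF Xi[of i]]] by (auto simp: Bseq_def)
  then obtain R where R: "\<And>k i. \<bar>X k i\<bar> \<le> R i" by metis
  have "\<exists>M. AE x in lebesgue_on \<Omega>. i < n \<longrightarrow> \<bar>e i x\<bar> \<le> M" for i
    using e[of i] by (cases "i < n") (auto simp: ess_bounded_def)
  then obtain M where M: "\<And>i. AE x in lebesgue_on \<Omega>. i < n \<longrightarrow> \<bar>e i x\<bar> \<le> M i" by metis
  obtain M0 where M0: "AE x in lebesgue_on \<Omega>. \<bar>w x\<bar> \<le> M0" using w by (auto simp: ess_bounded_def)
  obtain Z where Z: "AE x in lebesgue_on \<Omega>. \<bar>z x\<bar> \<le> Z" using z by (auto simp: ess_bounded_def)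
  \<comment> \<open>A common bound for the arguments along the whole sequence; on the ball of this
    radius \<open>h\<close> is bounded by \<open>H\<close>.\<close>
  define Q where "Q = M0 + (\<Sum>i<n. R i * M i)"
  have "compact (h ` cball 0 Q)"
    by (intro compact_continuous_image continuous_on_subset[OF h]) auto
  from compact_imp_bounded[OF this] obtain H where H0: "\<forall>y\<in>h ` cball 0 Q. norm y \<le> H"
    unfolding bounded_iff by blast
  have H: "\<bar>h s\<bar> \<le> H" if "\<bar>s\<bar> \<le> Q" for s
    using bspec[OF H0, of "h s"] that by simp
  have eb: "ess_bounded \<Omega> (\<lambda>x. h (w x + (\<Sum>i<n. c i * e i x)) * z x)" for c
    using e by (intro ess_bounded_mult z ess_bounded_compose[OF h] ess_bounded_add w ess_bounded_sum
      ess_bounded_const) auto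
  show "(\<lambda>k. LINT x|lebesgue_on \<Omega>. h (w x + (\<Sum>i<n. X k i * e i x)) * z x) \<longlonglongrightarrow>
      (LINT x|lebesgue_on \<Omega>. h (w x + (\<Sum>i<n. c i * e i x)) * z x)"
  proof (rule integral_dominated_convergence[where w = "\<lambda>_. H * Z"])
    show "(\<lambda>x. h (w x + (\<Sum>i<n. c i * e i x)) * z x) \<in> borel_measurable (lebesgue_on \<Omega>)" for c
      using eb[of c] by (simp add: ess_bounded_def)
    then show "(\<lambda>x. h (w x + (\<Sum>i<n. X k i * e i x)) * z x) \<in> borel_measurable (lebesgue_on \<Omega>)"
      for k .
    show "integrable (lebesgue_on \<Omega>) (\<lambda>x. H * Z)"
      by (rule ess_bounded_integrable[OF \<Omega> ess_bounded_const])
    show "AE x in lebesgue_on \<Omega>. (\<lambda>k. h (w x + (\<Sum>i<n. X k i * e i x)) * z x) \<longlonglongrightarrow>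
      h (w x + (\<Sum>i<n. c i * e i x)) * z x"
    proof (rule AE_I2)
      fix x
      have "(\<lambda>k. w x + (\<Sum>i<n. X k i * e i x)) \<longlonglongrightarrow> w x + (\<Sum>i<n. c i * e i x)"
        by (intro tendsto_intros Xi)
      moreover have "isCont h (w x + (\<Sum>i<n. c i * e i x))"
        using h by (simp add: continuous_on_eq_continuous_at)
      ultimately have "(\<lambda>k. h (w x + (\<Sum>i<n. X k i * e i x))) \<longlonglongrightarrow> h (w x + (\<Sum>i<n. c i * e i x))"
        by (rule isCont_tendsto_compose[rotated])
      then show "(\<lambda>k. h (w x + (\<Sum>i<n. X k i * e i x)) * z x) \<longlonglongrightarrow> h (w x + (\<Sum>i<n. c i * e i x)) * z x"
        by (intro tendsto_mult tendsto_const)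
    qed
    have "AE x in lebesgue_on \<Omega>. \<forall>i\<in>{..<n}. i < n \<longrightarrow> \<bar>e i x\<bar> \<le> M i"
      using M by (intro AE_finite_allI) auto
    then show "AE x in lebesgue_on \<Omega>. norm (h (w x + (\<Sum>i<n. X k i * e i x)) * z x) \<le> H * Z" for k
      using M0 Z
    proof eventually_elim
      case (elim x)
      have "\<bar>\<Sum>i<n. X k i * e i x\<bar> \<le> (\<Sum>i<n. R i * M i)"
      proof (rule order.trans[OF sum_abs sum_mono])
        fix i assume "i \<in> {..<n}"
        then show "\<bar>X k i * e i x\<bar> \<le> R i * M i"
          unfolding abs_mult using elim(1) R[of k i] by (intro mult_mono) auto
      qed
      then have "\<bar>w x + (\<Sum>i<n. X k i * e i x)\<bar> \<le> Q" using elim(2) by (simp add: Q_def)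
      from H[OF this] elim(3) show ?case
        unfolding real_norm_def abs_mult by (intro mult_mono') auto
    qed
  qed
qed

section \<open>Finite element functions as vectors\<close>

text \<open>Covers the identity, \<open>grad\<close>, \<open>symgrad\<close> and the convection
  operator alike. Linearity up to null sets is all that the choice in \<open>grad\<close> permits,
  and it suffices because the forms integrate.\<close>

definition ess_bounded_operator_on ::
  "'a::real_vector set \<Rightarrow> (real^'n) set \<Rightarrow> ('a \<Rightarrow> real^'n \<Rightarrow> 'b::euclidean_space) \<Rightarrow> bool" where
  "ess_bounded_operator_on X \<Omega> D \<longleftrightarrow> (\<forall>x\<in>X. ess_bounded \<Omega> (D x)) \<and>
     (\<forall>x\<in>X. \<forall>y\<in>X. \<forall>a b. AE p in lebesgue_on \<Omega>. D (a *\<^sub>R x + b *\<^sub>R y) p = a *\<^sub>R D x p + b *\<^sub>R D y p)"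

lemma ess_bounded_operator_onD:
  assumes "ess_bounded_operator_on X \<Omega> D"
  shows "x \<in> X \<Longrightarrow> ess_bounded \<Omega> (D x)"
    and "x \<in> X \<Longrightarrow> y \<in> X \<Longrightarrow> AE p in lebesgue_on \<Omega>. D (a *\<^sub>R x + b *\<^sub>R y) p = a *\<^sub>R D x p + b *\<^sub>R D y p"
  using assms by (auto simp: ess_bounded_operator_on_def)

lemma ess_bounded_operator_on_inner:
  assumes D: "ess_bounded_operator_on X \<Omega> D" and u: "ess_bounded \<Omega> u"
  shows "ess_bounded_operator_on X \<Omega> (\<lambda>x p. D x p \<bullet> u p)"
  unfolding ess_bounded_operator_on_def
proof (intro conjI ballI allI)
  show "ess_bounded \<Omega> (\<lambda>p. D x p \<bullet> u p)" if "x \<in> X" for x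
    by (intro ess_bounded_inner u ess_bounded_operator_onD(1)[OF D that])
  show "AE p in lebesgue_on \<Omega>. D (a *\<^sub>R x + b *\<^sub>R y) p \<bullet> u p = a *\<^sub>R (D x p \<bullet> u p) +
    b *\<^sub>R (D y p \<bullet> u p)"
    if "x \<in> X" "y \<in> X" for x y a b
    using ess_bounded_operator_onD(2)[OF D that, of a b]
    by eventually_elim (simp add: inner_add_left)
qed

lemma linear_form_on_integral:
  assumes \<Omega>: "\<Omega> \<in> sets lebesgue" and D: "ess_bounded_operator_on X \<Omega> D"
    and int: "\<And>x. x \<in> X \<Longrightarrow> integrable (lebesgue_on \<Omega>) (\<lambda>p. G p \<bullet> D x p)"
  shows "linear_form_on X (\<lambda>x. LINT p|lebesgue_on \<Omega>. G p \<bullet> D x p)"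
  unfolding linear_form_on_def
proof (intro ballI allI)
  fix x y a b assume xy: "x \<in> X" "y \<in> X"
  have "AE p in lebesgue_on \<Omega>. G p \<bullet> D (a *\<^sub>R x + b *\<^sub>R y) p = a * (G p \<bullet> D x p) +
    b * (G p \<bullet> D y p)"
    using ess_bounded_operator_onD(2)[OF D xy, of a b]
    by eventually_elim (simp add: inner_add_right)
  then show "(LINT p|lebesgue_on \<Omega>. G p \<bullet> D (a *\<^sub>R x + b *\<^sub>R y) p) =
      a * (LINT p|lebesgue_on \<Omega>. G p \<bullet> D x p) + b * (LINT p|lebesgue_on \<Omega>. G p \<bullet> D y p)"
    by (intro LINT_combine_AE[OF \<Omega>] int xy)
qed

text \<open>The weight \<open>k\<close> can be moved into either factor, so both slots are instances
  of the linear case.\<close>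

lemma bilinear_form_on_integral:
  fixes D :: "'a::real_vector \<Rightarrow> real^'n \<Rightarrow> 'c::euclidean_space"
    and E :: "'b::real_vector \<Rightarrow> real^'n \<Rightarrow> 'c"
  assumes \<Omega>: "\<Omega> \<in> lmeasurable" and D: "ess_bounded_operator_on X \<Omega> D"
    and E: "ess_bounded_operator_on Y \<Omega> E"
    and k: "ess_bounded \<Omega> k"
  shows "bilinear_form_on X Y (\<lambda>x y. LINT p|lebesgue_on \<Omega>. k p * (D x p \<bullet> E y p))"
proof -
  have \<Omega>s: "\<Omega> \<in> sets lebesgue" using \<Omega> by (rule fmeasurableD)
  have int: "integrable (lebesgue_on \<Omega>) (\<lambda>p. (k p *\<^sub>R E y p) \<bullet> D x p)"
    "integrable (lebesgue_on \<Omega>) (\<lambda>p. (k p *\<^sub>R D x p) \<bullet> E y p)" if "x \<in> X" "y \<in> Y" for x y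
    by (intro ess_bounded_integrable[OF \<Omega>] ess_bounded_inner ess_bounded_scaleR k
        ess_bounded_operator_onD(1)[OF D] ess_bounded_operator_onD(1)[OF E] that)+
  have "linear_form_on X (\<lambda>x. LINT p|lebesgue_on \<Omega>. (k p *\<^sub>R E y p) \<bullet> D x p)" if "y \<in> Y" for y
    by (intro linear_form_on_integral[OF \<Omega>s D] int that)
  moreover have "linear_form_on Y (\<lambda>y. LINT p|lebesgue_on \<Omega>. (k p *\<^sub>R D x p) \<bullet> E y p)" if "x \<in> X"
    for x
    by (intro linear_form_on_integral[OF \<Omega>s E] int that)
  ultimately show ?thesis by (simp add: bilinear_form_on_def inner_commute)
qed

lemma bilinear_form_on_scale: "bilinear_form_on X Y f \<Longrightarrow> bilinear_form_on X Y (\<lambda>x y. c * f x y)"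
  by (simp add: bilinear_form_on_def linear_form_on_def algebra_simps)

lemma bilinear_form_on_add:
  "bilinear_form_on X Y f \<Longrightarrow> bilinear_form_on X Y g \<Longrightarrow> bilinear_form_on X Y (\<lambda>x y. f x y + g x y)"
  by (simp add: bilinear_form_on_def linear_form_on_def algebra_simps)

lemma bilinear_form_on_flip: "bilinear_form_on X Y f \<Longrightarrow> bilinear_form_on Y X (\<lambda>y x. f x y)"
  by (simp add: bilinear_form_on_def)

lemma linear_form_on_add: "linear_form_on X f \<Longrightarrow> linear_form_on X g \<Longrightarrow>
  linear_form_on X (\<lambda>x. f x + g x)"
  by (simp add: linear_form_on_def algebra_simps)

lemma linear_form_on_scale: "linear_form_on X f \<Longrightarrow> linear_form_on X (\<lambda>x. c * f x)"
  by (simp add: linear_form_on_def algebra_simps)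

lemma jac_cong: "(\<And>x. x \<in> \<Omega> \<Longrightarrow> v x = w x) \<Longrightarrow> jac \<Omega> v = jac \<Omega> w"
  unfolding jac_def using grad_cong[of \<Omega> "\<lambda>y. v y $ i" "\<lambda>y. w y $ i" for i]
  by (simp add: fun_eq_iff)

lemma symgrad_cong: "(\<And>x. x \<in> \<Omega> \<Longrightarrow> v x = w x) \<Longrightarrow> symgrad \<Omega> v = symgrad \<Omega> w"
  unfolding symgrad_def by (simp add: jac_cong[of \<Omega> v w])

lemma divergence_cong: "(\<And>x. x \<in> \<Omega> \<Longrightarrow> v x = w x) \<Longrightarrow> divergence \<Omega> v = divergence \<Omega> w"
  unfolding divergence_def by (simp add: jac_cong[of \<Omega> v w])

text \<open>
  Functions are normalized to vanish outside \<open>closure \<Omega>\<close>: the finite element spaces proper leave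
  the values there free and are therefore infinite-dimensional.
\<close>

definition FE_zero_ext :: "nat \<Rightarrow> (real^'n) set \<Rightarrow> (real^'n) set set \<Rightarrow> (real^'n \<Rightarrow> real) set" where
  "FE_zero_ext j \<Omega> \<T> = {f \<in> FE_space j \<Omega> \<T>. \<forall>x. x \<notin> closure \<Omega> \<longrightarrow> f x = 0}"

definition H_div_zero_ext :: "(real^'n) set \<Rightarrow> (real^'n) set set \<Rightarrow> (real^'n \<Rightarrow> real^'n) set" where
  "H_div_zero_ext \<Omega> \<T> = {v \<in> H_div \<Omega> \<T>. \<forall>x. x \<notin> closure \<Omega> \<longrightarrow> v x = 0}"

lemma subspace_FE_zero_ext: "subspace (FE_zero_ext j \<Omega> \<T>)"
proof (rule subspaceI)
  show "0 \<in> FE_zero_ext j \<Omega> \<T>"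
    using FE_space_const[of 0 j \<Omega> \<T>] by (simp add: FE_zero_ext_def zero_fun_def)
  fix f g assume "f \<in> FE_zero_ext j \<Omega> \<T>" "g \<in> FE_zero_ext j \<Omega> \<T>"
  then show "f + g \<in> FE_zero_ext j \<Omega> \<T>"
    using FE_space_combine[of f j \<Omega> \<T> g 1 1] by (simp add: FE_zero_ext_def plus_fun_def)
next
  fix c f assume "f \<in> FE_zero_ext j \<Omega> \<T>"
  then show "c *\<^sub>R f \<in> FE_zero_ext j \<Omega> \<T>"
    using FE_space_combine[of f j \<Omega> \<T> f c 0] by (simp add: FE_zero_ext_def scaleR_fun_def)
qed

text \<open>Assign to each point one simplex \<open>t x\<close> containing it. Monomials cut off to
  the points assigned to one simplex generate the space; they may be discontinuous, since only an
  enclosing finite span is wanted.\<close>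

lemma FE_zero_ext_finite_span:
  assumes cover: "\<Union>\<T> = closure \<Omega>" and fin: "finite \<T>"
  obtains B where "finite B" "FE_zero_ext j \<Omega> \<T> \<subseteq> span B"
proof -
  have "\<exists>T\<in>\<T>. x \<in> T" if "x \<in> closure \<Omega>" for x using that cover by blast
  then obtain t where t: "\<And>x. x \<in> closure \<Omega> \<Longrightarrow> t x \<in> \<T> \<and> x \<in> t x" by metis
  define A where "A = {\<alpha> :: 'a \<Rightarrow> nat. sum \<alpha> UNIV \<le> j}"
  define b where "b T \<alpha> =
    (\<lambda>x :: real^'a. if x \<in> closure \<Omega> \<and> t x = T then (\<Prod>i\<in>UNIV. (x $ i) ^ \<alpha> i) else 0)" for T \<alpha>
  define B where "B = (\<lambda>(T, \<alpha>). b T \<alpha>) ` (\<T> \<times> A)"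
  have finA: "finite A" unfolding A_def by (rule finite_multiindices)
  have "f \<in> span B" if f: "f \<in> FE_zero_ext j \<Omega> \<T>" for f
  proof -
    have "\<exists>c. \<forall>x\<in>T. f x = (\<Sum>\<alpha>\<in>A. c \<alpha> * (\<Prod>i\<in>UNIV. (x $ i) ^ \<alpha> i))" if T: "T \<in> \<T>" for T
    proof -
      obtain p where p: "polynomial_deg_le j p" "\<forall>x\<in>T. f x = p x"
        using f T unfolding FE_zero_ext_def FE_space_def by blast
      then show ?thesis unfolding polynomial_deg_le_def A_def by metis
    qed
    then obtain c where c: "\<And>T x. T \<in> \<T> \<Longrightarrow> x \<in> T \<Longrightarrow> f x = (\<Sum>\<alpha>\<in>A. c T \<alpha> * (\<Prod>i\<in>UNIV. (x $ i) ^ \<alpha> i))"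
      by metis
    have "f x = (\<Sum>T\<in>\<T>. \<Sum>\<alpha>\<in>A. c T \<alpha> *\<^sub>R b T \<alpha>) x" for x
    proof (cases "x \<in> closure \<Omega>")
      case True
      have "(\<Sum>T\<in>\<T>. \<Sum>\<alpha>\<in>A. c T \<alpha> *\<^sub>R b T \<alpha>) x = (\<Sum>T\<in>\<T>. if T = t x then f x else 0)"
        unfolding sum_fun_apply
        using c[OF conjunct1[OF t[OF True]] conjunct2[OF t[OF True]]] True
        by (intro sum.cong) (auto simp: b_def scaleR_fun_apply)
      then show ?thesis using t[OF True] fin by simp
    next
      case False
      then show ?thesis using f by (simp add: sum_fun_apply scaleR_fun_apply b_def FE_zero_ext_def)
    qed
    then have "f = (\<Sum>T\<in>\<T>. \<Sum>\<alpha>\<in>A. c T \<alpha> *\<^sub>R b T \<alpha>)" by blast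
    also have "\<dots> \<in> span B"
      by (intro span_sum span_scale span_base) (auto simp: B_def)
    finally show ?thesis .
  qed
  moreover have "finite B" using fin finA by (simp add: B_def)
  ultimately show ?thesis using that by blast
qed

text \<open>Each component lies in the scalar space, and \<open>axis i\<close> puts it back into its
  place.\<close>

lemma H_div_zero_ext_finite_span:
  assumes cover: "\<Union>\<T> = closure \<Omega>" and fin: "finite \<T>"
  obtains B where "finite B" "H_div_zero_ext \<Omega> \<T> \<subseteq> span B"
proof -
  obtain B0 where B0: "finite B0" "FE_zero_ext 2 \<Omega> \<T> \<subseteq> span B0"
    using FE_zero_ext_finite_span[OF cover fin] by blast
  define e where "e i f = (\<lambda>x. axis i (f x))" for i :: 'a and f :: "real^'a \<Rightarrow> real"
  have lin: "linear (e i)" for i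
    by (intro linearI) (auto simp: e_def fun_eq_iff axis_def vec_eq_iff scaleR_fun_apply)
  define B where "B = (\<Union>i. e i ` B0)"
  have "v \<in> span B" if v: "v \<in> H_div_zero_ext \<Omega> \<T>" for v
  proof -
    have eq: "v = (\<Sum>i\<in>UNIV. e i (\<lambda>x. v x $ i))"
      by (simp add: fun_eq_iff sum_fun_apply e_def vec_eq_iff axis_def if_distrib[of "\<lambda>y. y $ _"]
        cong: if_cong)
    have "e i (\<lambda>x. v x $ i) \<in> span B" for i
    proof -
      have "(\<lambda>x. v x $ i) \<in> span B0"
        using v B0(2) by (auto simp: H_div_zero_ext_def H_div_def FE_zero_ext_def)
      then have "e i (\<lambda>x. v x $ i) \<in> span (e i ` B0)" by (simp add: linear_span_image[OF lin])
      then show ?thesis using span_mono[of "e i ` B0" B] by (auto simp: B_def)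
    qed
    then have "(\<Sum>i\<in>UNIV. e i (\<lambda>x. v x $ i)) \<in> span B" by (intro span_sum)
    then show ?thesis by (simp only: eq[symmetric])
  qed
  moreover have "finite B" using B0 by (simp add: B_def)
  ultimately show ?thesis using that by blast
qed

lemma FE_zero_ext_restrict:
  assumes "\<Union>\<T> = closure \<Omega>" "f \<in> FE_space j \<Omega> \<T>"
  shows "(\<lambda>x. if x \<in> closure \<Omega> then f x else 0) \<in> FE_zero_ext j \<Omega> \<T>"
  using FE_space_cong[OF assms(1), of "\<lambda>x. if x \<in> closure \<Omega> then f x else 0" f j] assms(2)
  by (simp add: FE_zero_ext_def)

lemma H_div_zero_ext_restrict:
  assumes cover: "\<Union>\<T> = closure \<Omega>" and v: "v \<in> H_div \<Omega> \<T>"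
  shows "(\<lambda>x. if x \<in> closure \<Omega> then v x else 0) \<in> H_div_zero_ext \<Omega> \<T>"
proof -
  have "divergence \<Omega> (\<lambda>x. if x \<in> closure \<Omega> then v x else 0) = divergence \<Omega> v"
    using closure_subset[of \<Omega>] by (intro divergence_cong) auto
  moreover have "(\<lambda>x. (if x \<in> closure \<Omega> then v x else 0) $ i) \<in> FE_space 2 \<Omega> \<T>" for i
    using FE_space_cong[OF cover, of "\<lambda>x. (if x \<in> closure \<Omega> then v x else 0) $ i" "\<lambda>x. v x $ i" 2] v
    by (simp add: H_div_def)
  ultimately show ?thesis using v by (simp add: H_div_zero_ext_def H_div_def)
qed

context fe_mesh
begin

lemma FE_zero_ext_identity: "ess_bounded_operator_on (FE_zero_ext j \<Omega> \<T>) \<Omega> (\<lambda>f. f)"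
  unfolding ess_bounded_operator_on_def
  by (auto simp: FE_zero_ext_def scaleR_fun_apply intro: FE_ess_bounded)

lemma FE_zero_ext_grad: "ess_bounded_operator_on (FE_zero_ext j \<Omega> \<T>) \<Omega> (grad \<Omega>)"
  unfolding ess_bounded_operator_on_def
proof (intro conjI ballI allI)
  fix f assume "f \<in> FE_zero_ext j \<Omega> \<T>"
  then show "ess_bounded \<Omega> (grad \<Omega> f)" by (auto simp: FE_zero_ext_def intro: FE_grad_ess_bounded)
next
  fix f g a b assume "f \<in> FE_zero_ext j \<Omega> \<T>" "g \<in> FE_zero_ext j \<Omega> \<T>"
  then show "AE x in lebesgue_on \<Omega>. grad \<Omega> (a *\<^sub>R f + b *\<^sub>R g) x = a *\<^sub>R grad \<Omega> f x +
    b *\<^sub>R grad \<Omega> g x"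
    using FE_grad_combine[of f j g a b] by (simp add: FE_zero_ext_def scaleR_fun_def plus_fun_def)
qed

lemma jac_ess_bounded:
  assumes "\<And>i. (\<lambda>x. v x $ i) \<in> FE_space j \<Omega> \<T>"
  shows "ess_bounded \<Omega> (jac \<Omega> v)"
proof -
  have "ess_bounded \<Omega> (\<lambda>x. \<chi> i. grad \<Omega> (\<lambda>y. v y $ i) x)"
    by (intro ess_bounded_vec FE_grad_ess_bounded[OF assms])
  then show ?thesis by (simp add: jac_def[abs_def])
qed

lemma jac_combine:
  assumes v: "\<And>i. (\<lambda>x. v x $ i) \<in> FE_space j \<Omega> \<T>" and w: "\<And>i. (\<lambda>x. w x $ i) \<in> FE_space j \<Omega> \<T>"
  shows "AE x in lebesgue_on \<Omega>. jac \<Omega> (a *\<^sub>R v + b *\<^sub>R w) x = a *\<^sub>R jac \<Omega> v x + b *\<^sub>R jac \<Omega> w x"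
proof -
  have "AE x in lebesgue_on \<Omega>. \<forall>i\<in>UNIV. grad \<Omega> (\<lambda>x. a * v x $ i + b * w x $ i) x =
      a *\<^sub>R grad \<Omega> (\<lambda>x. v x $ i) x + b *\<^sub>R grad \<Omega> (\<lambda>x. w x $ i) x"
    by (intro AE_finite_allI FE_grad_combine[OF v w]) simp
  then show ?thesis
    by eventually_elim (simp add: jac_def vec_eq_iff scaleR_fun_apply)
qed

lemma vec_ess_bounded:
  assumes "\<And>i. (\<lambda>x. v x $ i) \<in> FE_space j \<Omega> \<T>"
  shows "ess_bounded \<Omega> v"
  using ess_bounded_vec[of \<Omega> "\<lambda>x i. v x $ i"] FE_ess_bounded[OF assms] by simp

lemma H_div_components: "v \<in> H_div \<Omega> \<T> \<Longrightarrow> (\<lambda>x. v x $ i) \<in> FE_space 2 \<Omega> \<T>"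
  by (simp add: H_div_def)

lemma divergence_ess_bounded:
  assumes "\<And>i. (\<lambda>x. v x $ i) \<in> FE_space j \<Omega> \<T>"
  shows "ess_bounded \<Omega> (divergence \<Omega> v)"
  using jac_ess_bounded[OF assms] unfolding divergence_def[abs_def]
  by (intro ess_bounded_sum ess_bounded_vec_nth)

lemma symgrad_ess_bounded:
  assumes "\<And>i. (\<lambda>x. v x $ i) \<in> FE_space j \<Omega> \<T>"
  shows "ess_bounded \<Omega> (symgrad \<Omega> v)"
proof -
  have "ess_bounded \<Omega> (\<lambda>x. transpose (jac \<Omega> v x))"
    unfolding transpose_def by (intro ess_bounded_vec ess_bounded_vec_nth jac_ess_bounded[OF assms])
  then show ?thesis
    unfolding symgrad_def[abs_def]
    by (intro ess_bounded_scaleR ess_bounded_const ess_bounded_add jac_ess_bounded[OF assms])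
qed

lemma subspace_H_div_zero_ext: "subspace (H_div_zero_ext \<Omega> \<T>)"
proof -
  have comb: "a *\<^sub>R v + b *\<^sub>R w \<in> H_div_zero_ext \<Omega> \<T>"
    if v: "v \<in> H_div_zero_ext \<Omega> \<T>" and w: "w \<in> H_div_zero_ext \<Omega> \<T>" for v w a b
  proof -
    have vw: "v \<in> H_div \<Omega> \<T>" "w \<in> H_div \<Omega> \<T>" using v w by (auto simp: H_div_zero_ext_def)
    have "(\<lambda>x. (a *\<^sub>R v + b *\<^sub>R w) x $ i) \<in> FE_space 2 \<Omega> \<T>" for i
      using FE_space_combine[OF H_div_components[OF vw(1)] H_div_components[OF vw(2)], of a i b i]
      by (simp add: scaleR_fun_apply)
    moreover have "L2_inner \<Omega> (divergence \<Omega> (a *\<^sub>R v + b *\<^sub>R w)) q = 0"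
      if q: "q \<in> FE_space 1 \<Omega> \<T> \<inter> L2_mean_zero \<Omega>" for q
    proof -
      have qb: "ess_bounded \<Omega> q" using q FE_ess_bounded by blast
      have "AE x in lebesgue_on \<Omega>. divergence \<Omega> (a *\<^sub>R v + b *\<^sub>R w) x \<bullet> q x =
          a * (divergence \<Omega> v x \<bullet> q x) + b * (divergence \<Omega> w x \<bullet> q x)"
        using jac_combine[OF H_div_components[OF vw(1)] H_div_components[OF vw(2)], of a b]
        by eventually_elim (simp add: divergence_def sum.distrib algebra_simps
          flip: sum_distrib_left)
      then have "L2_inner \<Omega> (divergence \<Omega> (a *\<^sub>R v + b *\<^sub>R w)) q =
          a * L2_inner \<Omega> (divergence \<Omega> v) q + b * L2_inner \<Omega> (divergence \<Omega> w) q"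
        unfolding L2_inner_def
        by (intro LINT_combine_AE[OF domain_sets] ess_bounded_integrable[OF domain_lmeasurable]
            ess_bounded_inner divergence_ess_bounded[of _ 2] qb H_div_components vw)
      then show ?thesis using vw q by (simp add: H_div_def)
    qed
    ultimately show ?thesis
      using v w by (simp add: H_div_zero_ext_def H_div_def scaleR_fun_apply)
  qed
  \<comment> \<open>Even for the zero function \<open>grad\<close> is a choice, so its divergence
    vanishes only almost everywhere.\<close>
  have z: "(0 :: real^'n \<Rightarrow> real^'n) \<in> H_div_zero_ext \<Omega> \<T>"
  proof -
    have g: "AE x in lebesgue_on \<Omega>. grad \<Omega> (\<lambda>x. 0) x = 0" by (rule FE_grad_const)
    have "L2_inner \<Omega> (divergence \<Omega> 0) q = 0" for q
    proof -
      have "AE x in lebesgue_on \<Omega>. divergence \<Omega> 0 x \<bullet> q x = 0"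
        using g by eventually_elim (simp add: divergence_def jac_def)
      then show ?thesis unfolding L2_inner_def by (rule integral_eq_zero_AE)
    qed
    then show ?thesis using FE_space_const[of 0 2 \<Omega> \<T>] by (simp add: H_div_zero_ext_def H_div_def)
  qed
  show ?thesis
  proof (rule subspaceI)
    show "v + w \<in> H_div_zero_ext \<Omega> \<T>" if "v \<in> H_div_zero_ext \<Omega> \<T>" "w \<in> H_div_zero_ext \<Omega> \<T>" for v w
      using comb[OF that, of 1 1] by simp
    show "c *\<^sub>R v \<in> H_div_zero_ext \<Omega> \<T>" if "v \<in> H_div_zero_ext \<Omega> \<T>" for c v
      using comb[OF that that, of c 0] by simp
  qed (rule z)
qed

lemma H_div_zero_ext_identity: "ess_bounded_operator_on (H_div_zero_ext \<Omega> \<T>) \<Omega> (\<lambda>v. v)"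
  unfolding ess_bounded_operator_on_def
  by (auto simp: H_div_zero_ext_def scaleR_fun_apply intro: vec_ess_bounded[of _ 2]
    H_div_components)

lemma H_div_zero_ext_symgrad: "ess_bounded_operator_on (H_div_zero_ext \<Omega> \<T>) \<Omega> (symgrad \<Omega>)"
  unfolding ess_bounded_operator_on_def
proof (intro conjI ballI allI)
  fix v assume "v \<in> H_div_zero_ext \<Omega> \<T>"
  then show "ess_bounded \<Omega> (symgrad \<Omega> v)"
    by (auto simp: H_div_zero_ext_def intro: symgrad_ess_bounded[of _ 2] H_div_components)
next
  fix v w a b assume "v \<in> H_div_zero_ext \<Omega> \<T>" "w \<in> H_div_zero_ext \<Omega> \<T>"
  then have "AE x in lebesgue_on \<Omega>. jac \<Omega> (a *\<^sub>R v + b *\<^sub>R w) x = a *\<^sub>R jac \<Omega> v x + b *\<^sub>R jac \<Omega> w x"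
    by (intro jac_combine[of _ 2] H_div_components) (auto simp: H_div_zero_ext_def)
  then show "AE x in lebesgue_on \<Omega>. symgrad \<Omega> (a *\<^sub>R v + b *\<^sub>R w) x = a *\<^sub>R symgrad \<Omega> v x +
    b *\<^sub>R symgrad \<Omega> w x"
    by eventually_elim (simp add: symgrad_def vec_eq_iff transpose_def algebra_simps)
qed

lemma H_div_zero_ext_convection:
  assumes u: "ess_bounded \<Omega> u"
  shows "ess_bounded_operator_on (H_div_zero_ext \<Omega> \<T>) \<Omega> (\<lambda>v x. jac \<Omega> v x *v u x)"
  unfolding ess_bounded_operator_on_def
proof (intro conjI ballI allI)
  fix v assume "v \<in> H_div_zero_ext \<Omega> \<T>"
  then have "ess_bounded \<Omega> (jac \<Omega> v)"
    by (auto simp: H_div_zero_ext_def intro: jac_ess_bounded[of _ 2] H_div_components)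
  then show "ess_bounded \<Omega> (\<lambda>x. jac \<Omega> v x *v u x)"
    unfolding matrix_vector_mult_def
    by (intro ess_bounded_vec ess_bounded_sum ess_bounded_mult ess_bounded_vec_nth u)
next
  fix v w a b assume "v \<in> H_div_zero_ext \<Omega> \<T>" "w \<in> H_div_zero_ext \<Omega> \<T>"
  then have "AE x in lebesgue_on \<Omega>. jac \<Omega> (a *\<^sub>R v + b *\<^sub>R w) x = a *\<^sub>R jac \<Omega> v x + b *\<^sub>R jac \<Omega> w x"
    by (intro jac_combine[of _ 2] H_div_components) (auto simp: H_div_zero_ext_def)
  then show "AE x in lebesgue_on \<Omega>. jac \<Omega> (a *\<^sub>R v + b *\<^sub>R w) x *v u x = a *\<^sub>R (jac \<Omega> v x *v u x) +
    b *\<^sub>R (jac \<Omega> w x *v u x)"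
    by eventually_elim (simp add: matrix_vector_mult_add_rdistrib scaleR_matrix_vector_assoc)
qed

text \<open>The points of \<Omega> where \<open>f\<close> is nonzero form an open null set, hence
  none exist; continuity carries the zero to the closure.\<close>

lemma zero_on_closure_if_L2_norm_zero:
  fixes f :: "real^'n \<Rightarrow> 'b::euclidean_space"
  assumes cont: "continuous_on (closure \<Omega>) f" and zero: "L2_inner \<Omega> f f = 0" and x: "x \<in> closure \<Omega>"
  shows "f x = 0"
proof -
  have "ess_bounded \<Omega> f" by (rule ess_bounded_continuous[OF bounded_domain domain_sets cont])
  then have "integrable (lebesgue_on \<Omega>) (\<lambda>x. f x \<bullet> f x)"
    by (intro ess_bounded_integrable[OF domain_lmeasurable] ess_bounded_inner)
  then have "AE x in lebesgue_on \<Omega>. f x \<bullet> f x = 0"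
    using zero by (subst integral_nonneg_eq_0_iff_AE[symmetric]) (auto simp: L2_inner_def)
  then have "AE x in lebesgue. x \<notin> {x \<in> \<Omega>. f x \<noteq> 0}"
    using domain_sets by (subst (asm) AE_restrict_space_iff) (auto elim: eventually_mono)
  moreover have o: "open {x \<in> \<Omega>. f x \<noteq> 0}"
  proof -
    have "open (\<Omega> \<inter> f -` (- {0}))"
      by (intro continuous_open_preimage[OF continuous_on_subset[OF cont closure_subset]
        open_domain]) auto
    also have "\<Omega> \<inter> f -` (- {0}) = {x \<in> \<Omega>. f x \<noteq> 0}" by auto
    finally show ?thesis .
  qed
  ultimately have "negligible {x \<in> \<Omega>. f x \<noteq> 0}"
    by (simp add: negligible_iff_null_sets completion.AE_iff_null_sets[symmetric] AE_iff_null_sets)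
  then have "{x \<in> \<Omega>. f x \<noteq> 0} = {}" using o open_not_negligible by blast
  then show ?thesis
    by (intro continuous_constant_on_closure[OF cont _ x]) auto
qed

end

section \<open>Existence of discrete solutions\<close>

text \<open>Serves the gravitational force, the only factor of the integrands that may be
  unbounded.\<close>

lemma L2_inner_integrable:
  assumes \<Omega>: "\<Omega> \<in> lmeasurable" and g: "g \<in> L2_space \<Omega>" and f: "ess_bounded \<Omega> f"
  shows "integrable (lebesgue_on \<Omega>) (\<lambda>x. g x \<bullet> f x)"
proof (rule Bochner_Integration.integrable_bound)
  obtain M where M: "M \<ge> 0" "f \<in> borel_measurable (lebesgue_on \<Omega>)"
    "AE x in lebesgue_on \<Omega>. norm (f x) \<le> M"
    using ess_boundedE[OF f] .
  have gm: "g \<in> borel_measurable (lebesgue_on \<Omega>)"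
    and gi: "integrable (lebesgue_on \<Omega>) (\<lambda>x. (norm (g x))\<^sup>2)" using g by (auto simp: L2_space_def)
  have "ess_bounded \<Omega> (\<lambda>x. (norm (f x))\<^sup>2)"
    unfolding power2_norm_eq_inner by (intro ess_bounded_inner f)
  then show "integrable (lebesgue_on \<Omega>) (\<lambda>x. (norm (g x))\<^sup>2 + (norm (f x))\<^sup>2)"
    by (intro Bochner_Integration.integrable_add gi ess_bounded_integrable[OF \<Omega>])
  show "(\<lambda>x. g x \<bullet> f x) \<in> borel_measurable (lebesgue_on \<Omega>)"
    using gm M(2) by (rule borel_measurable_inner)
  show "AE x in lebesgue_on \<Omega>. norm (g x \<bullet> f x) \<le> norm ((norm (g x))\<^sup>2 + (norm (f x))\<^sup>2)"
  proof (rule AE_I2)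
    fix x
    have "\<bar>g x \<bullet> f x\<bar> \<le> norm (g x) * norm (f x)" by (rule Cauchy_Schwarz_ineq2)
    also have "\<dots> \<le> (norm (g x))\<^sup>2 + (norm (f x))\<^sup>2"
      using sum_squares_bound[of "norm (g x)" "norm (f x)"]
        mult_nonneg_nonneg[OF norm_ge_zero[of "g x"] norm_ge_zero[of "f x"]]
      by linarith
    finally show "norm (g x \<bullet> f x) \<le> norm ((norm (g x))\<^sup>2 + (norm (f x))\<^sup>2)" by simp
  qed
qed

lemma smooth_deriv_continuous:
  assumes "smooth (f :: real \<Rightarrow> real)"
  shows "continuous_on UNIV (deriv f)"
proof -
  have "frechet_derivative f (at x) 1 = deriv f x" for x
  proof -
    have "(f has_field_derivative deriv f x) (at x)"
      using smooth_differentiable[OF assms] by (simp add: DERIV_deriv_iff_real_differentiable)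
    then have "frechet_derivative f (at x) = (*) (deriv f x)"
      unfolding has_field_derivative_def by (rule frechet_derivative_at[symmetric])
    then show ?thesis by simp
  qed
  then show ?thesis using smooth_continuous_derivative[OF assms, of 1] by simp
qed

lemma LINT_cong_on:
  "(\<And>x. x \<in> \<Omega> \<Longrightarrow> f x = g x) \<Longrightarrow> (LINT x|lebesgue_on \<Omega>. f x) = (LINT x|lebesgue_on \<Omega>. g x)"
  by (intro Bochner_Integration.integral_cong) auto

context fe_mesh
begin

lemma L2_inner_pos:
  fixes f :: "real^'n \<Rightarrow> 'b::euclidean_space"
  assumes cont: "continuous_on (closure \<Omega>) f" and x: "x \<in> closure \<Omega>" "f x \<noteq> 0"
  shows "L2_inner \<Omega> f f > 0"
proof -
  have "L2_inner \<Omega> f f \<ge> 0" by (simp add: L2_inner_def)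
  moreover have "L2_inner \<Omega> f f \<noteq> 0" using zero_on_closure_if_L2_norm_zero[OF cont _ x(1)] x(2)
    by blast
  ultimately show ?thesis by linarith
qed

lemma H_div_continuous:
  assumes "v \<in> H_div \<Omega> \<T>"
  shows "continuous_on (closure \<Omega>) v"
proof -
  have "continuous_on (closure \<Omega>) (\<lambda>x. \<chi> i. v x $ i)"
    using H_div_components[OF assms] by (intro continuous_on_vec_lambda) (simp add: FE_space_def)
  then show ?thesis by simp
qed

lemma H_div_zero_ext_inner_product:
  "inner_product_on (H_div_zero_ext \<Omega> \<T>) (\<lambda>v w. LINT x|lebesgue_on \<Omega>. 1 * (v x \<bullet> w x))"
  unfolding inner_product_on_def
proof (intro conjI ballI impI)
  show "bilinear_form_on (H_div_zero_ext \<Omega> \<T>) (H_div_zero_ext \<Omega> \<T>)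
    (\<lambda>v w. LINT x|lebesgue_on \<Omega>. 1 * (v x \<bullet> w x))"
    by (rule bilinear_form_on_integral[OF domain_lmeasurable H_div_zero_ext_identity
      H_div_zero_ext_identity ess_bounded_const])
  show "(LINT x|lebesgue_on \<Omega>. 1 * (v x \<bullet> w x)) = (LINT x|lebesgue_on \<Omega>. 1 * (w x \<bullet> v x))"
    for v w :: "real^'n \<Rightarrow> real^'n"
    by (simp add: inner_commute)
  fix v assume v: "v \<in> H_div_zero_ext \<Omega> \<T>" "v \<noteq> 0"
  then obtain x where "v x \<noteq> 0" by (auto simp: fun_eq_iff)
  then have "L2_inner \<Omega> v v > 0"
    using v(1) by (intro L2_inner_pos[of v x] H_div_continuous) (auto simp: H_div_zero_ext_def)
  then show "(LINT x|lebesgue_on \<Omega>. 1 * (v x \<bullet> v x)) > 0" by (simp add: L2_inner_def)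
qed

end

theorem theorem2:
  fixes \<Omega> :: "(real^'n) set"
    and \<T> :: "nat \<Rightarrow> (real^'n) set set"
    and P :: "nat \<Rightarrow> (real^'n \<Rightarrow> real) \<Rightarrow> real^'n \<Rightarrow> real"
    and \<sigma> \<epsilon> \<tau> :: real
    and g :: "real^'n \<Rightarrow> real^'n"
    and \<rho> \<eta> m F Fp Fm :: "real \<Rightarrow> real"
    and \<rho>_lo \<rho>_up \<eta>_lo \<eta>_up m_lo m_up \<rho>1 \<rho>2 C q :: real
    and G :: "(real^'n \<Rightarrow> real) \<Rightarrow> (real^'n \<Rightarrow> real) \<Rightarrow> (real^'n \<Rightarrow> real) \<Rightarrow> real"
    and k :: nat
    and \<phi>_prev \<phi>_k \<mu>_k :: "real^'n \<Rightarrow> real"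
    and v_k :: "real^'n \<Rightarrow> real^'n"
  defines "\<rho>_k \<equiv> (\<lambda>x. \<rho> (\<phi>_k x))"
    and "\<rho>_prev \<equiv> (\<lambda>x. \<rho> (\<phi>_prev x))"
    and "\<eta>_k \<equiv> (\<lambda>x. \<eta> (\<phi>_k x))"
    and "m_k \<equiv> (\<lambda>x. m (\<phi>_k x))"
    and "J_k \<equiv> (\<lambda>x. - (deriv \<rho> (\<phi>_k x) * m (\<phi>_k x)) *\<^sub>R grad \<Omega> \<mu>_k x)"
  assumes dim: "CARD('n) \<in> {2, 3}"
    and domain: "open \<Omega>" "connected \<Omega>" "bounded \<Omega>" "\<Omega> \<noteq> {}"
    and constants: "\<sigma> > 0" "\<epsilon> > 0" "\<tau> > 0"
    and force: "g \<in> L2_space \<Omega>"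
    and meshes: "\<And>j. conforming_mesh \<Omega> (\<T> j)"
    and projections: "\<And>j. stable_projection \<Omega> (\<T> j) (P j)"
    and density_bounds: "continuous_on UNIV \<rho>" "\<rho>_lo > 0" "\<And>s. \<rho>_lo \<le> \<rho> s \<and> \<rho> s \<le> \<rho>_up"
    and viscosity_bounds: "continuous_on UNIV \<eta>" "\<eta>_lo > 0" "\<And>s. \<eta>_lo \<le> \<eta> s \<and> \<eta> s \<le> \<eta>_up"
    and mobility_bounds: "continuous_on UNIV m" "m_lo > 0" "\<And>s. m_lo \<le> m s \<and> m s \<le> m_up"
    and density: "smooth \<rho>" "mono \<rho>" "0 < \<rho>1" "\<rho>1 \<le> \<rho>2" "density_profile \<rho>1 \<rho>2 \<rho>"
    and potential: "\<And>s. F s = Fp s + Fm s"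
      "\<And>s. F differentiable (at s)" "continuous_on UNIV (deriv F)"
      "\<And>s. Fp differentiable (at s)" "\<And>s. Fm differentiable (at s)"
      "convex_on UNIV Fp" "concave_on UNIV Fm"
    and growth: "C > 0" "1 \<le> q" "CARD('n) = 3 \<Longrightarrow> q \<le> 4"
      "\<And>s. \<bar>F s\<bar> \<le> C * (1 + abs_pow s q)"
      "\<And>s. \<bar>deriv Fp s\<bar> \<le> C * (1 + abs_pow s (q - 1))"
      "\<And>s. \<bar>deriv Fm s\<bar> \<le> C * (1 + abs_pow s (q - 1))"
    and newton: "newton_derivative \<Omega> (deriv Fp) G"
      "\<And>\<phi> \<delta>. \<phi> \<in> H1 \<Omega> \<Longrightarrow> \<delta> \<in> H1 \<Omega> \<Longrightarrow> G \<phi> \<delta> \<delta> \<ge> 0"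
    and step: "k \<ge> 1"
    and given_data: "\<phi>_prev \<in> FE_space 1 \<Omega> (\<T> (k - 1))" "\<phi>_k \<in> FE_space 1 \<Omega> (\<T> k)"
      "\<mu>_k \<in> FE_space 1 \<Omega> (\<T> k)" "v_k \<in> H_div \<Omega> (\<T> k)"
  shows "\<exists>v_h \<in> H_div \<Omega> (\<T> (k + 1)).
         \<exists>\<phi>_h \<in> FE_space 1 \<Omega> (\<T> (k + 1)).
         \<exists>\<mu>_h \<in> FE_space 1 \<Omega> (\<T> (k + 1)).
         \<forall>w \<in> H_div \<Omega> (\<T> (k + 1)).
         \<forall>\<Phi> \<in> FE_space 1 \<Omega> (\<T> (k + 1)).
         \<forall>\<Psi> \<in> FE_space 1 \<Omega> (\<T> (k + 1)).
           1 / (2 * \<tau>) * L2_inner \<Omega>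
               (\<lambda>x. \<rho>_k x *\<^sub>R v_h x - \<rho>_prev x *\<^sub>R v_k x + \<rho>_prev x *\<^sub>R (v_h x - v_k x)) w
             + trilinear \<Omega> (\<lambda>x. \<rho>_k x *\<^sub>R v_k x + J_k x) v_h w
             + L2_inner \<Omega> (\<lambda>x. (2 * \<eta>_k x) *\<^sub>R symgrad \<Omega> v_h x) (symgrad \<Omega> w)
             - L2_inner \<Omega> (\<lambda>x. \<mu>_h x *\<^sub>R grad \<Omega> \<phi>_k x + \<rho>_k x *\<^sub>R g x) w = 0
         \<and> 1 / \<tau> * L2_inner \<Omega> (\<lambda>x. \<phi>_h x - P (k + 1) \<phi>_k x) \<Phi>
             + L2_inner \<Omega> (\<lambda>x. m_k x *\<^sub>R grad \<Omega> \<mu>_h x) (grad \<Omega> \<Phi>)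
             + L2_inner \<Omega> (\<lambda>x. v_h x \<bullet> grad \<Omega> \<phi>_k x) \<Phi> = 0
         \<and> \<sigma> * \<epsilon> * L2_inner \<Omega> (grad \<Omega> \<phi>_h) (grad \<Omega> \<Psi>)
             + L2_inner \<Omega> (\<lambda>x. deriv Fp (\<phi>_h x) + deriv Fm (P (k + 1) \<phi>_k x)) \<Psi>
             - L2_inner \<Omega> \<mu>_h \<Psi> = 0"
proof -

  \<comment> \<open>Spaces, data and their bounds\<close>
  interpret fe: fe_mesh \<Omega> "\<T> (k + 1)" by unfold_locales (use domain meshes in auto)
  interpret fek: fe_mesh \<Omega> "\<T> k" by unfold_locales (use domain meshes in auto)
  interpret fep: fe_mesh \<Omega> "\<T> (k - 1)" by unfold_locales (use domain meshes in auto)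
  note \<Omega>m = fe.domain_lmeasurable and \<Omega>s = fe.domain_sets
  note int = ess_bounded_integrable[OF \<Omega>m]
  define V where "V = H_div_zero_ext \<Omega> (\<T> (k + 1))"
  define S where "S = FE_zero_ext 1 \<Omega> (\<T> (k + 1))"
  define \<phi>0 where "\<phi>0 = P (k + 1) \<phi>_k"
  define u where "u = (\<lambda>x. \<rho>_k x *\<^sub>R v_k x + J_k x)"
  \<comment> \<open>The constant function 1 in normalized form, which becomes the distinguished
    vector of \<open>saddle_system_solvable\<close>.\<close>
  define one where "one = (\<lambda>x. if x \<in> closure \<Omega> then 1 else 0 :: real)"
  note cover = conforming_meshD(2)[OF meshes[of "k + 1"]]
    and fin = conforming_meshD(1)[OF meshes[of "k + 1"]]
  have sub: "subspace V" "subspace S"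
    unfolding V_def S_def by (rule fe.subspace_H_div_zero_ext subspace_FE_zero_ext)+
  obtain BV where BV: "V \<subseteq> span BV" "finite BV"
    unfolding V_def using H_div_zero_ext_finite_span[OF cover fin] by metis
  obtain BS where BS: "S \<subseteq> span BS" "finite BS"
    unfolding S_def using FE_zero_ext_finite_span[OF cover fin] by metis
  have VH: "v \<in> H_div \<Omega> (\<T> (k + 1))" if "v \<in> V" for v using that
    by (simp add: V_def H_div_zero_ext_def)
  have SF: "f \<in> FE_space 1 \<Omega> (\<T> (k + 1))" if "f \<in> S" for f using that
    by (simp add: S_def FE_zero_ext_def)
  have \<phi>0: "\<phi>0 \<in> FE_space 1 \<Omega> (\<T> (k + 1))"
    using projections[of "k + 1"] fek.FE_H1[OF given_data(2)]
    by (simp add: stable_projection_def \<phi>0_def)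
  have one: "one \<in> S"
    unfolding one_def S_def by (rule FE_zero_ext_restrict[OF cover FE_space_const])

  note idV = fe.H_div_zero_ext_identity[folded V_def]
    and symV = fe.H_div_zero_ext_symgrad[folded V_def]
    and convV = fe.H_div_zero_ext_convection[folded V_def]
    and idS = fe.FE_zero_ext_identity[of 1, folded S_def]
      and gradS = fe.FE_zero_ext_grad[of 1, folded S_def]
  have Vb: "ess_bounded \<Omega> v" if "v \<in> V" for v using ess_bounded_operator_onD(1)[OF idV that] .
  have Sb: "ess_bounded \<Omega> f" if "f \<in> S" for f using ess_bounded_operator_onD(1)[OF idS that] .
  have Vsb: "ess_bounded \<Omega> (symgrad \<Omega> v)" if "v \<in> V" for v
    using ess_bounded_operator_onD(1)[OF symV that] .
  have Sgb: "ess_bounded \<Omega> (grad \<Omega> f)" if "f \<in> S" for f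
    using ess_bounded_operator_onD(1)[OF gradS that] .
  have \<phi>0b: "ess_bounded \<Omega> \<phi>0" "ess_bounded \<Omega> (grad \<Omega> \<phi>0)"
    by (rule fe.FE_ess_bounded[OF \<phi>0], rule fe.FE_grad_ess_bounded[OF \<phi>0])
  note \<phi>kb = fek.FE_ess_bounded[OF given_data(2)]
    and g\<phi>kb = fek.FE_grad_ess_bounded[OF given_data(2)]
  have vkb: "ess_bounded \<Omega> v_k"
    by (rule fek.vec_ess_bounded[OF fek.H_div_components[OF given_data(4)]])
  have \<rho>kb: "ess_bounded \<Omega> \<rho>_k" unfolding \<rho>_k_def
    by (rule ess_bounded_compose[OF density_bounds(1) \<phi>kb])
  have \<rho>pb: "ess_bounded \<Omega> \<rho>_prev"
    unfolding \<rho>_prev_def by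
      (rule ess_bounded_compose[OF density_bounds(1) fep.FE_ess_bounded[OF given_data(1)]])
  have \<eta>kb: "ess_bounded \<Omega> \<eta>_k" unfolding \<eta>_k_def
    by (rule ess_bounded_compose[OF viscosity_bounds(1) \<phi>kb])
  have mkb: "ess_bounded \<Omega> m_k" unfolding m_k_def
    by (rule ess_bounded_compose[OF mobility_bounds(1) \<phi>kb])
  have "ess_bounded \<Omega> J_k"
  proof -
    have "continuous_on UNIV (\<lambda>s. - (deriv \<rho> s * m s))"
      by (intro continuous_intros smooth_deriv_continuous density mobility_bounds)
    from ess_bounded_compose[OF this \<phi>kb] show ?thesis
      unfolding J_k_def by (intro ess_bounded_scaleR fek.FE_grad_ess_bounded[OF given_data(3)])
  qed
  then have ub: "ess_bounded \<Omega> u"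
    unfolding u_def by (intro ess_bounded_add ess_bounded_scaleR \<rho>kb vkb)
  \<comment> \<open>The data give continuity of \<open>deriv F\<close> only. Convexity yields it for
    \<open>deriv Fp\<close>, and then the difference for \<open>deriv Fm\<close>.\<close>
  have Fp_cont: "continuous_on UNIV (deriv Fp)" by (rule convex_deriv_continuous[OF potential(6,4)])
  have Fm_cont: "continuous_on UNIV (deriv Fm)"
  proof -
    have "deriv Fm s = deriv F s - deriv Fp s" for s
    proof (rule DERIV_imp_deriv)
      have "(F has_field_derivative deriv F s) (at s)" "(Fp has_field_derivative deriv Fp s) (at s)"
        using potential by (simp_all add: DERIV_deriv_iff_real_differentiable)
      then have "((\<lambda>s. F s - Fp s) has_field_derivative deriv F s - deriv Fp s) (at s)"
        by (rule DERIV_diff)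
      then show "(Fm has_field_derivative deriv F s - deriv Fp s) (at s)" using potential(1) by simp
    qed
    then show ?thesis using potential(3) Fp_cont by (simp add: continuous_on_diff)
  qed
  have gint: "integrable (lebesgue_on \<Omega>) (\<lambda>x. (\<rho>_k x *\<^sub>R g x) \<bullet> w x)" if "w \<in> V" for w
    using L2_inner_integrable[OF \<Omega>m force ess_bounded_scaleR[OF \<rho>kb Vb[OF that]]] by simp

  \<comment> \<open>Forms of the discrete problem\<close>
  define ipV where "ipV v w = (LINT x|lebesgue_on \<Omega>. 1 * (v x \<bullet> w x))"
    for v w :: "real^'n \<Rightarrow> real^'n"
  \<comment> \<open>The weight collects the two occurrences of the new velocity in the discrete time
    derivative. The two occurrences of \<open>v_k\<close> leave \<open>- 2 * lv w\<close>, hence the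
    coefficient \<open>- (1 / \<tau>)\<close> in \<open>l\<close>.\<close>
  define b where "b v w = (LINT x|lebesgue_on \<Omega>. (\<rho>_k x + \<rho>_prev x) * (v x \<bullet> w x))"
    for v w :: "real^'n \<Rightarrow> real^'n"
  define s where "s v w = (LINT x|lebesgue_on \<Omega>. (2 * \<eta>_k x) * (symgrad \<Omega> v x \<bullet> symgrad \<Omega> w x))"
    for v w
  \<comment> \<open>\<open>trilinear\<close> is half of \<open>t v w - t w v\<close>. Explicit
    factors \<open>1\<close> here and in other forms fit the weighted shape of
    \<open>bilinear_form_on_integral\<close>.\<close>
  define t where "t v w = (LINT x|lebesgue_on \<Omega>. 1 * ((jac \<Omega> v x *v u x) \<bullet> w x))" for v w
  define K where "K v \<Phi> = (LINT x|lebesgue_on \<Omega>. 1 * ((v x \<bullet> grad \<Omega> \<phi>_k x) \<bullet> \<Phi> x))" for v \<Phi>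
  define A0 where "A0 \<psi> \<Phi> = (LINT x|lebesgue_on \<Omega>. 1 * (grad \<Omega> \<psi> x \<bullet> grad \<Omega> \<Phi> x))" for \<psi> \<Phi>
  define M where "M \<mu> \<Phi> = (LINT x|lebesgue_on \<Omega>. m_k x * (grad \<Omega> \<mu> x \<bullet> grad \<Omega> \<Phi> x))" for \<mu> \<Phi>
  define P0 where "P0 \<psi> \<Phi> = (LINT x|lebesgue_on \<Omega>. 1 * (\<psi> x \<bullet> \<Phi> x))" for \<psi> \<Phi> :: "real^'n \<Rightarrow> real"
  define lv where "lv w = (LINT x|lebesgue_on \<Omega>. (\<rho>_prev x *\<^sub>R v_k x) \<bullet> w x)" for w
  define lg where "lg w = (LINT x|lebesgue_on \<Omega>. (\<rho>_k x *\<^sub>R g x) \<bullet> w x)" for w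
  \<comment> \<open>The argument is shifted by \<open>\<phi>0\<close>, as the unknown is the
    increment \<psi>; for the same reason the gradient of \<open>\<phi>0\<close> enters
    \<open>N\<close> through \<open>Ng\<close>.\<close>
  define Np where "Np \<psi> \<Psi> = (LINT x|lebesgue_on \<Omega>. deriv Fp (\<phi>0 x + \<psi> x) \<bullet> \<Psi> x)" for \<psi> \<Psi>
  define Nm where "Nm \<Psi> = (LINT x|lebesgue_on \<Omega>. deriv Fm (\<phi>0 x) \<bullet> \<Psi> x)" for \<Psi>
  define Ng where "Ng \<Psi> = (LINT x|lebesgue_on \<Omega>. grad \<Omega> \<phi>0 x \<bullet> grad \<Omega> \<Psi> x)" for \<Psi>
  define B where "B v w = 1 / (2 * \<tau>) * b v w + ((1/2 * t v w + (- (1/2)) * t w v) + s v w)" for v w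
  \<comment> \<open>Here and in \<open>N\<close> the third equation is divided by \<tau>, so that
    \<psi> and \<mu> are coupled by the same form \<open>Q\<close> as in the second
    equation.\<close>
  define A where "A \<psi> \<Phi> = (\<sigma> * \<epsilon> / \<tau>) * A0 \<psi> \<Phi>" for \<psi> \<Phi>
  define Q where "Q \<psi> \<Phi> = 1 / \<tau> * P0 \<psi> \<Phi>" for \<psi> \<Phi>
  define l where "l w = (- (1 / \<tau>)) * lv w + (- 1) * lg w" for w
  define N where "N \<psi> \<Psi> = 1 / \<tau> * (Np \<psi> \<Psi> + (Nm \<Psi> + \<sigma> * \<epsilon> * Ng \<Psi>))" for \<psi> \<Psi>
  \<comment> \<open>The first entry is the coercivity of the mass term, the second expresses the
    lower bound \<open>m_lo * A0\<close> on the mobility form in terms of \<open>A\<close>.\<close>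
  define c where "c = min (\<rho>_lo / \<tau>) (m_lo * \<tau> / (\<sigma> * \<epsilon>))"

  \<comment> \<open>Linearity of the forms\<close>
  have b: "bilinear_form_on V V b"
    unfolding b_def by (intro bilinear_form_on_integral[OF \<Omega>m idV idV] ess_bounded_add \<rho>kb \<rho>pb)
  have s: "bilinear_form_on V V s"
    unfolding s_def by (intro bilinear_form_on_integral[OF \<Omega>m symV symV] ess_bounded_mult
      ess_bounded_const \<eta>kb)
  have t: "bilinear_form_on V V t"
    unfolding t_def by (intro bilinear_form_on_integral[OF \<Omega>m convV[OF ub] idV] ess_bounded_const)
  have K: "bilinear_form_on V S K"
    unfolding K_def
    by (intro bilinear_form_on_integral[OF \<Omega>m ess_bounded_operator_on_inner[OF idV g\<phi>kb] idS]
      ess_bounded_const)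
  have A0: "bilinear_form_on S S A0"
    unfolding A0_def by (intro bilinear_form_on_integral[OF \<Omega>m gradS gradS] ess_bounded_const)
  have Mf: "bilinear_form_on S S M"
    unfolding M_def by (intro bilinear_form_on_integral[OF \<Omega>m gradS gradS] mkb)
  have P0: "bilinear_form_on S S P0"
    unfolding P0_def by (intro bilinear_form_on_integral[OF \<Omega>m idS idS] ess_bounded_const)
  have lv: "linear_form_on V lv"
    unfolding lv_def
    by (intro linear_form_on_integral[OF \<Omega>s idV] int ess_bounded_inner ess_bounded_scaleR \<rho>pb vkb
      Vb)
  have lg: "linear_form_on V lg"
    unfolding lg_def by (intro linear_form_on_integral[OF \<Omega>s idV] gint)
  have Fpb: "ess_bounded \<Omega> (\<lambda>x. deriv Fp (\<phi>0 x + \<psi> x))" if "\<psi> \<in> S" for \<psi>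
    by (intro ess_bounded_compose[OF Fp_cont] ess_bounded_add \<phi>0b Sb that)
  have Fmb: "ess_bounded \<Omega> (\<lambda>x. deriv Fm (\<phi>0 x))"
    by (intro ess_bounded_compose[OF Fm_cont] \<phi>0b)
  have Np: "linear_form_on S (Np \<psi>)" if "\<psi> \<in> S" for \<psi>
    unfolding Np_def[abs_def]
    by (intro linear_form_on_integral[OF \<Omega>s idS] int ess_bounded_inner Fpb Sb that)
  have Nm: "linear_form_on S Nm"
    unfolding Nm_def by (intro linear_form_on_integral[OF \<Omega>s idS] int ess_bounded_inner Fmb Sb)
  have Ng: "linear_form_on S Ng"
    unfolding Ng_def by (intro linear_form_on_integral[OF \<Omega>s gradS] int ess_bounded_inner \<phi>0b Sgb)

  \<comment> \<open>Solution of the saddle point system\<close>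
  have "\<exists>v\<in>V. \<exists>\<psi>\<in>S. \<exists>\<mu>\<in>S. \<forall>w\<in>V. \<forall>\<Phi>\<in>S. \<forall>\<Psi>\<in>S.
      B v w - K w \<mu> + l w = 0 \<and> Q \<psi> \<Phi> + M \<mu> \<Phi> + K v \<Phi> = 0 \<and> A \<psi> \<Psi> + N \<psi> \<Psi> - Q \<mu> \<Psi> = 0"
  proof (rule saddle_system_solvable[OF sub(1) BV sub(2) BS])
    show "inner_product_on V ipV"
      unfolding V_def ipV_def[abs_def] by (rule fe.H_div_zero_ext_inner_product)
    show "bilinear_form_on V V B"
      unfolding B_def[abs_def] 
      by (rule bilinear_form_on_add[OF bilinear_form_on_scale[OF b] bilinear_form_on_add[OF
            bilinear_form_on_add[OF bilinear_form_on_scale[OF t]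
              bilinear_form_on_scale[OF bilinear_form_on_flip[OF t]]] s]])
    show "bilinear_form_on V S K" by (rule K)
    show "linear_form_on V l" unfolding l_def[abs_def]
      by (rule linear_form_on_add[OF linear_form_on_scale[OF lv] linear_form_on_scale[OF lg]])
    show "bilinear_form_on S S A" unfolding A_def[abs_def] by (rule bilinear_form_on_scale[OF A0])
    show "bilinear_form_on S S M" by (rule Mf)
    show "bilinear_form_on S S Q" unfolding Q_def[abs_def] by (rule bilinear_form_on_scale[OF P0])
    show "linear_form_on S (N x)" if "x \<in> S" for x
      unfolding N_def[abs_def] 
      by (rule linear_form_on_scale[OF linear_form_on_add[OF Np[OF that]
        linear_form_on_add[OF Nm linear_form_on_scale[OF Ng]]]])
    show "A x y = A y x" "Q x y = Q y x" for x y
      by (simp_all add: A_def A0_def Q_def P0_def inner_commute mult.commute)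
    show "0 \<le> A x x" for x
      using constants by (auto simp: A_def A0_def intro!: mult_nonneg_nonneg
        Bochner_Integration.integral_nonneg)
    show "c > 0" using constants density_bounds(2) mobility_bounds(2) by (simp add: c_def)
    show "c * ipV v v \<le> B v v" if v: "v \<in> V" for v
    proof -
      have ip0: "ipV v v \<ge> 0" by (simp add: ipV_def)
      have "2 * \<rho>_lo * ipV v v = (LINT x|lebesgue_on \<Omega>. 2 * \<rho>_lo * (v x \<bullet> v x))"
        by (simp add: ipV_def)
      also have "\<dots> \<le> b v v"
        unfolding b_def
      proof (rule integral_mono)
        show "integrable (lebesgue_on \<Omega>) (\<lambda>x. 2 * \<rho>_lo * (v x \<bullet> v x))"
          by (intro int ess_bounded_mult ess_bounded_const ess_bounded_inner Vb v)
        show "integrable (lebesgue_on \<Omega>) (\<lambda>x. (\<rho>_k x + \<rho>_prev x) * (v x \<bullet> v x))"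
          by (intro int ess_bounded_mult ess_bounded_add \<rho>kb \<rho>pb ess_bounded_inner Vb v)
        show "2 * \<rho>_lo * (v x \<bullet> v x) \<le> (\<rho>_k x + \<rho>_prev x) * (v x \<bullet> v x)" for x
          using density_bounds(3)[of "\<phi>_k x"] density_bounds(3)[of "\<phi>_prev x"]
          by (intro mult_right_mono) (auto simp: \<rho>_k_def \<rho>_prev_def)
      qed
      finally have "1 / (2 * \<tau>) * (2 * \<rho>_lo * ipV v v) \<le> 1 / (2 * \<tau>) * b v v"
        using constants by (intro mult_left_mono) auto
      moreover have "1 / (2 * \<tau>) * (2 * \<rho>_lo * ipV v v) = \<rho>_lo / \<tau> * ipV v v" by simp
      moreover have "s v v \<ge> 0"
        unfolding s_def
      proof (intro Bochner_Integration.integral_nonneg mult_nonneg_nonneg inner_ge_zero)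
        show "0 \<le> \<eta>_k x" for x
          using viscosity_bounds(2) viscosity_bounds(3)[of "\<phi>_k x"] by (simp add: \<eta>_k_def)
      qed auto
      moreover have "c * ipV v v \<le> \<rho>_lo / \<tau> * ipV v v"
        using ip0 by (intro mult_right_mono) (auto simp: c_def)
      \<comment> \<open>On the diagonal the two convective halves cancel.\<close>
      ultimately show ?thesis by (simp add: B_def)
    qed
    show "c * A x x \<le> M x x" if x: "x \<in> S" for x
    proof -
      have a0: "A0 x x \<ge> 0" by (simp add: A0_def)
      have "c * (\<sigma> * \<epsilon> / \<tau>) \<le> m_lo * \<tau> / (\<sigma> * \<epsilon>) * (\<sigma> * \<epsilon> / \<tau>)"
        using constants by (intro mult_right_mono) (auto simp: c_def)
      also have "\<dots> = m_lo" using constants by simp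
      finally have "c * (\<sigma> * \<epsilon> / \<tau>) * A0 x x \<le> m_lo * A0 x x" using a0 by (rule mult_right_mono)
      also have "\<dots> = (LINT p|lebesgue_on \<Omega>. m_lo * (grad \<Omega> x p \<bullet> grad \<Omega> x p))" by (simp add: A0_def)
      also have "\<dots> \<le> M x x"
        unfolding M_def
      proof (rule integral_mono)
        show "integrable (lebesgue_on \<Omega>) (\<lambda>p. m_lo * (grad \<Omega> x p \<bullet> grad \<Omega> x p))"
          by (intro int ess_bounded_mult ess_bounded_const ess_bounded_inner Sgb x)
        show "integrable (lebesgue_on \<Omega>) (\<lambda>p. m_k p * (grad \<Omega> x p \<bullet> grad \<Omega> x p))"
          by (intro int ess_bounded_mult mkb ess_bounded_inner Sgb x)
        show "m_lo * (grad \<Omega> x p \<bullet> grad \<Omega> x p) \<le> m_k p * (grad \<Omega> x p \<bullet> grad \<Omega> x p)" for p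
          using mobility_bounds(3)[of "\<phi>_k p"] by (intro mult_right_mono) (auto simp: m_k_def)
      qed
      finally show ?thesis by (simp add: A_def mult.assoc)
    qed
    show "one \<in> S" by (rule one)
    have grad_one: "AE x in lebesgue_on \<Omega>. grad \<Omega> one x = 0"
    proof -
      have "grad \<Omega> one = grad \<Omega> (\<lambda>x. 1)"
        using closure_subset[of \<Omega>] by (intro grad_cong) (auto simp: one_def)
      then show ?thesis using fe.FE_grad_const[of 1] by simp
    qed
    show "A x one = 0" for x
    proof -
      have "AE p in lebesgue_on \<Omega>. 1 * (grad \<Omega> x p \<bullet> grad \<Omega> one p) = 0"
        using grad_one by eventually_elim simp
      then show ?thesis unfolding A_def A0_def by (simp add: integral_eq_zero_AE)
    qed
    show "M x one = 0" for x
    proof -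
      have "AE p in lebesgue_on \<Omega>. m_k p * (grad \<Omega> x p \<bullet> grad \<Omega> one p) = 0"
        using grad_one by eventually_elim simp
      then show ?thesis unfolding M_def by (rule integral_eq_zero_AE)
    qed
    show "Q one one > 0"
    proof -
      obtain x where x: "x \<in> closure \<Omega>" using domain(4) closure_subset[of \<Omega>] by blast
      have "L2_inner \<Omega> one one > 0"
        using SF[OF one] x by (intro fe.L2_inner_pos[of one x]) (auto simp: FE_space_def one_def)
      then show ?thesis using constants by (simp add: Q_def P0_def L2_inner_def)
    qed
    show "x = 0" if x: "x \<in> S" and A: "A x x = 0" and Qx: "Q x one = 0" for x
    proof -
      have "A0 x x = 0" using A constants by (simp add: A_def)
      then have "(LINT p|lebesgue_on \<Omega>. grad \<Omega> x p \<bullet> grad \<Omega> x p) = 0" by (simp add: A0_def)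
      then have "AE p in lebesgue_on \<Omega>. grad \<Omega> x p \<bullet> grad \<Omega> x p = 0"
        by (subst (asm) integral_nonneg_eq_0_iff_AE) (auto intro!: int ess_bounded_inner Sgb x)
      then have "AE p in lebesgue_on \<Omega>. grad \<Omega> x p = 0" by eventually_elim simp
      then obtain a where a: "\<And>p. p \<in> closure \<Omega> \<Longrightarrow> x p = a"
        using fe.FE_constant_if_grad_zero[OF SF[OF x] _ domain(2)] by blast
      \<comment> \<open>As \<open>x\<close> is the constant \<open>a\<close>, its squared norm is
        \<open>a\<close> times its pairing with \<open>one\<close>, which vanishes.\<close>
      have "L2_inner \<Omega> x x = (LINT p|lebesgue_on \<Omega>. a * (x p \<bullet> one p))"
        unfolding L2_inner_def using a closure_subset[of \<Omega>]
        by (intro LINT_cong_on) (auto simp: one_def)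
      also have "\<dots> = a * P0 x one" by (simp add: P0_def)
      also have "\<dots> = 0" using Qx constants by (simp add: Q_def)
      finally have z: "L2_inner \<Omega> x x = 0" .
      have cont: "continuous_on (closure \<Omega>) x" using SF[OF x] by (simp add: FE_space_def)
      have "x p = 0" for p
        using fe.zero_on_closure_if_L2_norm_zero[OF cont z, of p] x
        by (cases "p \<in> closure \<Omega>") (auto simp: S_def FE_zero_ext_def)
      then show ?thesis by (simp add: fun_eq_iff)
    qed
    show "N 0 x \<le> N x x" if x: "x \<in> S" for x
    proof -
      \<comment> \<open>Monotonicity of \<open>deriv Fp\<close> between \<open>\<phi>0\<close> and
        \<open>\<phi>0 + x\<close>; the other parts of \<open>N\<close> do not depend on its first
        argument.\<close>
      have "Np 0 x \<le> Np x x"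
        unfolding Np_def
      proof (rule integral_mono)
        show "integrable (lebesgue_on \<Omega>) (\<lambda>p. deriv Fp (\<phi>0 p + 0 p) \<bullet> x p)"
          by (intro int ess_bounded_inner Fpb subspace_0 sub Sb x)
        show "integrable (lebesgue_on \<Omega>) (\<lambda>p. deriv Fp (\<phi>0 p + x p) \<bullet> x p)"
          by (intro int ess_bounded_inner Fpb Sb x)
        show "deriv Fp (\<phi>0 p + 0 p) \<bullet> x p \<le> deriv Fp (\<phi>0 p + x p) \<bullet> x p" for p
          using convex_deriv_mono[OF potential(6,4), of "\<phi>0 p + x p" "\<phi>0 p"]
          by (simp add: algebra_simps)
      qed
      then show ?thesis using constants unfolding N_def by (intro mult_left_mono) auto
    qed
    show "continuous_on UNIV (\<lambda>c::nat \<Rightarrow> real. N (\<Sum>i<n. c i *\<^sub>R e i) z)"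
      if e: "\<And>i. i < n \<Longrightarrow> e i \<in> S" and z: "z \<in> S" for n and e :: "nat \<Rightarrow> real^'n \<Rightarrow> real" and z
    proof -
      have "continuous_on UNIV (\<lambda>c::nat \<Rightarrow> real. LINT x|lebesgue_on \<Omega>. deriv Fp (\<phi>0 x +
        (\<Sum>i<n. c i * e i x)) * z x)"
        by (intro continuous_on_integral_superposition \<Omega>m Fp_cont \<phi>0b Sb e z)
      then have "continuous_on UNIV (\<lambda>c::nat \<Rightarrow> real. Np (\<Sum>i<n. c i *\<^sub>R e i) z)"
        by (simp add: Np_def sum_fun_apply scaleR_fun_apply)
      then show ?thesis unfolding N_def by (intro continuous_intros)
    qed
  qed
  \<comment> \<open>The three equations share one block of quantifiers; separating them requires an
    element of each space, for which \<open>0\<close> and \<open>one\<close> serve.\<close>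
  then obtain v \<psi> \<mu> where v: "v \<in> V" and \<psi>: "\<psi> \<in> S" and \<mu>: "\<mu> \<in> S"
    and E1: "\<And>w. w \<in> V \<Longrightarrow> B v w - K w \<mu> + l w = 0"
    and E2: "\<And>\<Phi>. \<Phi> \<in> S \<Longrightarrow> Q \<psi> \<Phi> + M \<mu> \<Phi> + K v \<Phi> = 0"
    and E3: "\<And>\<Psi>. \<Psi> \<in> S \<Longrightarrow> A \<psi> \<Psi> + N \<psi> \<Psi> - Q \<mu> \<Psi> = 0"
    using one subspace_0[OF sub(1)] by blast

  \<comment> \<open>Return to the original equations\<close>
  define \<phi>h where "\<phi>h = (\<lambda>x. 1 * \<phi>0 x + 1 * \<psi> x)"
  have \<phi>h: "\<phi>h \<in> FE_space 1 \<Omega> (\<T> (k + 1))"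
    unfolding \<phi>h_def by (intro FE_space_combine \<phi>0 SF \<psi>)
  have inside: "x \<in> closure \<Omega>" if "x \<in> \<Omega>" for x using that closure_subset[of \<Omega>] by blast

  have eq1: "1 / (2 * \<tau>) * L2_inner \<Omega>
        (\<lambda>x. \<rho>_k x *\<^sub>R v x - \<rho>_prev x *\<^sub>R v_k x + \<rho>_prev x *\<^sub>R (v x - v_k x)) w
      + trilinear \<Omega> u v w
      + L2_inner \<Omega> (\<lambda>x. (2 * \<eta>_k x) *\<^sub>R symgrad \<Omega> v x) (symgrad \<Omega> w)
      - L2_inner \<Omega> (\<lambda>x. \<mu> x *\<^sub>R grad \<Omega> \<phi>_k x + \<rho>_k x *\<^sub>R g x) w = 0"
    if w: "w \<in> H_div \<Omega> (\<T> (k + 1))" for w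
  proof -
    \<comment> \<open>An arbitrary test function may be nonzero outside the closed domain. Its
      truncation lies in \<open>V\<close> and gives the same integrals, since these and
      \<open>grad\<close> see values in \<Omega> only.\<close>
    define w0 where "w0 = (\<lambda>x. if x \<in> closure \<Omega> then w x else 0)"
    have w0: "w0 \<in> V" unfolding w0_def V_def by (rule H_div_zero_ext_restrict[OF cover w])
    have ww: "w x = w0 x" if "x \<in> \<Omega>" for x using inside[OF that] by (simp add: w0_def)
    have "L2_inner \<Omega> (\<lambda>x. \<rho>_k x *\<^sub>R v x - \<rho>_prev x *\<^sub>R v_k x + \<rho>_prev x *\<^sub>R (v x - v_k x)) w =
        (LINT x|lebesgue_on \<Omega>. (\<rho>_k x + \<rho>_prev x) * (v x \<bullet> w0 x) - 2 *
          ((\<rho>_prev x *\<^sub>R v_k x) \<bullet> w0 x))"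
      unfolding L2_inner_def
      by (intro LINT_cong_on) (simp add: ww inner_add_left inner_diff_left, simp add: algebra_simps)
    also have "\<dots> = b v w0 - 2 * lv w0"
    proof -
      have "integrable (lebesgue_on \<Omega>) (\<lambda>x. (\<rho>_k x + \<rho>_prev x) * (v x \<bullet> w0 x))"
        by (intro int ess_bounded_mult ess_bounded_add \<rho>kb \<rho>pb ess_bounded_inner Vb v w0)
      moreover have "integrable (lebesgue_on \<Omega>) (\<lambda>x. (\<rho>_prev x *\<^sub>R v_k x) \<bullet> w0 x)"
        by (intro int ess_bounded_inner ess_bounded_scaleR \<rho>pb vkb Vb w0)
      ultimately show ?thesis
        unfolding b_def lv_def by (simp del: inner_scaleR_left)
    qed
    finally have 1: "L2_inner \<Omega> (\<lambda>x. \<rho>_k x *\<^sub>R v x - \<rho>_prev x *\<^sub>R v_k x +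
      \<rho>_prev x *\<^sub>R (v x - v_k x)) w = b v w0 - 2 * lv w0" .
    have "(LINT x|lebesgue_on \<Omega>. (jac \<Omega> v x *v u x) \<bullet> w x) = t v w0"
      unfolding t_def by (intro LINT_cong_on) (simp add: ww)
    moreover have "(LINT x|lebesgue_on \<Omega>. (jac \<Omega> w x *v u x) \<bullet> v x) = t w0 v"
      using jac_cong[of \<Omega> w w0, OF ww] by (simp add: t_def)
    ultimately have 2: "trilinear \<Omega> u v w = 1/2 * t v w0 + (- (1/2)) * t w0 v"
      by (simp add: trilinear_def)
    have 3: "L2_inner \<Omega> (\<lambda>x. (2 * \<eta>_k x) *\<^sub>R symgrad \<Omega> v x) (symgrad \<Omega> w) = s v w0"
      using symgrad_cong[of \<Omega> w w0, OF ww] by (simp add: L2_inner_def s_def)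
    have "L2_inner \<Omega> (\<lambda>x. \<mu> x *\<^sub>R grad \<Omega> \<phi>_k x + \<rho>_k x *\<^sub>R g x) w =
        (LINT x|lebesgue_on \<Omega>. 1 * ((w0 x \<bullet> grad \<Omega> \<phi>_k x) \<bullet> \<mu> x) + (\<rho>_k x *\<^sub>R g x) \<bullet> w0 x)"
      unfolding L2_inner_def
      by (intro LINT_cong_on) (simp add: ww inner_add_left, simp add: inner_commute mult.commute)
    also have "\<dots> = K w0 \<mu> + lg w0"
      unfolding K_def lg_def
      by (intro Bochner_Integration.integral_add gint w0 int ess_bounded_mult ess_bounded_const
        ess_bounded_inner Vb Sb g\<phi>kb \<mu>)
    finally have 4: "L2_inner \<Omega> (\<lambda>x. \<mu> x *\<^sub>R grad \<Omega> \<phi>_k x + \<rho>_k x *\<^sub>R g x) w = K w0 \<mu> + lg w0" .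
    have "1 / (2 * \<tau>) * (b v w0 - 2 * lv w0) = 1 / (2 * \<tau>) * b v w0 + (- (1 / \<tau>)) * lv w0"
      by (simp add: right_diff_distrib)
    then show ?thesis
      using E1[OF w0] unfolding 1 2 3 4 B_def l_def by linarith
  qed
  have eq2: "1 / \<tau> * L2_inner \<Omega> (\<lambda>x. \<phi>h x - \<phi>0 x) \<Phi> +
    L2_inner \<Omega> (\<lambda>x. m_k x *\<^sub>R grad \<Omega> \<mu> x) (grad \<Omega> \<Phi>)
      + L2_inner \<Omega> (\<lambda>x. v x \<bullet> grad \<Omega> \<phi>_k x) \<Phi> = 0"
    if \<Phi>: "\<Phi> \<in> FE_space 1 \<Omega> (\<T> (k + 1))" for \<Phi>
  proof -
    define \<Phi>0 where "\<Phi>0 = (\<lambda>x. if x \<in> closure \<Omega> then \<Phi> x else 0)"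
    have \<Phi>0: "\<Phi>0 \<in> S" unfolding \<Phi>0_def S_def by (rule FE_zero_ext_restrict[OF cover \<Phi>])
    have eq: "\<Phi> x = \<Phi>0 x" if "x \<in> \<Omega>" for x using inside[OF that] by (simp add: \<Phi>0_def)
    have "L2_inner \<Omega> (\<lambda>x. \<phi>h x - \<phi>0 x) \<Phi> = P0 \<psi> \<Phi>0"
      unfolding L2_inner_def P0_def by (intro LINT_cong_on) (simp add: eq \<phi>h_def)
    moreover have "L2_inner \<Omega> (\<lambda>x. m_k x *\<^sub>R grad \<Omega> \<mu> x) (grad \<Omega> \<Phi>) = M \<mu> \<Phi>0"
      using grad_cong[of \<Omega> \<Phi> \<Phi>0, OF eq] by (simp add: L2_inner_def M_def)
    moreover have "L2_inner \<Omega> (\<lambda>x. v x \<bullet> grad \<Omega> \<phi>_k x) \<Phi> = K v \<Phi>0"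
      unfolding L2_inner_def K_def by (intro LINT_cong_on) (simp add: eq)
    ultimately show ?thesis using E2[OF \<Phi>0] by (simp add: Q_def)
  qed
  have eq3: "\<sigma> * \<epsilon> * L2_inner \<Omega> (grad \<Omega> \<phi>h) (grad \<Omega> \<Psi>)
      + L2_inner \<Omega> (\<lambda>x. deriv Fp (\<phi>h x) + deriv Fm (\<phi>0 x)) \<Psi> - L2_inner \<Omega> \<mu> \<Psi> = 0"
    if \<Psi>: "\<Psi> \<in> FE_space 1 \<Omega> (\<T> (k + 1))" for \<Psi>
  proof -
    define \<Psi>0 where "\<Psi>0 = (\<lambda>x. if x \<in> closure \<Omega> then \<Psi> x else 0)"
    have \<Psi>0: "\<Psi>0 \<in> S" unfolding \<Psi>0_def S_def by (rule FE_zero_ext_restrict[OF cover \<Psi>])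
    have eq: "\<Psi> x = \<Psi>0 x" if "x \<in> \<Omega>" for x using inside[OF that] by (simp add: \<Psi>0_def)
    have geq: "grad \<Omega> \<Psi> = grad \<Omega> \<Psi>0" by (rule grad_cong) (rule eq)
    have "AE x in lebesgue_on \<Omega>. grad \<Omega> \<phi>h x \<bullet> grad \<Omega> \<Psi>0 x =
        1 * (grad \<Omega> \<phi>0 x \<bullet> grad \<Omega> \<Psi>0 x) + 1 * (1 * (grad \<Omega> \<psi> x \<bullet> grad \<Omega> \<Psi>0 x))"
      using fe.FE_grad_combine[OF \<phi>0 SF[OF \<psi>], of 1 1] unfolding \<phi>h_def
      by eventually_elim (simp add: inner_add_left)
    then have 1: "L2_inner \<Omega> (grad \<Omega> \<phi>h) (grad \<Omega> \<Psi>) = 1 * Ng \<Psi>0 + 1 * A0 \<psi> \<Psi>0"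
      unfolding L2_inner_def geq Ng_def A0_def
      by (intro LINT_combine_AE[OF \<Omega>s] int ess_bounded_mult ess_bounded_const ess_bounded_inner \<phi>0b
        Sgb \<psi> \<Psi>0)
    have "L2_inner \<Omega> (\<lambda>x. deriv Fp (\<phi>h x) + deriv Fm (\<phi>0 x)) \<Psi> =
        (LINT x|lebesgue_on \<Omega>. deriv Fp (\<phi>0 x + \<psi> x) \<bullet> \<Psi>0 x + deriv Fm (\<phi>0 x) \<bullet> \<Psi>0 x)"
      unfolding L2_inner_def by (intro LINT_cong_on) (simp add: eq \<phi>h_def algebra_simps)
    also have "\<dots> = Np \<psi> \<Psi>0 + Nm \<Psi>0"
      unfolding Np_def Nm_def
      by (intro Bochner_Integration.integral_add int ess_bounded_inner Fpb Fmb Sb \<psi> \<Psi>0)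
    finally have 2: "L2_inner \<Omega> (\<lambda>x. deriv Fp (\<phi>h x) + deriv Fm (\<phi>0 x)) \<Psi> = Np \<psi> \<Psi>0 + Nm \<Psi>0" .
    have 3: "L2_inner \<Omega> \<mu> \<Psi> = P0 \<mu> \<Psi>0"
      unfolding L2_inner_def P0_def by (intro LINT_cong_on) (simp add: eq)
    \<comment> \<open>Undoes the division of the third equation by \<tau>.\<close>
    have "\<tau> * (A \<psi> \<Psi>0 + N \<psi> \<Psi>0 - Q \<mu> \<Psi>0) = 0" using E3[OF \<Psi>0] by simp
    moreover have "\<tau> * (A \<psi> \<Psi>0 + N \<psi> \<Psi>0 - Q \<mu> \<Psi>0) =
        \<sigma> * \<epsilon> * (1 * Ng \<Psi>0 + 1 * A0 \<psi> \<Psi>0) + (Np \<psi> \<Psi>0 + Nm \<Psi>0) - P0 \<mu> \<Psi>0"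
      using constants(3) by (simp add: A_def N_def Q_def field_simps)
    ultimately show ?thesis unfolding 1 2 3 by simp
  qed
  show ?thesis
    by (intro bexI[OF _ VH[OF v]] bexI[OF _ \<phi>h] bexI[OF _ SF[OF \<mu>]] ballI conjI)
      (use eq1 eq2 eq3 in \<open>simp_all add: \<phi>0_def u_def\<close>)
qed

end
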